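(* Let $V(r)$ be a two-Higgs-doublet potential on $LC^+$ with $\Lambda_{\mu\nu}$ non-singular and $\Lambda_{\mu\nu} r^\mu r^\nu>0$ for all $r\in LC^+\setminus\{0\}$, and suppose that the base point $m_\mu=(\Lambda^{-1})_{\mu\nu}M^\nu$ lies (strictly) inside the forward lightcone $LC^+$. Let $\mathcal{V}$ be the valley of the potential. Then the topology of $\mathcal{V}$, which coincides up to homotopy with the topology of the bottom of the valley, is determined by the number of positive spacelike eigenvalues $\Lambda_1,\Lambda_2,\Lambda_3$ of $\Lambda_{\mu\nu}$: (i) if all three $\Lambda_i$ are positive, then the valley is simply connected and homotopy equivalent to the 2-sphere $S^2$, with $\pi_2(\mathcal{V})=\mathbb{Z}$; (ii) if exactly two of the $\Lambda_i$ are positive, then the valley is connected but not simply connected; it is homotopy equivalent to the circle $S^1$, with $\pi_1(\mathcal{V})=\mathbb{Z}$; (iii) if exactly one of the $\Lambda_i$ is positive, then the valley is disconnected; it has two connected components, each of which is simply connected.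
   Context: Work in $\mathbb{R}^4$ with coordinates $r^\mu = (r_0, r_1, r_2, r_3)$ and Minkowski metric $g = \mathrm{diag}(1,-1,-1,-1)$. The orbit space is the closed forward lightcone (surface and interior) $LC^+ = \{ r \in \mathbb{R}^4 : r_0 \ge 0,\ r_0^2 - r_1^2 - r_2^2 - r_3^2 \ge 0\}$; its surface is the subset where $r_0^2 - r_1^2 - r_2^2 - r_3^2 = 0$ and its (strict) inside is the subset where $r_0>0$ and $r_0^2 - r_1^2 - r_2^2 - r_3^2 > 0$. The potential is $V(r) = -M_\mu r^\mu + \frac12 \Lambda_{\mu\nu} r^\mu r^\nu$ with $M_\mu$ a real four-vector and $\Lambda_{\mu\nu}$ a real symmetric tensor. For non-singular $\Lambda_{\mu\nu}$ it can be written as $V=\frac12\Lambda_{\mu\nu}(r^\mu-m^\mu)(r^\nu-m^\nu)+V_0$, where the base point $m$ is the unique solution of $\Lambda_{\mu\nu}m^\nu=M_\mu$ and $V_0=-\frac12(\Lambda^{-1})_{\mu\nu}M^\mu M^\nu$. The positivity assumption on $\Lambda_{\mu\nu}$ is equivalent to the existence of a proper Lorentz frame in which $\Lambda_{\mu\nu} = \mathrm{diag}(\Lambda_0,-\Lambda_1,-\Lambda_2,-\Lambda_3)$, so that $\Lambda_{\mu\nu}p^\mu p^\nu=\Lambda_0p_0^2-\sum_i\Lambda_ip_i^2$, with $\Lambda_0>0$ and $\Lambda_0>\Lambda_1,\Lambda_2,\Lambda_3$; the numbers $\Lambda_1,\Lambda_2,\Lambda_3$ are the spacelike eigenvalues.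 Non-singular means all $\Lambda_i\neq0$. The valley of the potential is $\mathcal{V}=\{r\in LC^+ : \Lambda_{\mu\nu}(r^\mu-m^\mu)(r^\nu-m^\nu)<0\}$, and the bottom of the valley is the intersection of $\mathcal{V}$ with the surface of $LC^+$. *)

theory Defs
  imports "HOL-Analysis.Analysis" "HOL-Algebra.Elementary_Groups"
begin

section \<open>Orbit space and potential\<close>

text \<open>
  The coordinates \<open>r\<^sup>0, r\<^sup>1, r\<^sup>2, r\<^sup>3\<close> are \<open>r $ 0, r $ 1, r $ 2, r $ 3\<close>; in the index type \<open>4\<close>
  (integers modulo 4) the element \<open>4\<close> used by library lemmas such as \<open>sum_4\<close> is \<open>0\<close>.
  The vector \<open>M\<close> and the matrix \<open>\<Lambda>\<close> hold the covariant components \<open>M\<^sub>\<mu>\<close> and \<open>\<Lambda>\<^sub>\<mu>\<^sub>\<nu>\<close>, while points \<open>r\<close>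
  hold contravariant ones, so the contractions below are plain coordinate sums.
\<close>

definition minkowski_metric :: "real^4^4" where
  "minkowski_metric = (\<chi> i j. if i = j then (if i = 0 then 1 else - 1) else 0)"

definition minkowski_sq :: "real^4 \<Rightarrow> real" where
  "minkowski_sq r = (r $ 0)\<^sup>2 - (r $ 1)\<^sup>2 - (r $ 2)\<^sup>2 - (r $ 3)\<^sup>2"

definition LC_plus :: "(real^4) set" where
  "LC_plus = {r. 0 \<le> r $ 0 \<and> 0 \<le> minkowski_sq r}"

definition LC_surface :: "(real^4) set" where
  "LC_surface = {r \<in> LC_plus. minkowski_sq r = 0}"

definition LC_inside :: "(real^4) set" where
  "LC_inside = {r. 0 < r $ 0 \<and> 0 < minkowski_sq r}"

definition qform :: "real^4^4 \<Rightarrow> real^4 \<Rightarrow> real" where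
  "qform \<Lambda> p = (\<Sum>\<mu>\<in>UNIV. \<Sum>\<nu>\<in>UNIV. \<Lambda> $ \<mu> $ \<nu> * p $ \<mu> * p $ \<nu>)"

definition potential :: "real^4 \<Rightarrow> real^4^4 \<Rightarrow> real^4 \<Rightarrow> real" where
  "potential M \<Lambda> r = - (\<Sum>\<mu>\<in>UNIV. M $ \<mu> * r $ \<mu>) + qform \<Lambda> r / 2"

text \<open>Meaningful for invertible \<open>\<Lambda>\<close> only.\<close>

definition base_point :: "real^4 \<Rightarrow> real^4^4 \<Rightarrow> real^4" where
  "base_point M \<Lambda> = matrix_inv \<Lambda> *v M"

definition valley :: "real^4 \<Rightarrow> real^4^4 \<Rightarrow> (real^4) set" where
  "valley M \<Lambda> = {r \<in> LC_plus. qform \<Lambda> (r - base_point M \<Lambda>) < 0}"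

definition valley_bottom :: "real^4 \<Rightarrow> real^4^4 \<Rightarrow> (real^4) set" where
  "valley_bottom M \<Lambda> = valley M \<Lambda> \<inter> LC_surface"

lemma qform_inner: "qform \<Lambda> p = p \<bullet> (\<Lambda> *v p)"
  by (simp add: qform_def inner_vec_def matrix_vector_mult_def sum_distrib_left algebra_simps)

lemma base_point_unique:
  assumes "invertible \<Lambda>"
  shows "\<Lambda> *v m = M \<longleftrightarrow> m = base_point M \<Lambda>"
proof -
  have inv: "\<Lambda> ** matrix_inv \<Lambda> = mat 1" "matrix_inv \<Lambda> ** \<Lambda> = mat 1"
    using assms someI_ex[of "\<lambda>B. \<Lambda> ** B = mat 1 \<and> B ** \<Lambda> = mat 1"]
    by (auto simp: invertible_def matrix_inv_def)
  show ?thesis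
    by (metis base_point_def inv matrix_vector_mul_assoc matrix_vector_mul_lid)
qed

lemma potential_eq_base_point:
  assumes "transpose \<Lambda> = \<Lambda>" "invertible \<Lambda>"
  shows "potential M \<Lambda> r =
    qform \<Lambda> (r - base_point M \<Lambda>) / 2 - M \<bullet> (matrix_inv \<Lambda> *v M) / 2"
proof -
  let ?m = "base_point M \<Lambda>"
  have M: "\<Lambda> *v ?m = M"
    using base_point_unique[OF assms(2)] by blast
  have "?m \<bullet> (\<Lambda> *v r) = M \<bullet> r"
    by (metis M assms(1) dot_lmul_matrix transpose_matrix_vector)
  then have "qform \<Lambda> (r - ?m) = qform \<Lambda> r - 2 * (M \<bullet> r) + M \<bullet> ?m"
    by (simp add: qform_inner matrix_vector_mult_diff_distrib inner_diff_left inner_diff_right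
        M inner_commute)
  moreover have "potential M \<Lambda> r = - (M \<bullet> r) + qform \<Lambda> r / 2"
    by (simp add: potential_def inner_vec_def)
  ultimately show ?thesis
    by (simp add: base_point_def field_simps)
qed

lemma valley_iff_potential:
  assumes "transpose \<Lambda> = \<Lambda>" "invertible \<Lambda>"
  shows "valley M \<Lambda> = {r \<in> LC_plus. potential M \<Lambda> r < potential M \<Lambda> (base_point M \<Lambda>)}"
  by (simp add: valley_def potential_eq_base_point[OF assms] qform_def)


section \<open>Lorentz frames and spacelike eigenvalues\<close>

definition proper_lorentz :: "real^4^4 \<Rightarrow> bool" where
  "proper_lorentz S \<longleftrightarrow>
     transpose S ** minkowski_metric ** S = minkowski_metric \<and> det S = 1 \<and> 0 < S $ 0 $ 0"

text \<open>
  The columns of \<open>S\<close> are the basis vectors of a frame in which \<open>\<Lambda>\<close> has the covariant components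
  \<open>diag (L\<^sub>0, -L\<^sub>1, -L\<^sub>2, -L\<^sub>3)\<close>; the spacelike eigenvalues are \<open>L $ 1, L $ 2, L $ 3\<close>.
\<close>

definition lorentz_eigenvalues :: "real^4^4 \<Rightarrow> real^4 \<Rightarrow> bool" where
  "lorentz_eigenvalues \<Lambda> L \<longleftrightarrow>
     (\<exists>S. proper_lorentz S \<and>
        transpose S ** \<Lambda> ** S =
          (\<chi> i j. if i = j then (if i = 0 then L $ i else - L $ i) else 0)) \<and>
     0 < L $ 0 \<and> (\<forall>i\<in>{1, 2, 3}. L $ i < L $ 0)"

definition num_pos_spacelike :: "real^4 \<Rightarrow> nat" where
  "num_pos_spacelike L = card {i \<in> {1, 2, 3}. 0 < L $ i}"


section \<open>The first two homotopy groups\<close>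

text \<open>
  Elements are homotopy classes of loops at \<open>a\<close>, relative to the endpoints; the product of two
  classes is the class of the concatenation of any representatives.
\<close>

definition fundamental_group :: "'a::real_normed_vector set \<Rightarrow> 'a \<Rightarrow> (real \<Rightarrow> 'a) set monoid" where
  "fundamental_group X a =
     \<lparr>carrier = {p. path p \<and> path_image p \<subseteq> X \<and> pathstart p = a \<and> pathfinish p = a}
                  // {(p, q). homotopic_paths X p q},
      monoid.mult = (\<lambda>P Q. \<Union>p\<in>P. \<Union>q\<in>Q. {r. homotopic_paths X (p +++ q) r}),
      one = {r. homotopic_paths X (linepath a a) r}\<rparr>"

abbreviation unit_square :: "(real \<times> real) set" where
  "unit_square \<equiv> {0..1} \<times> {0..1}"

definition spheroids :: "'a::topological_space set \<Rightarrow> 'a \<Rightarrow> (real \<times> real \<Rightarrow> 'a) set" where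
  "spheroids X a =
     {f. continuous_on unit_square f \<and> f ` unit_square \<subseteq> X \<and> (\<forall>z\<in>frontier unit_square. f z = a)}"

definition homotopic_spheroids ::
    "'a::topological_space set \<Rightarrow> 'a \<Rightarrow> (real \<times> real \<Rightarrow> 'a) \<Rightarrow> (real \<times> real \<Rightarrow> 'a) \<Rightarrow> bool" where
  "homotopic_spheroids X a =
     homotopic_with_canon (\<lambda>h. \<forall>z\<in>frontier unit_square. h z = a) unit_square X"

definition join_spheroids :: "(real \<times> real \<Rightarrow> 'a) \<Rightarrow> (real \<times> real \<Rightarrow> 'a) \<Rightarrow> real \<times> real \<Rightarrow> 'a" where
  "join_spheroids f g = (\<lambda>(s, t). if s \<le> 1/2 then f (2 * s, t) else g (2 * s - 1, t))"

definition second_homotopy_group ::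
    "'a::topological_space set \<Rightarrow> 'a \<Rightarrow> (real \<times> real \<Rightarrow> 'a) set monoid" where
  "second_homotopy_group X a =
     \<lparr>carrier = spheroids X a // {(f, g). homotopic_spheroids X a f g},
      monoid.mult = (\<lambda>F G. \<Union>f\<in>F. \<Union>g\<in>G. {h. homotopic_spheroids X a (join_spheroids f g) h}),
      one = {h. homotopic_spheroids X a (\<lambda>_. a) h}\<rparr>"

end

theory Submission
  imports Defs
begin

text \<open>
  Let \<open>m\<close> be the base point and choose a Lorentz frame that diagonalises \<open>\<Lambda>\<close>.  After rescaling the
  axes, \<open>\<Lambda> < 0\<close> becomes \<open>norm v < norm u\<close>, where \<open>u\<close> collects the coordinates with positive spacelike
  eigenvalue and \<open>v\<close> the others.  Sending \<open>r\<close> to the direction of \<open>u (r - m)\<close> fibres the valley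
  over the unit sphere of the \<open>u\<close>-space.  The fibres are convex because the light cone is, and every point of the
  valley lies on a section, so that the sphere is a strong deformation retract relative to any chosen
  base point.  The bottom is a deformation retract because \<open>\<Lambda> < 0\<close> forces \<open>r - m\<close> to be spacelike, so the
  ray from \<open>m\<close> through \<open>r\<close> leaves the light cone at exactly one point.

  For \<open>\<pi>\<^sub>2(S\<^sup>2) = \<int>\<close>, maps of cubes into \<open>S\<^sup>2\<close> are lifted through the Hopf map; a lift of a spheroid, normalised on
  three sides of the square, runs along a fibre circle on the fourth side, and its winding number is the
  degree.  Equal degrees give a homotopy because maps from the boundary of a 3-cube to \<open>S\<^sup>3\<close> extend over the cube.

  The frame is found by maximising \<open>g / \<Lambda>\<close> over the light cone (\<open>g\<close> the Minkowski form), and then \<open>\<Lambda> / (- g)\<close> on the orthogonal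
  complements of the vectors found so far.
\<close>

section \<open>The Hopf map\<close>

text \<open>Two demands shape the proof. The groups are wanted at every point \<open>a\<close> of
  the valley, and a free homotopy may move base points; so the section is built anew for each
  \<open>a\<close>, through \<open>a\<close>, and the straight-line homotopies then keep
  \<open>a\<close> fixed. And the degree of maps into S^2 must be complete as well as invariant:
  after lifting to C^2 without 0 it is a matter of logarithms of functions without zeros on convex
  sets, and the lifts take values in a space where every boundary of a 3-cube can be filled.

  The formulas around the Hopf map come from one dictionary. A unit vector (t, w) is the Hermitian
  involution with rows (t, w) and (cnj w, -t); its line is the eigenspace for 1, the line of the
  antipode is the eigenspace for -1, and \<open>line_proj\<close> is the identity plus this
  involution.

  That the base point is strictly inside gives the room for the deformations: every direction from
  it can be followed for a while within the light cone, so a point that falls outside can be pulled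
  back towards it.\<close>

definition cscale :: "complex \<Rightarrow> complex \<times> complex \<Rightarrow> complex \<times> complex" where
  "cscale c v = (c * fst v, c * snd v)"

text \<open>Dividing by the squared norm extends the Hopf map from the unit sphere to all nonzero
  vectors of C^2, constant on punctured complex lines, so lifts need no normalisation in length.
  Division by zero sends 0 to the zero vector, which is off the sphere.\<close>

definition hopf :: "complex \<times> complex \<Rightarrow> real \<times> complex" where
  "hopf v = (((cmod (fst v))\<^sup>2 - (cmod (snd v))\<^sup>2) / (norm v)\<^sup>2,
             2 * fst v * cnj (snd v) / of_real ((norm v)\<^sup>2))"

lemma norm_sq_pair: "(norm (z :: 'a::real_normed_vector \<times> 'b::real_normed_vector))\<^sup>2 = (norm (fst z))\<^sup>2 + (norm (snd z))\<^sup>2"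
  by (simp add: norm_prod_def)

lemma cscale_eq_0_iff [simp]: "cscale c v = 0 \<longleftrightarrow> c = 0 \<or> v = 0"
  by (cases v) (auto simp: cscale_def zero_prod_def)

lemma cscale_simps [simp]:
  "cscale 1 v = v" "cscale c (cscale d v) = cscale (c * d) v" "cscale c (x, 0) = (c * x, 0)"
  by (auto simp: cscale_def)

lemma continuous_on_cscale [continuous_intros]:
  "continuous_on S f \<Longrightarrow> continuous_on S g \<Longrightarrow> continuous_on S (\<lambda>x. cscale (f x) (g x))"
  unfolding cscale_def by (intro continuous_intros)

lemma hopf_cscale:
  assumes "c \<noteq> 0" shows "hopf (cscale c v) = hopf v"
proof -
  have n: "(norm (cscale c v))\<^sup>2 = (cmod c)\<^sup>2 * (norm v)\<^sup>2"
    by (simp add: norm_sq_pair cscale_def norm_mult power_mult_distrib distrib_left)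
  have c: "c * cnj c = of_real ((cmod c)\<^sup>2)" "(cmod c)\<^sup>2 \<noteq> 0"
    using assms complex_norm_square[of c] by auto
  have "fst (hopf (cscale c v)) = fst (hopf v)"
    unfolding hopf_def n using c(2)
    by (simp add: cscale_def norm_mult power_mult_distrib flip: right_diff_distrib)
  moreover have "snd (hopf (cscale c v)) = snd (hopf v)"
  proof -
    have "snd (hopf (cscale c v)) = (c * cnj c) * (2 * fst v * cnj (snd v)) / of_real ((cmod c)\<^sup>2 * (norm v)\<^sup>2)"
      unfolding hopf_def n by (simp add: cscale_def mult_ac)
    also have "\<dots> = snd (hopf v)"
      unfolding c(1) using c(2) by (simp add: hopf_def)
    finally show ?thesis .
  qed
  ultimately show ?thesis by (simp add: prod_eq_iff)
qed

lemma hopf_in_sphere: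
  assumes "v \<noteq> 0" shows "hopf v \<in> sphere 0 1"
proof -
  have n: "(norm v)\<^sup>2 \<noteq> 0" using assms by simp
  define a b where "a = (cmod (fst v))\<^sup>2" and "b = (cmod (snd v))\<^sup>2"
  have ab: "(norm v)\<^sup>2 = a + b" by (simp add: norm_sq_pair a_def b_def)
  have f: "fst (hopf v) = (a - b) / (a + b)"
    unfolding hopf_def ab by (simp add: a_def b_def)
  have "cmod (snd (hopf v)) = 2 * cmod (fst v) * cmod (snd v) / (a + b)"
    unfolding hopf_def ab by (simp add: norm_divide norm_mult a_def b_def del: of_real_add)
  then have g: "(cmod (snd (hopf v)))\<^sup>2 = 4 * a * b / (a + b)\<^sup>2"
    by (simp add: power_divide power_mult_distrib a_def b_def)
  have "(norm (hopf v))\<^sup>2 = ((a - b) / (a + b))\<^sup>2 + 4 * a * b / (a + b)\<^sup>2"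
    unfolding norm_sq_pair[of "hopf v"] f g by (simp only: real_norm_def power2_abs)
  also have "\<dots> = 1"
  proof -
    have "(a - b)\<^sup>2 + 4 * a * b = (a + b)\<^sup>2" by (simp add: power2_eq_square algebra_simps)
    then show ?thesis using n unfolding ab by (simp add: power_divide flip: add_divide_distrib)
  qed
  finally show ?thesis by (simp add: power2_eq_1_iff) (smt (verit) norm_ge_zero)
qed

text \<open>The two linear equations say that \<open>v\<close> lies in the line that the unit vector \<open>p\<close> stands for.\<close>

definition on_line :: "real \<times> complex \<Rightarrow> complex \<times> complex \<Rightarrow> bool" where
  "on_line p v \<longleftrightarrow> of_real (1 + fst p) * snd v = cnj (snd p) * fst v \<and>
                   snd p * snd v = of_real (1 - fst p) * fst v"

text \<open>The two equations, one of them conjugated, combine to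
  \<open>w * of_real n = 2 * z1 * cnj z2\<close>, because the terms in t cancel; comparing the two
  expressions for \<open>w * cnj z1 * z2\<close> gives the first coordinate.\<close>

lemma hopf_eq_of_on_line:
  assumes "on_line p v" "v \<noteq> 0"
  shows "hopf v = p"
proof -
  obtain z1 z2 where v: "v = (z1, z2)" by fastforce
  obtain t w where p: "p = (t, w)" by fastforce
  define n where "n = (cmod z1)\<^sup>2 + (cmod z2)\<^sup>2"
  have n: "(norm v)\<^sup>2 = n" by (simp add: norm_sq_pair v n_def)
  have n0: "n \<noteq> 0" using assms(2) unfolding n[symmetric] by simp
  have nc: "of_real n = z1 * cnj z1 + z2 * cnj z2"
    by (simp add: n_def flip: complex_norm_square)
  have e1: "of_real (1 + t) * z2 = cnj w * z1" and e2: "w * z2 = of_real (1 - t) * z1"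
    using assms(1) by (auto simp: on_line_def v p)
  have e1': "of_real (1 + t) * cnj z2 = w * cnj z1" 
    using arg_cong[OF e1, of cnj] by simp
  have w: "w * of_real n = 2 * z1 * cnj z2"
  proof -
    have "w * of_real n = z1 * (w * cnj z1) + (w * z2) * cnj z2"
      unfolding nc by (simp add: algebra_simps)
    then show ?thesis unfolding e1'[symmetric] e2 by (simp add: algebra_simps)
  qed
  have "of_real (t * n) = (of_real ((cmod z1)\<^sup>2 - (cmod z2)\<^sup>2) :: complex)"
  proof -
    have "of_real (1 + t) * cnj z2 * z2 = of_real (1 - t) * z1 * cnj z1"
      unfolding e1' e2[symmetric] by (simp add: mult_ac)
    then have "of_real t * (z1 * cnj z1 + z2 * cnj z2) = z1 * cnj z1 - z2 * cnj z2"
      by (simp add: algebra_simps)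
    then have "of_real t * of_real n = (of_real ((cmod z1)\<^sup>2) - of_real ((cmod z2)\<^sup>2) :: complex)"
      unfolding nc[symmetric] complex_norm_square .
    then show ?thesis by (simp only: of_real_mult of_real_diff)
  qed
  then have t: "t * n = (cmod z1)\<^sup>2 - (cmod z2)\<^sup>2" using of_real_eq_iff by blast
  show ?thesis
    unfolding hopf_def n using t[symmetric] w[symmetric] n0 by (simp add: v p)
qed

lemma on_line_hopf:
  assumes "v \<noteq> 0" shows "on_line (hopf v) v"
proof -
  obtain z1 z2 where v: "v = (z1, z2)" by fastforce
  define n where "n = (cmod z1)\<^sup>2 + (cmod z2)\<^sup>2"
  have n: "(norm v)\<^sup>2 = n" by (simp add: norm_sq_pair v n_def)
  have n0: "n \<noteq> 0" using assms unfolding n[symmetric] by simp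
  have 1: "1 + fst (hopf v) = 2 * (cmod z1)\<^sup>2 / n" "1 - fst (hopf v) = 2 * (cmod z2)\<^sup>2 / n"
    unfolding hopf_def n using n0 by (simp_all add: v field_simps) (simp_all add: n_def)
  have 2: "snd (hopf v) = 2 * z1 * cnj z2 / of_real n"
    unfolding hopf_def n by (simp add: v)
  have 3: "of_real (2 * (cmod z1)\<^sup>2 / n) = 2 * (z1 * cnj z1) / complex_of_real n"
    "of_real (2 * (cmod z2)\<^sup>2 / n) = 2 * (z2 * cnj z2) / complex_of_real n"
    unfolding complex_norm_square[symmetric] by simp_all
  show ?thesis
    unfolding on_line_def 1 2 3 by (simp add: v mult_ac)
qed

text \<open>Both vectors solve the same pair of linear equations, so the determinant
  \<open>z2 * y1 - z1 * y2\<close> vanishes and they are proportional. The factor is a Hermitian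
  product over a squared norm, a form that is visibly continuous when the two lifts vary.\<close>

lemma hopf_fibre:
  assumes "v \<noteq> 0" "v' \<noteq> 0" "hopf v = hopf v'"
  defines "c \<equiv> (fst v' * cnj (fst v) + snd v' * cnj (snd v)) / of_real ((norm v)\<^sup>2)"
  shows "v' = cscale c v" "c \<noteq> 0"
proof -
  obtain z1 z2 where v: "v = (z1, z2)" by fastforce
  obtain y1 y2 where v': "v' = (y1, y2)" by fastforce
  obtain t w where p: "hopf v = (t, w)" by fastforce
  have e: "of_real (1 + t) * z2 = cnj w * z1" "w * z2 = of_real (1 - t) * z1"
    using on_line_hopf[OF assms(1)] unfolding p by (auto simp: on_line_def v)
  have e': "of_real (1 + t) * y2 = cnj w * y1" "w * y2 = of_real (1 - t) * y1"
    using on_line_hopf[OF assms(2)] unfolding assms(3)[symmetric] p by (auto simp: on_line_def v')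
  have "2 * (z2 * y1) = of_real (1 + t) * z2 * y1 + z2 * (of_real (1 - t) * y1)"
    by (simp add: algebra_simps)
  also have "\<dots> = z1 * (cnj w * y1) + (w * z2) * y2"
    unfolding e(1) e'(2)[symmetric] by (simp only: mult_ac)
  also have "\<dots> = 2 * (z1 * y2)"
    unfolding e(2) e'(1)[symmetric] by (simp add: algebra_simps)
  finally have d: "z2 * y1 = z1 * y2" by simp
  have nc: "of_real ((norm v)\<^sup>2) = z1 * cnj z1 + z2 * cnj z2"
    by (simp add: norm_sq_pair v flip: complex_norm_square)
  have n0: "z1 * cnj z1 + z2 * cnj z2 \<noteq> 0" using assms(1) unfolding nc[symmetric] by simp
  have "(y1 * cnj z1 + y2 * cnj z2) * z1 = y1 * (z1 * cnj z1 + z2 * cnj z2)"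
    using d by (simp add: algebra_simps)
  moreover have "(y1 * cnj z1 + y2 * cnj z2) * z2 = y2 * (z1 * cnj z1 + z2 * cnj z2)"
  proof -
    have "(y1 * cnj z1 + y2 * cnj z2) * z2 = (z2 * y1) * cnj z1 + y2 * cnj z2 * z2"
      by (simp add: algebra_simps)
    then show ?thesis unfolding d by (simp add: algebra_simps)
  qed
  ultimately show "v' = cscale c v"
    unfolding c_def nc using n0 by (simp add: v v' cscale_def)
  then show "c \<noteq> 0" using assms(2) by auto
qed

lemma sphere_pair_snd:
  assumes "(p :: real \<times> complex) \<in> sphere 0 1"
  shows "snd p * cnj (snd p) = of_real ((1 - fst p) * (1 + fst p))"
proof -
  have "(cmod (snd p))\<^sup>2 = (1 - fst p) * (1 + fst p)"
    using assms norm_sq_pair[of p] by (simp add: algebra_simps power2_eq_square)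
  then show ?thesis by (metis complex_norm_square)
qed

lemma hopf_surj:
  assumes "p \<in> sphere 0 1" obtains v where "v \<noteq> 0" "hopf v = p"
proof -
  obtain t w where p: "p = (t, w)" by fastforce
  have ww: "w * cnj w = of_real ((1 - t) * (1 + t))"
    using sphere_pair_snd[of p] assms by (simp only: p fst_conv snd_conv)
  show thesis
  \<comment> \<open>The vector \<open>(1 + t, cnj w)\<close> lies on the line of p but vanishes at
    the pole \<open>(-1, 0)\<close>, whose line is spanned by \<open>(0, 1)\<close>.\<close>
  proof (cases "t = -1")
    case True
    then have "w = 0" using ww by simp
    then show ?thesis
      by (intro that[of "(0, 1)"] hopf_eq_of_on_line) (auto simp: on_line_def p True zero_prod_def)
  next
    case False
    then have "of_real (1 + t) \<noteq> (0::complex)" by (metis add_eq_0_iff of_real_eq_0_iff)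
    then show ?thesis
      using ww by (intro that[of "(of_real (1 + t), cnj w)"] hopf_eq_of_on_line)
        (auto simp: on_line_def p zero_prod_def)
  qed
qed

text \<open>Twice the orthogonal projection of \<open>v\<close> onto the line of \<open>p\<close>.\<close>

definition line_proj :: "real \<times> complex \<Rightarrow> complex \<times> complex \<Rightarrow> complex \<times> complex" where
  "line_proj p v = (of_real (1 + fst p) * fst v + snd p * snd v,
                    cnj (snd p) * fst v + of_real (1 - fst p) * snd v)"

text \<open>With s for the involution of p, \<open>line_proj p v\<close> is (1 + s) v. It vanishes
  only if s v = -v, that is, if v is on the line of \<open>- p\<close>; and it lies on the line of p
  since (1 - s)(1 + s) = 0, which in coordinates is
  \<open>w * cnj w = (1 - t) * (1 + t)\<close>.\<close>

lemma hopf_line_proj: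
  assumes p: "p \<in> sphere 0 1" and v: "v \<noteq> 0" and np: "hopf v \<noteq> - p"
  shows "line_proj p v \<noteq> 0" "hopf (line_proj p v) = p"
proof -
  obtain t w where p': "p = (t, w)" by fastforce
  have ww: "w * cnj w = of_real ((1 - t) * (1 + t))"
    using sphere_pair_snd[of p] p by (simp only: p' fst_conv snd_conv)
  show *: "line_proj p v \<noteq> 0"
  proof
    assume "line_proj p v = 0"
    then have "of_real (1 + t) * fst v + w * snd v = 0" "cnj w * fst v + of_real (1 - t) * snd v = 0"
      by (simp_all add: line_proj_def p' prod_eq_iff)
    then have "w * snd v = - (of_real (1 + t) * fst v)" "cnj w * fst v = - (of_real (1 - t) * snd v)"
      by (simp_all add: add_eq_0_iff)
    then have "on_line (- p) v" by (simp add: on_line_def p')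
    then show False using hopf_eq_of_on_line v np by blast
  qed
  have "on_line p (line_proj p v)"
  proof -
    have "of_real (1 + t) * (cnj w * fst v + of_real (1 - t) * snd v) =
      cnj w * (of_real (1 + t) * fst v) + (w * cnj w) * snd v"
      unfolding ww by (simp add: algebra_simps)
    moreover have "of_real (1 - t) * (of_real (1 + t) * fst v + w * snd v) =
      (w * cnj w) * fst v + of_real (1 - t) * (w * snd v)"
      unfolding ww by (simp add: algebra_simps)
    ultimately show ?thesis
      unfolding on_line_def line_proj_def p' fst_conv snd_conv by (simp only: algebra_simps)
  qed
  then show "hopf (line_proj p v) = p"
    using * hopf_eq_of_on_line by blast
qed

lemma continuous_on_hopf [continuous_intros]:
  assumes "continuous_on S f" "\<And>x. x \<in> S \<Longrightarrow> f x \<noteq> 0"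
  shows "continuous_on S (\<lambda>x. hopf (f x))"
proof -
  have n: "(norm (f x))\<^sup>2 \<noteq> 0" "complex_of_real ((norm (f x))\<^sup>2) \<noteq> 0" if "x \<in> S" for x
    using assms(2)[OF that] by simp_all
  show ?thesis
    unfolding hopf_def by (intro continuous_intros assms(1)) (use n in blast)+
qed

lemma hopf_pole [simp]: "z \<noteq> 0 \<Longrightarrow> hopf (z, 0) = (1, 0)"
  by (rule hopf_eq_of_on_line) (auto simp: on_line_def zero_prod_def)

lemma hopf_eq_pole_imp:
  assumes "hopf v = (1, 0)" "v \<noteq> 0" shows "snd v = 0" "fst v \<noteq> 0"
proof -
  show "snd v = 0" using on_line_hopf[OF assms(2)] by (simp add: on_line_def assms(1))
  then show "fst v \<noteq> 0" using assms(2) by (auto simp: prod_eq_iff)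
qed

text \<open>
  \<open>f\<close> is deformed from a constant map in steps so short that consecutive values are never antipodal;
  then the lift of one step projects to a nowhere vanishing lift of the next.
\<close>

lemma hopf_lift:
  fixes f :: "'a::euclidean_space \<Rightarrow> real \<times> complex"
  assumes "compact X" "convex X" and contf: "continuous_on X f" and im: "f ` X \<subseteq> sphere 0 1"
  obtains F where "continuous_on X F" "\<And>x. x \<in> X \<Longrightarrow> F x \<noteq> 0" "\<And>x. x \<in> X \<Longrightarrow> hopf (F x) = f x"
proof (cases "X = {}")
  case True then show thesis using that by auto
next
  case False
  then obtain x0 where x0: "x0 \<in> X" by blast
  have "uniformly_continuous_on X f" using compact_uniformly_continuous contf \<open>compact X\<close> by blast
  \<comment> \<open>Antipodal unit vectors are at distance 2, so the bound 1 keeps consecutive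
    values away from antipodes.\<close>
  then obtain d where d: "d > 0" "\<And>x x'. x \<in> X \<Longrightarrow> x' \<in> X \<Longrightarrow> dist x' x < d \<Longrightarrow> dist (f x') (f x) < 1"
    unfolding uniformly_continuous_on_def by (metis zero_less_one)
  obtain B where B: "B > 0" "\<And>x. x \<in> X \<Longrightarrow> norm (x - x0) \<le> B"
  proof -
    have "bounded ((\<lambda>x. x - x0) ` X)"
      using \<open>compact X\<close> by (simp add: bounded_translation_minus compact_imp_bounded)
    then show thesis using that by (auto simp: bounded_pos)
  qed
  obtain N where N: "N > 0" "B < d * real N"
  proof -
    obtain n :: nat where "B / d < real n" using reals_Archimedean2 by blast
    then have "B < d * real (Suc n)" using d(1) by (simp add: field_simps)
    then show thesis using that by blast
  qed
  \<comment> \<open>Convexity lets X contract to \<open>x0\<close> along segments, in N equal steps;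
    each step moves a point by at most \<open>B / N < d\<close>.\<close>
  define pt where "pt j x = x0 + (real j / real N) *\<^sub>R (x - x0)" for j x
  have ptX: "pt j x \<in> X" if "j \<le> N" "x \<in> X" for j x
  proof -
    have "pt j x = (1 - real j / real N) *\<^sub>R x0 + (real j / real N) *\<^sub>R x"
      by (simp add: pt_def algebra_simps)
    then show ?thesis using \<open>convex X\<close> x0 that N(1)
      by (simp add: convexD_alt)
  qed
  have cpt: "continuous_on X (\<lambda>x. f (pt j x))" if "j \<le> N" for j
    by (rule continuous_on_compose2[OF contf])
      (use ptX that in \<open>auto simp: pt_def intro!: continuous_intros\<close>)
  have "\<exists>F. continuous_on X F \<and> (\<forall>x\<in>X. F x \<noteq> 0 \<and> hopf (F x) = f (pt j x))" if "j \<le> N" for j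
    using that
  proof (induction j)
    case 0
    have "f x0 \<in> sphere 0 1" using im x0 by blast
    then obtain v where "v \<noteq> 0" "hopf v = f x0" using hopf_surj by blast
    then show ?case by (intro exI[of _ "\<lambda>_. v"]) (auto simp: pt_def)
  next
    case (Suc j)
    then obtain F where F: "continuous_on X F" "\<And>x. x \<in> X \<Longrightarrow> F x \<noteq> 0 \<and> hopf (F x) = f (pt j x)"
      by (meson Suc_leD)
    have *: "line_proj (f (pt (Suc j) x)) (F x) \<noteq> 0 \<and>
             hopf (line_proj (f (pt (Suc j) x)) (F x)) = f (pt (Suc j) x)" if "x \<in> X" for x
    proof -
      have S: "f (pt (Suc j) x) \<in> sphere 0 1" using im ptX Suc.prems that by blast
      have "pt (Suc j) x - pt j x = (1 / real N) *\<^sub>R (x - x0)"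
        by (simp add: pt_def add_divide_distrib algebra_simps)
      then have "dist (pt (Suc j) x) (pt j x) = norm (x - x0) / real N"
        by (simp add: dist_norm)
      also have "\<dots> < d" using B(2)[OF that] N by (simp add: field_simps)
      finally have *: "dist (f (pt (Suc j) x)) (f (pt j x)) < 1"
        using d(2) ptX that Suc.prems by (meson Suc_leD)
      have "hopf (F x) \<noteq> - f (pt (Suc j) x)"
      proof
        assume "hopf (F x) = - f (pt (Suc j) x)"
        then have "f (pt j x) = - f (pt (Suc j) x)" using F(2) that by metis
        then have "dist (f (pt (Suc j) x)) (f (pt j x)) = norm (2 *\<^sub>R f (pt (Suc j) x))"
          by (simp only: dist_norm scaleR_2 diff_minus_eq_add)
        then show False using * S by simp
      qed
      then show ?thesis using hopf_line_proj S F(2) that by blast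
    qed
    show ?case
      by (intro exI[of _ "\<lambda>x. line_proj (f (pt (Suc j) x)) (F x)"])
        (use * in \<open>auto simp: line_proj_def intro!: continuous_intros cpt Suc.prems F(1)\<close>)
  qed
  from this[of N] obtain F where F: "continuous_on X F" "\<forall>x\<in>X. F x \<noteq> 0 \<and> hopf (F x) = f (pt N x)"
    by auto
  have "pt N x = x" for x using N(1) by (simp add: pt_def)
  then show thesis using that[of F] F by auto
qed

section \<open>Uniqueness of logarithms, and the square relative to three of its sides\<close>

text \<open>Two logarithms of one function differ by multiples of 2 pi i, a discrete set. Invariance
  and uniqueness of winding numbers rest on this.\<close>

lemma exp_lift_diff_const:
  fixes l l' :: "'a::topological_space \<Rightarrow> complex"
  assumes "connected S" "continuous_on S l" "continuous_on S l'" "\<And>x. x \<in> S \<Longrightarrow> exp (l x) = exp (l' x)"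
    "x \<in> S" "y \<in> S"
  shows "l x - l' x = l y - l' y"
proof -
  have "(\<lambda>x. l x - l' x) constant_on S"
  proof (rule continuous_discrete_range_constant[OF assms(1)])
    show "continuous_on S (\<lambda>x. l x - l' x)" using assms by (intro continuous_intros)
    fix x assume x: "x \<in> S"
    show "\<exists>e>0. \<forall>y. y \<in> S \<and> l y - l' y \<noteq> l x - l' x \<longrightarrow> e \<le> norm (l y - l' y - (l x - l' x))"
    proof (intro exI[of _ "2 * pi"] conjI allI impI)
      fix y assume y: "y \<in> S \<and> l y - l' y \<noteq> l x - l' x"
      have "exp (l y - l' y - (l x - l' x)) = 1"
        using assms(4) x y by (simp add: exp_diff)
      then obtain n :: int where n: "Re (l y - l' y - (l x - l' x)) = 0" "Im (l y - l' y - (l x - l' x)) = of_int (2 * n) * pi"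
        unfolding exp_eq_1 by blast
      then have "n \<noteq> 0" using y by (auto simp: complex_eq_iff)
      then have "1 \<le> \<bar>of_int n :: real\<bar>" by linarith
      then have "2 * pi \<le> \<bar>Im (l y - l' y - (l x - l' x))\<bar>"
        unfolding n(2) by (simp add: abs_mult)
      then show "2 * pi \<le> norm (l y - l' y - (l x - l' x))"
        using abs_Im_le_cmod order_trans by blast
    qed auto
  qed
  then show ?thesis using assms(5,6) unfolding constant_on_def by metis
qed

text \<open>The sides on which a lift is made equal to \<open>(1, 0)\<close>. The remaining side
  \<open>s = 1\<close> carries the winding; its two end points belong to the set, so the lift runs
  along a closed curve there.\<close>

definition three_sides :: "(real \<times> real) set" where
  "three_sides = {(s, t). (s, t) \<in> unit_square \<and> (s = 0 \<or> t = 0 \<or> t = 1)}"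

lemma three_sides_iff:
  "(s, t) \<in> three_sides \<longleftrightarrow> (s, t) \<in> unit_square \<and> (s = 0 \<or> t = 0 \<or> t = 1)"
  by (simp add: three_sides_def)

lemma three_sides_subset: "three_sides \<subseteq> unit_square"
  by (auto simp: three_sides_def)

lemma frontier_unit_square: "frontier unit_square = three_sides \<union> {1} \<times> {0..1}"
  unfolding frontier_def closure_Times interior_Times three_sides_def by auto

text \<open>Radial projection of the square from the point \<open>(2, 1/2)\<close>.\<close>

definition to_three_sides :: "real \<times> real \<Rightarrow> real \<times> real" where
  "to_three_sides = (\<lambda>(s, t). let y = 2 * (t - 1/2) / (2 - s); M = max (1/2) \<bar>y\<bar>
     in (2 - 1 / M, 1/2 + y / (2 * M)))"

text \<open>The ray from \<open>(2, 1/2)\<close> through \<open>(s, t)\<close> meets the line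
  \<open>s = 0\<close> at height \<open>1/2 + y\<close>. For \<open>\<bar>y\<bar> \<le> 1/2\<close>
  this point is on the left side and \<open>M = 1/2\<close>; otherwise the ray leaves through the
  top or the bottom, and scaling the direction \<open>(- 2, y)\<close> by \<open>1 / (2 * M)\<close>
  with \<open>M = \<bar>y\<bar>\<close> stops it there.\<close>

lemma three_sides_retraction:
  "continuous_on unit_square to_three_sides"
  "x \<in> unit_square \<Longrightarrow> to_three_sides x \<in> three_sides"
  "x \<in> three_sides \<Longrightarrow> to_three_sides x = x"
proof -
  have eq: "to_three_sides (s, t) = (2 - 1 / M, 1/2 + y / (2 * M))"
    if "2 * (t - 1/2) / (2 - s) = y" "max (1/2) \<bar>y\<bar> = M" for s t y M
    unfolding to_three_sides_def Let_def case_prod_conv that ..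
  show "continuous_on unit_square to_three_sides"
  proof -
    have c: "continuous_on unit_square (\<lambda>x. max (1/2) \<bar>2 * (snd x - 1/2) / (2 - fst x)\<bar>)"
      by (intro continuous_intros) auto
    have "max (1/2) y \<noteq> 0" "2 * max (1/2) y \<noteq> 0" for y :: real by (auto simp: max_def)
    then show ?thesis
      unfolding to_three_sides_def Let_def case_prod_unfold
      by (intro continuous_intros c ballI) auto
  qed
  show "to_three_sides x \<in> three_sides" if "x \<in> unit_square"
  proof -
    obtain s t where x: "x = (s, t)" by fastforce
    have st: "0 \<le> s" "s \<le> 1" "0 \<le> t" "t \<le> 1" using that by (auto simp: x)
    define y where "y = 2 * (t - 1/2) / (2 - s)"
    define M where "M = max (1/2) \<bar>y\<bar>"
    have "\<bar>y\<bar> = 2 * \<bar>t - 1/2\<bar> / (2 - s)" using st by (simp only: y_def abs_mult abs_divide)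
    also have "\<dots> \<le> 1" 
    proof -
      have "\<bar>t - 1/2\<bar> \<le> 1/2" using st by (intro abs_leI) auto
      then have "2 * \<bar>t - 1/2\<bar> \<le> 2 - s" using st(2) by simp
      then show ?thesis using st by (simp add: divide_le_eq_1)
    qed
    finally have M: "1/2 \<le> M" "M \<le> 1" "\<bar>y\<bar> \<le> M" by (auto simp: M_def)
    have 1: "0 \<le> 2 - 1 / M" "2 - 1 / M \<le> 1" using M by (simp_all add: field_simps)
    have "- M \<le> y" "y \<le> M" using M(3) by linarith+
    then have 2: "0 \<le> 1/2 + y / (2 * M)" "1/2 + y / (2 * M) \<le> 1" using M(1) by (simp_all add: field_simps)
    have 3: "2 - 1 / M = 0 \<or> 1/2 + y / (2 * M) = 0 \<or> 1/2 + y / (2 * M) = 1"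
    proof (cases "M = 1/2")
      case True
      then show ?thesis unfolding True by simp
    next
      case False
      then have "M = y \<or> M = - y" by (auto simp: M_def max_def abs_if split: if_splits)
      then show ?thesis using M(1) by (auto simp: field_simps)
    qed
    have "to_three_sides x = (2 - 1 / M, 1/2 + y / (2 * M))"
      unfolding x by (rule eq) (simp_all only: y_def M_def)
    then show ?thesis using 1 2 3 by (simp add: three_sides_iff)
  qed
  show "to_three_sides x = x" if "x \<in> three_sides"
  proof -
    obtain s t where x: "x = (s, t)" by fastforce
    have st: "0 \<le> s" "s \<le> 1" "0 \<le> t" "t \<le> 1" and "s = 0 \<or> t = 0 \<or> t = 1"
      using that by (auto simp: x three_sides_iff)
    then consider "s = 0" | "t = 0" | "t = 1" by blast
    then show ?thesis
    proof cases
      case 1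
      have "\<bar>t - 1/2\<bar> \<le> 1/2" using st by (intro abs_leI) auto
      then have "max (1/2) \<bar>t - 1/2\<bar> = 1/2" by (simp only: max_def) simp
      then have "to_three_sides (s, t) = (2 - 1 / (1/2), 1/2 + (t - 1/2) / (2 * (1/2)))"
        unfolding 1 by (intro eq) (simp, simp only:)
      then show ?thesis by (simp add: x 1)
    next
      case 2
      have "\<bar>- 1 / (2 - s)\<bar> = 1 / (2 - s)" "1/2 \<le> 1 / (2 - s)" using st by (simp_all add: field_simps)
      then have "max (1/2) \<bar>- 1 / (2 - s)\<bar> = 1 / (2 - s)" by (simp only: max_def if_True)
      then have "to_three_sides (s, t) = (2 - 1 / (1 / (2 - s)), 1/2 + - 1 / (2 - s) / (2 * (1 / (2 - s))))"
        unfolding 2 by (intro eq) (simp, simp only:)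
      then show ?thesis using st by (simp add: x 2)
    next
      case 3
      have "\<bar>1 / (2 - s)\<bar> = 1 / (2 - s)" "1/2 \<le> 1 / (2 - s)" using st by (simp_all add: field_simps)
      then have "max (1/2) \<bar>1 / (2 - s)\<bar> = 1 / (2 - s)" by (simp only: max_def if_True)
      then have "to_three_sides (s, t) = (2 - 1 / (1 / (2 - s)), 1/2 + 1 / (2 - s) / (2 * (1 / (2 - s))))"
        unfolding 3 by (intro eq) (simp, simp only:)
      then show ?thesis using st by (simp add: x 3)
    qed
  qed
qed

section \<open>The second homotopy group of the 2-sphere\<close>

lemma homotopic_spheroids_iff:
  "homotopic_spheroids X a f g \<longleftrightarrow>
    (\<exists>h. continuous_on ({0..1::real} \<times> unit_square) h \<and> h ` ({0..1::real} \<times> unit_square) \<subseteq> X \<and>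
         (\<forall>x\<in>unit_square. h (0, x) = f x) \<and> (\<forall>x\<in>unit_square. h (1, x) = g x) \<and>
         (\<forall>t\<in>{0..1}. \<forall>x\<in>frontier unit_square. h (t, x) = a))"
proof -
  have "\<forall>z\<in>frontier unit_square. z \<in> unit_square"
    using three_sides_subset unfolding frontier_unit_square by auto
  then show ?thesis
    unfolding homotopic_spheroids_def
    by (subst homotopic_with) (auto simp: prod_topology_subtopology_eu image_subset_iff_funcset)
qed

lemma continuous_on_slice:
  assumes "continuous_on (T \<times> S) h" "t \<in> T"
  shows "continuous_on S (\<lambda>x. h (t, x))"
  by (rule continuous_on_compose2[OF assms(1)]) (use assms(2) in \<open>auto intro!: continuous_intros\<close>)

lemma homotopic_spheroids_imp_spheroids:
  assumes "homotopic_spheroids X a f g"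
  shows "f \<in> spheroids X a" "g \<in> spheroids X a"
proof -
  obtain h where h: "continuous_on ({0..1::real} \<times> unit_square) h" "h ` ({0..1::real} \<times> unit_square) \<subseteq> X"
    "\<And>x. x \<in> unit_square \<Longrightarrow> h (0, x) = f x" "\<And>x. x \<in> unit_square \<Longrightarrow> h (1, x) = g x"
    "\<And>t x. t \<in> {0..1} \<Longrightarrow> x \<in> frontier unit_square \<Longrightarrow> h (t, x) = a"
    using assms unfolding homotopic_spheroids_iff by blast
  have sub: "frontier unit_square \<subseteq> unit_square"
    using three_sides_subset unfolding frontier_unit_square by auto
  have *: "k \<in> spheroids X a" if t: "t \<in> {0..1}" and hk: "\<And>x. x \<in> unit_square \<Longrightarrow> h (t, x) = k x" for t k
  proof -
    have "continuous_on unit_square k"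
      using continuous_on_slice[OF h(1) t] hk by (simp cong: continuous_on_cong)
    moreover have "k x \<in> X" if x: "x \<in> unit_square" for x
    proof -
      have "(t, x) \<in> {0..1} \<times> unit_square" using t x by simp
      then have "h (t, x) \<in> X" using h(2) by (metis image_subset_iff)
      then show ?thesis using hk[OF x] by simp
    qed
    moreover have "k x = a" if x: "x \<in> frontier unit_square" for x
      using h(5)[OF t x] hk[OF subsetD[OF sub x]] by simp
    ultimately show ?thesis unfolding spheroids_def by (simp add: image_subset_iff)
  qed
  show "f \<in> spheroids X a" using *[of 0 f] h(3) by simp
  show "g \<in> spheroids X a" using *[of 1 g] h(4) by simp
qed

lemma homotopic_spheroids_sym: "homotopic_spheroids X a f g \<Longrightarrow> homotopic_spheroids X a g f"
  unfolding homotopic_spheroids_def by (simp add: homotopic_with_sym)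

lemma homotopic_spheroids_trans:
  "homotopic_spheroids X a f g \<Longrightarrow> homotopic_spheroids X a g h \<Longrightarrow> homotopic_spheroids X a f h"
  unfolding homotopic_spheroids_def by (rule homotopic_with_trans)

lemma homotopic_spheroids_image:
  assumes "homotopic_spheroids X a f g" "continuous_on X k" "k ` X \<subseteq> Y"
  shows "homotopic_spheroids Y (k a) (k \<circ> f) (k \<circ> g)"
proof -
  obtain h where h: "continuous_on ({0..1::real} \<times> unit_square) h" "h ` ({0..1::real} \<times> unit_square) \<subseteq> X"
    "\<forall>x\<in>unit_square. h (0, x) = f x" "\<forall>x\<in>unit_square. h (1, x) = g x"
    "\<forall>t\<in>{0..1}. \<forall>x\<in>frontier unit_square. h (t, x) = a"
    using assms(1) unfolding homotopic_spheroids_iff by blast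
  show ?thesis
    unfolding homotopic_spheroids_iff
  proof (intro exI[of _ "k \<circ> h"] conjI)
    show "continuous_on ({0..1::real} \<times> unit_square) (k \<circ> h)"
      using continuous_on_compose[OF h(1)] continuous_on_subset[OF assms(2) h(2)] by blast
    show "(k \<circ> h) ` ({0..1::real} \<times> unit_square) \<subseteq> Y" using h(2) assms(3) by (auto simp: image_subset_iff)
  qed (use h in auto)
qed

lemma homotopic_spheroids_linear:
  fixes f g :: "real \<times> real \<Rightarrow> 'a::real_normed_vector"
  assumes "f \<in> spheroids X a" "g \<in> spheroids X a"
    "\<And>x. x \<in> unit_square \<Longrightarrow> closed_segment (f x) (g x) \<subseteq> X"
  shows "homotopic_spheroids X a f g"
  unfolding homotopic_spheroids_iff
proof (intro exI[of _ "\<lambda>z. (1 - fst z) *\<^sub>R f (snd z) + fst z *\<^sub>R g (snd z)"] conjI)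
  have c: "continuous_on ({0..1::real} \<times> unit_square) (\<lambda>z::real\<times>real\<times>real. k (snd z))" if "k \<in> spheroids X a" for k
    by (rule continuous_on_compose2[of unit_square k])
      (use that in \<open>auto simp: spheroids_def intro!: continuous_intros\<close>)
  show "continuous_on ({0..1::real} \<times> unit_square) (\<lambda>z. (1 - fst z) *\<^sub>R f (snd z) + fst z *\<^sub>R g (snd z))"
    by (intro continuous_intros c assms(1,2))
  show "(\<lambda>z. (1 - fst z) *\<^sub>R f (snd z) + fst z *\<^sub>R g (snd z)) ` ({0..1::real} \<times> unit_square) \<subseteq> X"
  proof clarify
    fix t s r :: real assume "t \<in> {0..1}" "s \<in> {0..1}" "r \<in> {0..1}"
    then have "(1 - t) *\<^sub>R f (s, r) + t *\<^sub>R g (s, r) \<in> closed_segment (f (s, r)) (g (s, r))"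
      by (auto simp: in_segment)
    then show "(1 - fst (t, s, r)) *\<^sub>R f (snd (t, s, r)) + fst (t, s, r) *\<^sub>R g (snd (t, s, r)) \<in> X"
      using assms(3)[of "(s, r)"] \<open>s \<in> {0..1}\<close> \<open>r \<in> {0..1}\<close> by auto
  qed
qed (use assms(1,2) in \<open>auto simp: spheroids_def simp flip: scaleR_left_distrib\<close>)

lemma spheroids_image:
  assumes "f \<in> spheroids X a" "continuous_on X k" "k ` X \<subseteq> Y"
  shows "k \<circ> f \<in> spheroids Y (k a)"
proof -
  have "continuous_on (f ` unit_square) k"
    using assms(1) by (intro continuous_on_subset[OF assms(2)]) (simp add: spheroids_def)
  then have "continuous_on unit_square (k \<circ> f)"
    using assms(1) continuous_on_compose by (auto simp: spheroids_def)
  then show ?thesis using assms(1,3) by (auto simp: spheroids_def image_subset_iff)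
qed

lemma spheroids_frontier:
  assumes "f \<in> spheroids X a" "(s, t) \<in> unit_square" "s = 0 \<or> s = 1 \<or> t = 0 \<or> t = 1"
  shows "f (s, t) = a"
proof -
  have "(s, t) \<in> frontier unit_square"
    unfolding frontier_unit_square using assms by (auto simp: three_sides_iff)
  then show ?thesis using assms(1) unfolding spheroids_def by blast
qed

lemma continuous_on_halves:
  fixes f g :: "real \<times> real \<Rightarrow> 'a::topological_space"
  assumes "continuous_on unit_square f" "continuous_on unit_square g"
    "\<And>t. t \<in> {0..1} \<Longrightarrow> f (1, t) = g (0, t)"
  shows "continuous_on unit_square (\<lambda>(s, t). if s \<le> 1/2 then f (2 * s, t) else g (2 * s - 1, t))"
proof -
  let ?A = "{0..1/2} \<times> {0..1::real}" and ?B = "{1/2..1} \<times> {0..1::real}"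
  have 1: "continuous_on ?A (\<lambda>x::real\<times>real. f (2 * fst x, snd x))"
    by (rule continuous_on_compose2[OF assms(1)]) (auto intro!: continuous_intros)
  have 2: "continuous_on ?B (\<lambda>x::real\<times>real. g (2 * fst x - 1, snd x))"
    by (rule continuous_on_compose2[OF assms(2)]) (auto intro!: continuous_intros)
  have 3: "f (2 * fst x, snd x) = g (2 * fst x - 1, snd x)"
    if "x \<in> ?A \<and> \<not> fst x \<le> 1/2 \<or> x \<in> ?B \<and> fst x \<le> 1/2" for x
  proof -
    have "2 * fst x = 1" "2 * fst x - 1 = 0" "snd x \<in> {0..1}" using that by auto
    then show ?thesis using assms(3)[of "snd x"] by (simp only:)
  qed
  have "continuous_on (?A \<union> ?B) (\<lambda>x. if fst x \<le> 1/2 then f (2 * fst x, snd x) else g (2 * fst x - 1, snd x))"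
    by (rule continuous_on_cases[OF _ _ 1 2]) (use 3 in \<open>blast intro: closed_Times closed_atLeastAtMost\<close>)+
  moreover have "?A \<union> ?B = unit_square" by auto
  ultimately show ?thesis by (simp add: case_prod_unfold)
qed

lemma join_spheroids_in_spheroids:
  assumes "f \<in> spheroids X a" "g \<in> spheroids X a"
  shows "join_spheroids f g \<in> spheroids X a"
proof -
  have "continuous_on unit_square (join_spheroids f g)"
    unfolding join_spheroids_def
    using assms spheroids_frontier[OF assms(1)] spheroids_frontier[OF assms(2)]
    by (intro continuous_on_halves) (auto simp: spheroids_def)
  moreover have "join_spheroids f g (s, t) \<in> X" if "s \<in> {0..1}" "t \<in> {0..1}" for s t
    using that assms by (auto simp: join_spheroids_def spheroids_def image_subset_iff)
  moreover have "join_spheroids f g x = a" if "x \<in> frontier unit_square" for x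
    using that spheroids_frontier[OF assms(1)] spheroids_frontier[OF assms(2)]
    unfolding frontier_unit_square by (auto simp: join_spheroids_def three_sides_def)
  ultimately show ?thesis unfolding spheroids_def by auto
qed

text \<open>The boundary map \<open>\<pi>\<^sub>2(S\<^sup>2) \<rightarrow> \<pi>\<^sub>1(S\<^sup>1)\<close> of the Hopf fibration: \<open>n\<close> is the winding number that a lift,
  normalised on three sides of the square, has along the fourth one.\<close>

definition spheroid_degree :: "(real \<times> real \<Rightarrow> real \<times> complex) \<Rightarrow> int \<Rightarrow> bool" where
  "spheroid_degree f n \<longleftrightarrow>
    (\<exists>F l. continuous_on unit_square F \<and> (\<forall>x\<in>unit_square. F x \<noteq> 0 \<and> hopf (F x) = f x) \<and>
       (\<forall>x\<in>three_sides. F x = (1, 0)) \<and> continuous_on {0..1} l \<and>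
       (\<forall>t\<in>{0..1}. F (1, t) = (exp (l t), 0)) \<and> l 0 = 0 \<and> l 1 = 2 * of_int n * pi * \<i>)"

text \<open>On three sides any lift takes values \<open>(c, 0)\<close> with c nonzero. Retracting
  the square to these sides extends c without zeros to the whole cube, and dividing the lift by it
  normalises the lift without changing its image under \<open>hopf\<close>. The parameter serves
  homotopies; a single spheroid is a constant family.\<close>

lemma hopf_lift_family:
  fixes H :: "real \<times> real \<times> real \<Rightarrow> real \<times> complex"
  assumes "continuous_on ({0..1::real} \<times> unit_square) H" "H ` ({0..1::real} \<times> unit_square) \<subseteq> sphere 0 1"
    "\<And>\<tau> x. \<tau> \<in> {0..1} \<Longrightarrow> x \<in> three_sides \<Longrightarrow> H (\<tau>, x) = (1, 0)"
  shows "\<exists>F. continuous_on ({0..1::real} \<times> unit_square) F \<and>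
    (\<forall>z\<in>{0..1::real} \<times> unit_square. F z \<noteq> 0 \<and> hopf (F z) = H z) \<and>
    (\<forall>\<tau>\<in>{0..1}. \<forall>x\<in>three_sides. F (\<tau>, x) = (1, 0))"
proof -
  let ?C = "{0..1::real} \<times> unit_square :: (real \<times> real \<times> real) set"
  have "compact ?C" "convex ?C" by (auto intro!: compact_Times convex_Times)
  then obtain F where F: "continuous_on ?C F" "\<And>z. z \<in> ?C \<Longrightarrow> F z \<noteq> 0" "\<And>z. z \<in> ?C \<Longrightarrow> hopf (F z) = H z"
    using hopf_lift[OF _ _ assms(1,2)] by blast
  define c where "c z = fst (F (fst z, to_three_sides (snd z)))" for z
  have r: "(fst z, to_three_sides (snd z)) \<in> ?C" "to_three_sides (snd z) \<in> three_sides" if "z \<in> ?C" for z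
    using three_sides_retraction(2)[of "snd z"] three_sides_subset that by (auto simp: mem_Times_iff)
  have c0: "c z \<noteq> 0" if "z \<in> ?C" for z
    unfolding c_def
  proof (rule hopf_eq_pole_imp(2))
    show "F (fst z, to_three_sides (snd z)) \<noteq> 0" using F(2) r(1) that by blast
    have "fst z \<in> {0..1}" using that by auto
    then show "hopf (F (fst z, to_three_sides (snd z))) = (1, 0)"
      using F(3)[OF r(1)[OF that]] assms(3)[of "fst z"] r(2)[OF that] by simp
  qed
  have "continuous_on ?C (\<lambda>z. F (fst z, to_three_sides (snd z)))"
  proof (rule continuous_on_compose2[OF F(1)])
    have "continuous_on ?C (\<lambda>z. to_three_sides (snd z))"
      by (rule continuous_on_compose2[OF three_sides_retraction(1)]) (auto intro!: continuous_intros)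
    then show "continuous_on ?C (\<lambda>z. (fst z, to_three_sides (snd z)))" by (intro continuous_intros)
    show "(\<lambda>z. (fst z, to_three_sides (snd z))) ` ?C \<subseteq> ?C" using r(1) by blast
  qed
  then have cc: "continuous_on ?C c" unfolding c_def by (intro continuous_intros)
  show ?thesis
  proof (intro exI[of _ "\<lambda>z. cscale (inverse (c z)) (F z)"] conjI ballI)
    show "continuous_on ?C (\<lambda>z. cscale (inverse (c z)) (F z))"
      using c0 by (intro continuous_intros cc F(1)) auto
    show "cscale (inverse (c z)) (F z) \<noteq> 0" "hopf (cscale (inverse (c z)) (F z)) = H z" if "z \<in> ?C" for z
      using c0[OF that] F(2,3)[OF that] by (simp_all add: hopf_cscale)
    show "cscale (inverse (c (\<tau>, x))) (F (\<tau>, x)) = (1, 0)" if t: "\<tau> \<in> {0..1}" "x \<in> three_sides" for \<tau> x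
    proof -
      have z: "(\<tau>, x) \<in> ?C" using t three_sides_subset by blast
      have "c (\<tau>, x) = fst (F (\<tau>, x))" unfolding c_def using three_sides_retraction(3) t by simp
      moreover have "snd (F (\<tau>, x)) = 0"
        using hopf_eq_pole_imp(1) F(2,3)[OF z] assms(3)[OF t] by simp
      ultimately show ?thesis using c0[OF z] by (simp add: cscale_def)
    qed
  qed
qed

lemma log_on_convex:
  fixes f :: "'a::real_normed_vector \<Rightarrow> complex"
  assumes "continuous_on S f" "convex S" "\<And>z. z \<in> S \<Longrightarrow> f z \<noteq> 0"
  obtains g where "continuous_on S g" "\<And>x. x \<in> S \<Longrightarrow> f x = exp (g x)"
  using continuous_logarithm_on_contractible[OF assms(1) convex_imp_contractible[OF assms(2)] assms(3)] by blast

lemma exp_eq_1_int: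
  assumes "exp z = 1" obtains n :: int where "z = 2 * of_int n * pi * \<i>"
proof -
  obtain n :: int where "Re z = 0" "Im z = of_int (2 * n) * pi" using assms unfolding exp_eq_1 by blast
  then show thesis by (intro that[of n]) (simp add: complex_eq_iff)
qed

lemma spheroid_degree_exists:
  assumes f: "f \<in> spheroids (sphere 0 1) (1, 0)"
  obtains n where "spheroid_degree f n"
proof -
  have 1: "continuous_on ({0..1::real} \<times> unit_square) (\<lambda>z::real\<times>real\<times>real. f (snd z))"
    by (rule continuous_on_compose2[of unit_square f])
      (use f in \<open>auto simp: spheroids_def intro!: continuous_intros\<close>)
  have 2: "f (snd (\<tau>, x)) = (1, 0)" if "\<tau> \<in> {0..1}" "x \<in> three_sides" for \<tau> :: real and x
    using that f unfolding spheroids_def frontier_unit_square by auto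
  have 3: "(\<lambda>z. f (snd z)) ` ({0..1::real} \<times> unit_square) \<subseteq> sphere 0 1"
    using f unfolding spheroids_def by (auto simp: image_subset_iff)
  obtain F where F: "continuous_on ({0..1::real} \<times> unit_square) F"
    "\<And>z. z \<in> {0..1::real} \<times> unit_square \<Longrightarrow> F z \<noteq> 0 \<and> hopf (F z) = f (snd z)"
    "\<And>\<tau> x. \<tau> \<in> {0..1} \<Longrightarrow> x \<in> three_sides \<Longrightarrow> F (\<tau>, x) = (1, 0)"
  proof -
    have "\<exists>F. continuous_on ({0..1::real} \<times> unit_square) F \<and>
      (\<forall>z\<in>{0..1::real} \<times> unit_square. F z \<noteq> 0 \<and> hopf (F z) = f (snd z)) \<and>
      (\<forall>\<tau>\<in>{0..1}. \<forall>x\<in>three_sides. F (\<tau>, x) = (1, 0))"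
      by (rule hopf_lift_family[OF 1 3]) (rule 2)
    then show ?thesis using that by metis
  qed
  define G where "G x = F (0, x)" for x
  have G: "continuous_on unit_square G" "\<And>x. x \<in> unit_square \<Longrightarrow> G x \<noteq> 0 \<and> hopf (G x) = f x"
    "\<And>x. x \<in> three_sides \<Longrightarrow> G x = (1, 0)"
    using continuous_on_slice[OF F(1), of 0] F(2)[of "(0, _)"] F(3)[of 0] by (simp_all add: G_def mem_Times_iff)
  have side: "snd (G (1, t)) = 0" "fst (G (1, t)) \<noteq> 0" if "t \<in> {0..1}" for t
    using hopf_eq_pole_imp[of "G (1, t)"] G(2)[of "(1, t)"] spheroids_frontier[OF f, of 1 t] that by auto
  have "continuous_on {0..1} (\<lambda>t. fst (G (1, t)))"
    by (intro continuous_intros continuous_on_slice[OF G(1)]) auto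
  then obtain l where l: "continuous_on {0..1} l" "\<And>t. t \<in> {0..1} \<Longrightarrow> fst (G (1, t)) = exp (l t)"
    using log_on_convex[OF _ convex_real_interval(5)] side(2) by blast
  have e: "exp (l 0) = 1" "exp (l 1) = 1"
    using l(2)[of 0] l(2)[of 1] G(3)[of "(1, 0)"] G(3)[of "(1, 1)"] by (simp_all add: three_sides_iff)
  obtain n where n: "l 1 - l 0 = 2 * of_int n * pi * \<i>"
    using exp_eq_1_int[of "l 1 - l 0"] e by (auto simp: exp_diff)
  have "spheroid_degree f n"
    unfolding spheroid_degree_def
    by (intro exI[of _ G] exI[of _ "\<lambda>t. l t - l 0"] conjI ballI)
      (use G l n e side in \<open>auto intro!: continuous_intros simp: exp_diff prod_eq_iff\<close>)
  then show thesis by (rule that)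
qed

lemma connected_three_sides: "connected three_sides"
proof -
  have "to_three_sides ` unit_square = three_sides"
  proof
    show "to_three_sides ` unit_square \<subseteq> three_sides" using three_sides_retraction(2) by blast
    show "three_sides \<subseteq> to_three_sides ` unit_square"
    proof
      fix x assume "x \<in> three_sides"
      then show "x \<in> to_three_sides ` unit_square"
        using three_sides_retraction(3)[of x] three_sides_subset by (intro image_eqI[of _ _ x]) auto
    qed
  qed
  moreover have "connected unit_square" by (intro convex_connected convex_Times) auto
  ultimately show ?thesis using connected_continuous_image[OF three_sides_retraction(1)] by metis
qed

text \<open>The quotient c of two lifts has no zeros and, the square being convex, has a logarithm
  k. It is 1 on the connected set of three sides, so k is constant there and has equal values at
  both ends of the fourth side; hence c adds no winding.\<close>

lemma normalised_lift_winding_unique: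
  assumes F: "continuous_on unit_square F" "\<And>x. x \<in> unit_square \<Longrightarrow> F x \<noteq> 0"
    "\<And>x. x \<in> three_sides \<Longrightarrow> F x = (1, 0)"
    and G: "continuous_on unit_square G" "\<And>x. x \<in> unit_square \<Longrightarrow> G x \<noteq> 0"
    "\<And>x. x \<in> three_sides \<Longrightarrow> G x = (1, 0)"
    and FG: "\<And>x. x \<in> unit_square \<Longrightarrow> hopf (F x) = hopf (G x)"
    and l: "continuous_on {0..1} l" "\<And>t. t \<in> {0..1} \<Longrightarrow> F (1, t) = (exp (l t), 0)"
    and m: "continuous_on {0..1} m" "\<And>t. t \<in> {0..1} \<Longrightarrow> G (1, t) = (exp (m t), 0)"
  shows "l 1 - l 0 = m 1 - m 0"
proof -
  define c where "c x = (fst (G x) * cnj (fst (F x)) + snd (G x) * cnj (snd (F x))) / of_real ((norm (F x))\<^sup>2)" for x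
  have c: "G x = cscale (c x) (F x)" "c x \<noteq> 0" if "x \<in> unit_square" for x
    using hopf_fibre[of "F x" "G x"] F(2) G(2) FG that unfolding c_def by blast+
  have n: "complex_of_real ((norm (F x))\<^sup>2) \<noteq> 0" if "x \<in> unit_square" for x
    using F(2)[OF that] by simp
  have "continuous_on unit_square c"
    unfolding c_def by (intro continuous_intros F(1) G(1)) (use n in blast)
  moreover have "convex unit_square" by (intro convex_Times) auto
  ultimately obtain k where k: "continuous_on unit_square k" "\<And>x. x \<in> unit_square \<Longrightarrow> c x = exp (k x)"
    using log_on_convex c(2) by blast
  have "exp (k x) = exp 0" if "x \<in> three_sides" for x
  proof -
    have x: "x \<in> unit_square" using that three_sides_subset by blast
    show ?thesis using c(1)[OF x] F(3)[OF that] G(3)[OF that] k(2)[OF x] by simp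
  qed
  moreover have "continuous_on three_sides k" by (rule continuous_on_subset[OF k(1) three_sides_subset])
  ultimately have "k (1, 1) - 0 = k (1, 0) - 0"
    by (intro exp_lift_diff_const[OF connected_three_sides]) (auto simp: three_sides_iff)
  moreover have "(k (1, 1) + l 1) - m 1 = (k (1, 0) + l 0) - m 0"
  proof (rule exp_lift_diff_const[of "{0..1}" "\<lambda>t. k (1, t) + l t" m])
    show "exp (k (1, t) + l t) = exp (m t)" if "t \<in> {0..1}" for t
      using c(1)[of "(1, t)"] k(2)[of "(1, t)"] l(2)[OF that] m(2)[OF that] that
      by (auto simp: exp_add)
    show "continuous_on {0..1} (\<lambda>t. k (1, t) + l t)"
      by (intro continuous_intros continuous_on_slice[OF k(1)] l(1)) auto
  qed (use m in auto)
  ultimately show ?thesis by (simp add: algebra_simps)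
qed

text \<open>Along the fourth side a lifted homotopy is a function without zeros on the square of all
  \<open>(\<tau>, t)\<close>, hence has a logarithm L. The winding
  \<open>L (\<tau>, 1) - L (\<tau>, 0)\<close> is continuous in \<tau> and a multiple of 2 pi i, so
  it is constant.\<close>

lemma spheroid_degree_homotopic:
  assumes "homotopic_spheroids (sphere 0 1) (1, 0) f g" "spheroid_degree f n" "spheroid_degree g m"
  shows "n = m"
proof -
  obtain h where h: "continuous_on ({0..1::real} \<times> unit_square) h" "h ` ({0..1::real} \<times> unit_square) \<subseteq> sphere 0 1"
    "\<And>x. x \<in> unit_square \<Longrightarrow> h (0, x) = f x" "\<And>x. x \<in> unit_square \<Longrightarrow> h (1, x) = g x"
    "\<And>t x. t \<in> {0..1} \<Longrightarrow> x \<in> frontier unit_square \<Longrightarrow> h (t, x) = (1, 0)"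
    using assms(1) unfolding homotopic_spheroids_iff by blast
  obtain F where F: "continuous_on ({0..1::real} \<times> unit_square) F"
    "\<And>z. z \<in> {0..1::real} \<times> unit_square \<Longrightarrow> F z \<noteq> 0 \<and> hopf (F z) = h z"
    "\<And>\<tau> x. \<tau> \<in> {0..1} \<Longrightarrow> x \<in> three_sides \<Longrightarrow> F (\<tau>, x) = (1, 0)"
  proof -
    have "h (\<tau>, x) = (1, 0)" if "\<tau> \<in> {0..1}" "x \<in> three_sides" for \<tau> x
      using h(5) that unfolding frontier_unit_square by blast
    then have "\<exists>F. continuous_on ({0..1::real} \<times> unit_square) F \<and>
      (\<forall>z\<in>{0..1::real} \<times> unit_square. F z \<noteq> 0 \<and> hopf (F z) = h z) \<and>
      (\<forall>\<tau>\<in>{0..1}. \<forall>x\<in>three_sides. F (\<tau>, x) = (1, 0))"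
      by (intro hopf_lift_family[OF h(1,2)])
    then show ?thesis using that by metis
  qed
  have side: "snd (F (\<tau>, 1, t)) = 0" "fst (F (\<tau>, 1, t)) \<noteq> 0" if "\<tau> \<in> {0..1}" "t \<in> {0..1}" for \<tau> t
  proof -
    have "(\<tau>, 1, t) \<in> {0..1::real} \<times> unit_square" "h (\<tau>, 1, t) = (1, 0)"
      using h(5)[OF that(1), of "(1, t)"] that unfolding frontier_unit_square by auto
    then show "snd (F (\<tau>, 1, t)) = 0" "fst (F (\<tau>, 1, t)) \<noteq> 0"
      using F(2) hopf_eq_pole_imp[of "F (\<tau>, 1, t)"] by auto
  qed
  have "continuous_on unit_square (\<lambda>z. F (fst z, 1, snd z))"
    by (rule continuous_on_compose2[OF F(1)]) (auto intro!: continuous_intros)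
  then have "continuous_on unit_square (\<lambda>z. fst (F (fst z, 1, snd z)))" by (intro continuous_intros)
  moreover have "convex unit_square" by (intro convex_Times) auto
  moreover have "fst (F (fst z, 1, snd z)) \<noteq> 0" if "z \<in> unit_square" for z
    using side(2) that by (simp add: mem_Times_iff)
  ultimately obtain L where L: "continuous_on unit_square L"
    "\<And>z. z \<in> unit_square \<Longrightarrow> fst (F (fst z, 1, snd z)) = exp (L z)"
    using log_on_convex by blast
  have swap: "continuous_on {0..1} (\<lambda>\<tau>. L (\<tau>, t))" if "t \<in> {0..1}" for t
    by (rule continuous_on_compose2[OF L(1)]) (use that in \<open>auto intro!: continuous_intros\<close>)
  have *: "L (0, 1) - L (0, 0) = L (1, 1) - L (1, 0)"
  proof (rule exp_lift_diff_const[of "{0..1}" "\<lambda>\<tau>. L (\<tau>, 1)" "\<lambda>\<tau>. L (\<tau>, 0)"])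
    show "exp (L (\<tau>, 1)) = exp (L (\<tau>, 0))" if "\<tau> \<in> {0..1}" for \<tau>
      using L(2)[of "(\<tau>, 1)"] L(2)[of "(\<tau>, 0)"] F(3)[OF that, of "(1, 0)"] F(3)[OF that, of "(1, 1)"] that
      by (simp add: three_sides_iff)
  qed (auto intro!: swap)
  \<comment> \<open>The lift provided by \<open>spheroid_degree\<close> need not be a slice of F;
    the two are compared by \<open>normalised_lift_winding_unique\<close>.\<close>
  have deg: "L (\<tau>, 1) - L (\<tau>, 0) = 2 * of_int j * pi * \<i>"
    if k: "spheroid_degree k j" "\<tau> \<in> {0..1}" "\<And>x. x \<in> unit_square \<Longrightarrow> h (\<tau>, x) = k x" for \<tau> k j
  proof -
    obtain K l where K: "continuous_on unit_square K" "\<And>x. x \<in> unit_square \<Longrightarrow> K x \<noteq> 0 \<and> hopf (K x) = k x"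
       "\<And>x. x \<in> three_sides \<Longrightarrow> K x = (1, 0)" "continuous_on {0..1} l"
       "\<And>t. t\<in>{0..1} \<Longrightarrow> K (1, t) = (exp (l t), 0)" "l 0 = 0" "l 1 = 2 * of_int j * pi * \<i>"
      using k(1) unfolding spheroid_degree_def by blast
    have "L (\<tau>, 1) - L (\<tau>, 0) = l 1 - l 0"
    proof (rule normalised_lift_winding_unique[of "\<lambda>x. F (\<tau>, x)" K "\<lambda>t. L (\<tau>, t)" l])
      show "F (\<tau>, 1, t) = (exp (L (\<tau>, t)), 0)" if "t \<in> {0..1}" for t
        using L(2)[of "(\<tau>, t)"] side[OF k(2) that] k(2) that by (auto simp: prod_eq_iff)
      show "hopf (F (\<tau>, x)) = hopf (K x)" if "x \<in> unit_square" for x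
        using F(2)[of "(\<tau>, x)"] K(2)[OF that] k(2) k(3)[OF that] that by auto
      show "F (\<tau>, x) \<noteq> 0" if "x \<in> unit_square" for x
        using F(2)[of "(\<tau>, x)"] that k(2) by auto
    qed (use K k F(3) in \<open>auto intro!: continuous_on_slice[OF F(1)] continuous_on_slice[OF L(1)]\<close>)
    then show ?thesis using K(6,7) by simp
  qed
  have "2 * of_int n * pi * \<i> = 2 * of_int m * pi * \<i>"
    using deg[OF assms(2), of 0] deg[OF assms(3), of 1] h(3,4) * by simp
  then show ?thesis by simp
qed

text \<open>The two lifts agree on three sides and differ by \<open>exp (l t - m t)\<close> on the
  fourth. Equal windings make \<open>l - m\<close> vanish at both ends, so multiplying G by
  \<open>exp (s * (l t - m t))\<close> keeps it a lift of g, changes nothing on three sides and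
  matches F on the fourth. What remains is to fill a 3-cube with nonzero values prescribed on its
  boundary.\<close>

lemma spheroid_degree_imp_homotopic:
  assumes "spheroid_degree f n" "spheroid_degree g n"
  shows "homotopic_spheroids (sphere 0 1) (1, 0) f g"
proof -
  obtain F l where F: "continuous_on unit_square F" "\<And>x. x \<in> unit_square \<Longrightarrow> F x \<noteq> 0 \<and> hopf (F x) = f x"
     "\<And>x. x \<in> three_sides \<Longrightarrow> F x = (1, 0)" and l: "continuous_on {0..1} l"
     "\<And>t. t\<in>{0..1} \<Longrightarrow> F (1, t) = (exp (l t), 0)" "l 0 = 0" "l 1 = 2 * of_int n * pi * \<i>"
    using assms(1) unfolding spheroid_degree_def by blast
  obtain G m where G: "continuous_on unit_square G" "\<And>x. x \<in> unit_square \<Longrightarrow> G x \<noteq> 0 \<and> hopf (G x) = g x"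
     "\<And>x. x \<in> three_sides \<Longrightarrow> G x = (1, 0)" and m: "continuous_on {0..1} m"
     "\<And>t. t\<in>{0..1} \<Longrightarrow> G (1, t) = (exp (m t), 0)" "m 0 = 0" "m 1 = 2 * of_int n * pi * \<i>"
    using assms(2) unfolding spheroid_degree_def by blast
  define G' where "G' x = cscale (exp (of_real (fst x) * (l (snd x) - m (snd x)))) (G x)" for x
  have "continuous_on unit_square (\<lambda>x. l (snd x))" "continuous_on unit_square (\<lambda>x. m (snd x))"
    by (auto intro!: continuous_on_compose2[OF l(1)] continuous_on_compose2[OF m(1)] continuous_intros)
  then have G'c: "continuous_on unit_square G'"
    unfolding G'_def by (intro continuous_intros G(1))
  have G'n: "G' x \<noteq> 0 \<and> hopf (G' x) = g x" if "x \<in> unit_square" for x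
    using G(2)[OF that] by (simp add: G'_def hopf_cscale)
  have agree: "G' x = F x" if "x \<in> frontier unit_square" for x
  proof -
    have "x \<in> three_sides \<or> (\<exists>t\<in>{0..1}. x = (1, t))"
      using that unfolding frontier_unit_square by (cases x) auto
    then consider "x \<in> three_sides" | t where "t \<in> {0..1}" "x = (1, t)" by blast
    then show ?thesis
    proof cases
      case 1
      then have "exp (of_real (fst x) * (l (snd x) - m (snd x))) = 1"
        using l m by (auto simp: three_sides_def)
      then show ?thesis unfolding G'_def using F(3) G(3) 1 by simp
    next
      case 2
      then show ?thesis using l(2) m(2) by (simp add: G'_def flip: exp_add)
    qed
  qed
  let ?C = "{0..1::real} \<times> unit_square :: (real \<times> real \<times> real) set"
  \<comment> \<open>A is the bottom of the cube together with its walls, B is the top; F on A and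
    \<open>G'\<close> on B agree where the two meet.\<close>
  define A B where "A = {0::real} \<times> unit_square \<union> {0..1} \<times> frontier unit_square" and "B = {1::real} \<times> unit_square"
  define K where "K z = (if fst z \<noteq> 1 then F (snd z) else G' (snd z))" for z :: "real \<times> real \<times> real"
  have fr: "frontier unit_square \<subseteq> unit_square" using three_sides_subset unfolding frontier_unit_square by auto
  have AB: "A \<subseteq> ?C" "B \<subseteq> ?C" using fr unfolding A_def B_def by auto
  have cl: "closed A" "closed B"
    unfolding A_def B_def by (simp_all add: closed_Un closed_Times frontier_closed)
  have K0: "K z \<noteq> 0" if "z \<in> A \<union> B" for z
  proof -
    have "snd z \<in> unit_square" using AB that by auto
    then show ?thesis using F(2) G'n by (simp add: K_def)
  qed
  have "continuous_on (A \<union> B) K"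
    unfolding K_def
  proof (rule continuous_on_cases[OF cl])
    show "continuous_on A (\<lambda>z. F (snd z))" "continuous_on B (\<lambda>z. G' (snd z))"
      using AB by (auto intro!: continuous_on_compose2[OF F(1)] continuous_on_compose2[OF G'c] continuous_intros)
    show "\<forall>x. x \<in> A \<and> \<not> fst x \<noteq> 1 \<or> x \<in> B \<and> fst x \<noteq> 1 \<longrightarrow> F (snd x) = G' (snd x)"
      using agree unfolding A_def B_def by auto
  qed
  then have Kc: "continuous_on (A \<union> B) (\<lambda>z. K z /\<^sub>R norm (K z))"
    using K0 by (intro continuous_intros) auto
  have box: "?C = cbox (0, 0, 0) (1, 1, 1)" by (auto simp: cbox_Pair_eq)
  \<comment> \<open>The cube is a complex with a single cell, of dimension at most 3, while the
    target sphere bounds a ball of dimension 4.\<close>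
  obtain E where E: "continuous_on (\<Union>{?C}) E" "E \<in> \<Union>{?C} \<rightarrow> rel_frontier (cball (0::complex\<times>complex) 1)"
    "\<And>z. z \<in> A \<union> B \<Longrightarrow> E z = K z /\<^sub>R norm (K z)"
  proof (rule extend_map_cell_complex_to_sphere[of "{?C}" "A \<union> B" "cball (0::complex\<times>complex) 1" "\<lambda>z. K z /\<^sub>R norm (K z)"])
    show "polytope X" if "X \<in> {?C}" for X using that unfolding box by (simp add: polytope_interval)
    show "aff_dim X < aff_dim (cball (0::complex\<times>complex) 1)" if "X \<in> {?C}" for X
      using aff_dim_le_DIM[of X] by (simp add: aff_dim_cball)
    show "(X \<inter> Y) face_of X" if "X \<in> {?C}" "Y \<in> {?C}" for X Y
    proof -
      have "X \<inter> Y = ?C" "X = ?C" "convex ?C" using that by (auto intro!: convex_Times)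
      then show ?thesis by (metis face_of_refl)
    qed
    show "(\<lambda>z. K z /\<^sub>R norm (K z)) \<in> A \<union> B \<rightarrow> rel_frontier (cball (0::complex\<times>complex) 1)"
      using K0 by (simp add: rel_frontier_cball Pi_iff del: Un_iff)
  qed (use AB cl Kc in auto)
  have E0: "E z \<noteq> 0" if "z \<in> ?C" for z
  proof -
    have "E z \<in> sphere 0 1" using Pi_mem[OF E(2), of z] that by (simp add: rel_frontier_cball)
    then show ?thesis by auto
  qed
  have hE: "hopf (E z) = hopf (K z)" if "z \<in> A \<union> B" for z
  proof -
    have "E z = cscale (of_real (inverse (norm (K z)))) (K z)"
      unfolding E(3)[OF that] by (simp add: cscale_def scaleR_conv_of_real prod_eq_iff)
    then show ?thesis using K0[OF that] by (simp add: hopf_cscale)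
  qed
  show ?thesis
    unfolding homotopic_spheroids_iff
  proof (intro exI[of _ "\<lambda>z. hopf (E z)"] conjI ballI)
    show "continuous_on ?C (\<lambda>z. hopf (E z))" using E(1) E0 by (intro continuous_intros) auto
    show "(\<lambda>z. hopf (E z)) ` ?C \<subseteq> sphere 0 1" using E0 hopf_in_sphere by blast
    show "hopf (E (0, x)) = f x" if "x \<in> unit_square" for x
      using hE[of "(0, x)"] F(2)[OF that] that by (auto simp: A_def K_def)
    show "hopf (E (1, x)) = g x" if "x \<in> unit_square" for x
      using hE[of "(1, x)"] G'n[OF that] that by (auto simp: B_def K_def)
    show "hopf (E (t, x)) = (1, 0)" if t: "t \<in> {0..1}" "x \<in> frontier unit_square" for t x
    proof -
      have "K (t, x) = F x" using agree t(2) by (simp add: K_def)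
      moreover have "hopf (F x) = (1, 0)"
        using t(2) F(3)[of x] l(2) unfolding frontier_unit_square by auto
      ultimately show ?thesis using hE[of "(t, x)"] t by (auto simp: A_def)
    qed
  qed
qed

text \<open>The lift of f ends in \<open>(exp (l t), 0)\<close> and that of g starts in
  \<open>(1, 0)\<close>. Multiplying the second by \<open>exp (l t)\<close> makes them fit and makes
  the logarithm on the last side \<open>l + k\<close>; top and bottom stay normalised because
  \<open>exp (l 0)\<close> and \<open>exp (l 1)\<close> are 1.\<close>

lemma spheroid_degree_join:
  assumes "spheroid_degree f n" "spheroid_degree g m"
  shows "spheroid_degree (join_spheroids f g) (n + m)"
proof -
  obtain F l where F: "continuous_on unit_square F" "\<And>x. x \<in> unit_square \<Longrightarrow> F x \<noteq> 0 \<and> hopf (F x) = f x"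
     "\<And>x. x \<in> three_sides \<Longrightarrow> F x = (1, 0)" and l: "continuous_on {0..1} l"
     "\<And>t. t\<in>{0..1} \<Longrightarrow> F (1, t) = (exp (l t), 0)" "l 0 = 0" "l 1 = 2 * of_int n * pi * \<i>"
    using assms(1) unfolding spheroid_degree_def by blast
  obtain G k where G: "continuous_on unit_square G" "\<And>x. x \<in> unit_square \<Longrightarrow> G x \<noteq> 0 \<and> hopf (G x) = g x"
     "\<And>x. x \<in> three_sides \<Longrightarrow> G x = (1, 0)" and k: "continuous_on {0..1} k"
     "\<And>t. t\<in>{0..1} \<Longrightarrow> G (1, t) = (exp (k t), 0)" "k 0 = 0" "k 1 = 2 * of_int m * pi * \<i>"
    using assms(2) unfolding spheroid_degree_def by blast
  define G' where "G' x = cscale (exp (l (snd x))) (G x)" for x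
  have "continuous_on unit_square (\<lambda>x. l (snd x))"
    by (auto intro!: continuous_on_compose2[OF l(1)] continuous_intros)
  then have G'c: "continuous_on unit_square G'"
    unfolding G'_def by (intro continuous_intros G(1))
  have G'n: "G' x \<noteq> 0 \<and> hopf (G' x) = g x" if "x \<in> unit_square" for x
    using G(2)[OF that] by (simp add: G'_def hopf_cscale)
  have l1: "exp (l 1) = 1" by (simp add: l(4) exp_eq_1)
  define J where "J = (\<lambda>(s, t). if s \<le> 1/2 then F (2 * s, t) else G' (2 * s - 1, t))"
  have "G (0, t) = (1, 0)" if "t \<in> {0..1}" for t using G(3) that by (auto simp: three_sides_iff)
  then have Jc: "continuous_on unit_square J"
    unfolding J_def using l(2) by (intro continuous_on_halves F(1) G'c) (simp add: G'_def)
  show ?thesis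
    unfolding spheroid_degree_def
  proof (intro exI[of _ J] exI[of _ "\<lambda>t. l t + k t"] conjI ballI)
    fix x assume "x \<in> unit_square"
    moreover obtain s t where x: "x = (s, t)" by fastforce
    ultimately have st: "0 \<le> s" "s \<le> 1" "0 \<le> t" "t \<le> 1" by auto
    show "J x \<noteq> 0" "hopf (J x) = join_spheroids f g x"
      using F(2)[of "(2 * s, t)"] G'n[of "(2 * s - 1, t)"] st by (auto simp: x J_def join_spheroids_def)
  next
    fix x assume "x \<in> three_sides"
    moreover obtain s t where x: "x = (s, t)" by fastforce
    ultimately have st: "0 \<le> s" "s \<le> 1" "0 \<le> t" "t \<le> 1" "s = 0 \<or> t = 0 \<or> t = 1"
      by (auto simp: three_sides_iff)
    show "J x = (1, 0)"
      unfolding x using st F(3)[of "(2 * s, t)"] G(3)[of "(2 * s - 1, t)"] l1 l(3)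
      by (auto simp: J_def G'_def three_sides_iff)
  next
    fix t :: real assume "t \<in> {0..1}"
    then show "J (1, t) = (exp (l t + k t), 0)" using k(2) by (simp add: J_def G'_def exp_add)
  qed (use Jc l k in \<open>auto intro!: continuous_intros simp: algebra_simps\<close>)
qed

text \<open>The first coordinate of F interpolates between 1 and the loop e, and can vanish only for
  \<open>s = 1/2\<close> and t strictly between 0 and 1. The second coordinate is positive inside
  the square and zero on its frontier, so it removes these zeros without disturbing the boundary
  values.\<close>

lemma spheroid_degree_surj:
  obtains f where "f \<in> spheroids (sphere 0 1) (1, 0)" "spheroid_degree f n"
proof -
  define e where "e t = exp (2 * of_int n * pi * \<i> * of_real t)" for t
  define F where "F x = (of_real (1 - fst x) + of_real (fst x) * e (snd x),
      complex_of_real (fst x * (1 - fst x) * snd x * (1 - snd x)))" for x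
  have e: "cmod (e t) = 1" "e 0 = 1" "e 1 = 1" for t
    by (auto simp: e_def norm_exp_eq_Re exp_eq_1)
  have F0: "F x \<noteq> 0" if "x \<in> unit_square" for x
  proof
    assume 0: "F x = 0"
    obtain s t where x: "x = (s, t)" by fastforce
    have st: "0 \<le> s" "s \<le> 1" "0 \<le> t" "t \<le> 1" using that by (auto simp: x)
    have 1: "of_real (1 - s) + of_real s * e t = 0" and 2: "s * (1 - s) * t * (1 - t) = 0"
      using 0 by (auto simp: F_def x prod_eq_iff simp del: of_real_diff)
    from 1 have "of_real (1 - s) = - (of_real s * e t)" by (simp add: eq_neg_iff_add_eq_0)
    then have "cmod (of_real (1 - s)) = cmod (of_real s * e t)" by (metis norm_minus_cancel)
    then have "s = 1/2" using st e(1) by (simp add: norm_mult del: of_real_diff)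
    then have "t = 0 \<or> t = 1" using 2 by auto
    then show False using 1 e \<open>s = 1/2\<close> by auto
  qed
  have Fc: "continuous_on unit_square F"
    unfolding F_def e_def by (intro continuous_intros)
  have sides: "F x = (1, 0)" if "x \<in> three_sides" for x
    using that e by (auto simp: F_def three_sides_def)
  have F1: "F (1, t) = (e t, 0)" for t by (simp add: F_def)
  have "continuous_on unit_square (\<lambda>x. hopf (F x))" using Fc F0 by (intro continuous_intros) auto
  moreover have "hopf (F x) = (1, 0)" if "x \<in> frontier unit_square" for x
  proof -
    have "e t \<noteq> 0" for t by (simp add: e_def)
    then show ?thesis using that sides[of x] F1 unfolding frontier_unit_square by auto
  qed
  ultimately have "(\<lambda>x. hopf (F x)) \<in> spheroids (sphere 0 1) (1, 0)"
    using hopf_in_sphere F0 unfolding spheroids_def by blast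
  moreover have "spheroid_degree (\<lambda>x. hopf (F x)) n"
    unfolding spheroid_degree_def
    by (intro exI[of _ F] exI[of _ "\<lambda>t. 2 * of_int n * pi * \<i> * of_real t"] conjI ballI)
      (use Fc F0 sides F1 in \<open>auto intro!: continuous_intros simp: e_def\<close>)
  ultimately show thesis by (rule that)
qed

section \<open>Homotopy groups of spaces fibred over a sphere\<close>

text \<open>The classes of R are the level sets of d, so an additive invariant that decides
  equivalence and takes all values identifies the quotient with the integers. Loops and spheroids
  share this lemma.\<close>

lemma quotient_iso_integer_group:
  fixes d :: "'a \<Rightarrow> int"
  assumes R: "\<And>x y. x \<in> A \<Longrightarrow> R x y \<longleftrightarrow> y \<in> A \<and> d x = d y"
    and m: "\<And>x y. x \<in> A \<Longrightarrow> y \<in> A \<Longrightarrow> m x y \<in> A \<and> d (m x y) = d x + d y"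
    and surj: "\<And>n. \<exists>x\<in>A. d x = n"
  shows "\<lparr>carrier = A // {(x, y). R x y}, monoid.mult = (\<lambda>P Q. \<Union>x\<in>P. \<Union>y\<in>Q. {z. R (m x y) z}), one = e\<rparr>
          \<cong> integer_group"
proof -
  define K where "K n = {x \<in> A. d x = n}" for n
  have cls: "{(x, y). R x y} `` {x} = K (d x)" if "x \<in> A" for x
  proof -
    have "{(x, y). R x y} `` {x} = {y. y \<in> A \<and> d x = d y}" using R[OF that] by (simp add: Image_def)
    then show ?thesis unfolding K_def by (simp only: eq_commute)
  qed
  have quo: "A // {(x, y). R x y} = range K"
  proof -
    have "A // {(x, y). R x y} = (\<lambda>x. K (d x)) ` A"
      unfolding quotient_def using cls by (simp add: UNION_singleton_eq_range cong: image_cong)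
    also have "\<dots> = range K"     proof
      show "range K \<subseteq> (\<lambda>x. K (d x)) ` A"
      proof
        fix P assume "P \<in> range K"
        then obtain n where "P = K n" by blast
        moreover obtain x where "x \<in> A" "d x = n" using surj by blast
        ultimately show "P \<in> (\<lambda>x. K (d x)) ` A" by blast
      qed
    qed auto
    finally show ?thesis .
  qed
  have inj: "inj K"
  proof (rule injI)
    fix n n' assume "K n = K n'"
    moreover obtain x where "x \<in> A" "d x = n" using surj by blast
    ultimately have "x \<in> K n'" by (metis (mono_tags, lifting) K_def mem_Collect_eq)
    then show "n = n'" using \<open>d x = n\<close> by (simp add: K_def)
  qed
  have mult: "(\<Union>x\<in>K n. \<Union>y\<in>K n'. {z. R (m x y) z}) = K (n + n')" for n n'
  proof -
    have "{z. R (m x y) z} = K (n + n')" if "x \<in> K n" "y \<in> K n'" for x y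
    proof -
      have xy: "x \<in> A" "y \<in> A" "d x = n" "d y = n'" using that by (auto simp: K_def)
      have "{z. R (m x y) z} = {z. z \<in> A \<and> d (m x y) = d z}" using R[of "m x y"] m[OF xy(1,2)] by simp
      also have "\<dots> = K (n + n')" unfolding K_def using m[OF xy(1,2)] xy by (simp only: eq_commute)
      finally show ?thesis .
    qed
    then have "(\<Union>x\<in>K n. \<Union>y\<in>K n'. {z. R (m x y) z}) = (\<Union>x\<in>K n. \<Union>y\<in>K n'. K (n + n'))"
      by simp
    moreover have "K n \<noteq> {}" "K n' \<noteq> {}" using surj[of n] surj[of n'] by (auto simp: K_def)
    ultimately show ?thesis by simp
  qed
  have "inv_into UNIV K \<in> iso \<lparr>carrier = A // {(x, y). R x y}, monoid.mult = (\<lambda>P Q. \<Union>x\<in>P. \<Union>y\<in>Q. {z. R (m x y) z}), one = e\<rparr> integer_group"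
    unfolding iso_def hom_def quo
    using inj mult by (auto simp: bij_betw_inv_into inj_imp_bij_betw_inv)
  then show ?thesis by (rule is_isoI)
qed

text \<open>The hypotheses \<open>\<phi>\<close>, \<open>\<sigma>\<close> describe a space fibred over a sphere with fibres that are starlike about a section
  through the base point, which makes the sphere a strong deformation retract.\<close>

lemma second_homotopy_group_iso_integer_group:
  fixes X :: "'a::real_normed_vector set" and \<phi> :: "'a \<Rightarrow> real \<times> complex"
  assumes \<phi>: "continuous_on X \<phi>" "\<phi> ` X \<subseteq> sphere 0 1" "\<phi> a = (1, 0)"
    and \<sigma>: "continuous_on (sphere 0 1) \<sigma>" "\<sigma> ` sphere 0 1 \<subseteq> X" "\<sigma> (1, 0) = a"
    and id: "\<And>y. y \<in> sphere 0 1 \<Longrightarrow> \<phi> (\<sigma> y) = y"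
    and seg: "\<And>x. x \<in> X \<Longrightarrow> closed_segment x (\<sigma> (\<phi> x)) \<subseteq> X"
  shows "second_homotopy_group X a \<cong> integer_group"
proof -
  define d where "d f = (THE n. spheroid_degree (\<phi> \<circ> f) n)" for f
  have ps: "\<phi> \<circ> f \<in> spheroids (sphere 0 1) (1, 0)" if "f \<in> spheroids X a" for f
    using spheroids_image[OF that \<phi>(1,2)] \<phi>(3) by simp
  have d: "spheroid_degree (\<phi> \<circ> f) n \<longleftrightarrow> d f = n" if f: "f \<in> spheroids X a" for f n
  proof -
    obtain k where k: "spheroid_degree (\<phi> \<circ> f) k" using spheroid_degree_exists ps[OF f] by blast
    \<comment> \<open>Reflexivity of homotopy turns the invariance of the degree into its
      uniqueness.\<close>
    have "homotopic_spheroids (sphere 0 1) (1, 0) (\<phi> \<circ> f) (\<phi> \<circ> f)"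
      using k spheroid_degree_imp_homotopic by blast
    then have "n = k" if "spheroid_degree (\<phi> \<circ> f) n" for n
      using spheroid_degree_homotopic that k by blast
    then show ?thesis unfolding d_def using k by (metis the_equality)
  qed
  show ?thesis
    unfolding second_homotopy_group_def
  proof (rule quotient_iso_integer_group[where d = d])
    fix f g assume f: "f \<in> spheroids X a"
    show "homotopic_spheroids X a f g \<longleftrightarrow> g \<in> spheroids X a \<and> d f = d g"
    proof safe
      assume h: "homotopic_spheroids X a f g"
      then show g: "g \<in> spheroids X a" by (rule homotopic_spheroids_imp_spheroids)
      have "homotopic_spheroids (sphere 0 1) (1, 0) (\<phi> \<circ> f) (\<phi> \<circ> g)"
        using homotopic_spheroids_image[OF h \<phi>(1,2)] \<phi>(3) by simp
      then show "d f = d g" using spheroid_degree_homotopic d f g by blast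
    next
      assume g: "g \<in> spheroids X a" and "d f = d g"
      then have "homotopic_spheroids (sphere 0 1) (1, 0) (\<phi> \<circ> f) (\<phi> \<circ> g)"
        using spheroid_degree_imp_homotopic d f by blast
      from homotopic_spheroids_image[OF this \<sigma>(1,2)]
      have 1: "homotopic_spheroids X a (\<sigma> \<circ> (\<phi> \<circ> f)) (\<sigma> \<circ> (\<phi> \<circ> g))" using \<sigma>(3) by simp
      \<comment> \<open>The segments contract k onto its image in the section; over the frontier
        they are the single point a, since \<sigma> leads from \<open>(1, 0)\<close> back to
        a.\<close>
      have 2: "homotopic_spheroids X a k (\<sigma> \<circ> (\<phi> \<circ> k))" if "k \<in> spheroids X a" for k
      proof (rule homotopic_spheroids_linear[OF that])
        show "\<sigma> \<circ> (\<phi> \<circ> k) \<in> spheroids X a" using spheroids_image[OF ps[OF that] \<sigma>(1,2)] \<sigma>(3) by simp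
        show "closed_segment (k x) ((\<sigma> \<circ> (\<phi> \<circ> k)) x) \<subseteq> X" if "x \<in> unit_square" for x
          using seg[of "k x"] that \<open>k \<in> spheroids X a\<close> unfolding spheroids_def by auto
      qed
      show "homotopic_spheroids X a f g"
        using 1 2[OF f] 2[OF g] homotopic_spheroids_trans homotopic_spheroids_sym by blast
    qed
  next
    fix f g assume fg: "f \<in> spheroids X a" "g \<in> spheroids X a"
    have j: "join_spheroids f g \<in> spheroids X a" by (rule join_spheroids_in_spheroids[OF fg])
    have "\<phi> \<circ> join_spheroids f g = join_spheroids (\<phi> \<circ> f) (\<phi> \<circ> g)"
      by (auto simp: join_spheroids_def fun_eq_iff)
    then show "join_spheroids f g \<in> spheroids X a \<and> d (join_spheroids f g) = d f + d g"
      using spheroid_degree_join d fg j by metis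
  next
    fix n
    obtain f where f: "f \<in> spheroids (sphere 0 1) (1, 0)" "spheroid_degree f n"
      using spheroid_degree_surj .
    have s: "\<sigma> \<circ> f \<in> spheroids X a" using spheroids_image[OF f(1) \<sigma>(1,2)] \<sigma>(3) by simp
    have "homotopic_spheroids (sphere 0 1) (1, 0) (\<phi> \<circ> (\<sigma> \<circ> f)) f"
    proof (rule homotopic_spheroids_linear[OF ps[OF s] f(1)])
      show "closed_segment ((\<phi> \<circ> (\<sigma> \<circ> f)) x) (f x) \<subseteq> sphere 0 1" if "x \<in> unit_square" for x
      proof -
        have "f x \<in> sphere 0 1" using f(1) that unfolding spheroids_def by blast
        then show ?thesis using id by simp
      qed
    qed
    then have "d (\<sigma> \<circ> f) = n"
      using spheroid_degree_homotopic f(2) d[OF s] by blast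
    then show "\<exists>x\<in>spheroids X a. d x = n" using s by blast
  qed
qed

section \<open>Winding numbers of loops, and the fundamental group\<close>

definition loop_degree :: "(real \<Rightarrow> complex) \<Rightarrow> int \<Rightarrow> bool" where
  "loop_degree p n \<longleftrightarrow>
    (\<exists>l. continuous_on {0..1} l \<and> (\<forall>t\<in>{0..1}. p t = exp (l t)) \<and> l 0 = 0 \<and> l 1 = 2 * of_int n * pi * \<i>)"

abbreviation loops_at :: "'a::topological_space set \<Rightarrow> 'a \<Rightarrow> (real \<Rightarrow> 'a) set" where
  "loops_at X a \<equiv> {p. path p \<and> path_image p \<subseteq> X \<and> pathstart p = a \<and> pathfinish p = a}"

lemma loop_degree_exists:
  assumes "p \<in> loops_at (sphere 0 1) 1" obtains n where "loop_degree p n"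
proof -
  have "continuous_on {0..1} p" using assms by (simp add: path_def)
  moreover have "p t \<noteq> 0" if "t \<in> {0..1}" for t
  proof -
    have "norm (p t) = 1" using assms that by (auto simp: path_image_def image_subset_iff)
    then show ?thesis by auto
  qed
  ultimately obtain l where l: "continuous_on {0..1} l" "\<And>t. t \<in> {0..1} \<Longrightarrow> p t = exp (l t)"
    using log_on_convex[OF _ convex_real_interval(5)] by blast
  have e: "exp (l 0) = 1" "exp (l 1) = 1"
    using l(2)[of 0] l(2)[of 1] assms by (auto simp: pathstart_def pathfinish_def)
  obtain n where n: "l 1 - l 0 = 2 * of_int n * pi * \<i>"
    using exp_eq_1_int[of "l 1 - l 0"] e by (auto simp: exp_diff)
  have "loop_degree p n"
    unfolding loop_degree_def
    by (intro exI[of _ "\<lambda>t. l t - l 0"]) (use l e n in \<open>auto intro!: continuous_intros simp: exp_diff\<close>)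
  then show thesis by (rule that)
qed

lemma loop_degree_homotopic:
  assumes "homotopic_paths (sphere 0 1) p q" "pathstart p = 1" "pathfinish p = 1"
    "loop_degree p n" "loop_degree q m"
  shows "n = m"
proof -
  obtain h where h: "continuous_on unit_square h" "h \<in> unit_square \<rightarrow> sphere 0 1"
    "\<And>x. x \<in> {0..1} \<Longrightarrow> h (0, x) = p x" "\<And>x. x \<in> {0..1} \<Longrightarrow> h (1, x) = q x"
    "\<And>t. t \<in> {0..1} \<Longrightarrow> h (t, 0) = 1 \<and> h (t, 1) = 1"
    using assms(1,2,3) unfolding homotopic_paths by (auto simp: pathstart_def pathfinish_def)
  have "convex unit_square" by (intro convex_Times) auto
  moreover have "h z \<noteq> 0" if "z \<in> unit_square" for z using Pi_mem[OF h(2) that] by auto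
  ultimately obtain L where L: "continuous_on unit_square L" "\<And>z. z \<in> unit_square \<Longrightarrow> h z = exp (L z)"
    using log_on_convex h(1) by blast
  have swap: "continuous_on {0..1} (\<lambda>\<tau>. L (\<tau>, t))" if "t \<in> {0..1}" for t
    by (rule continuous_on_compose2[OF L(1)]) (use that in \<open>auto intro!: continuous_intros\<close>)
  have *: "L (0, 1) - L (0, 0) = L (1, 1) - L (1, 0)"
  proof (rule exp_lift_diff_const[of "{0..1}" "\<lambda>\<tau>. L (\<tau>, 1)" "\<lambda>\<tau>. L (\<tau>, 0)"])
    show "exp (L (\<tau>, 1)) = exp (L (\<tau>, 0))" if "\<tau> \<in> {0..1}" for \<tau>
      using L(2)[of "(\<tau>, 1)"] L(2)[of "(\<tau>, 0)"] h(5)[OF that] that by simp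
  qed (auto intro!: swap)
  have deg: "L (\<tau>, 1) - L (\<tau>, 0) = 2 * of_int j * pi * \<i>"
    if k: "loop_degree k j" "\<tau> \<in> {0..1}" "\<And>x. x \<in> {0..1} \<Longrightarrow> h (\<tau>, x) = k x" for \<tau> k j
  proof -
    obtain l where l: "continuous_on {0..1} l" "\<And>t. t\<in>{0..1} \<Longrightarrow> k t = exp (l t)" "l 0 = 0" "l 1 = 2 * of_int j * pi * \<i>"
      using k(1) unfolding loop_degree_def by blast
    have "L (\<tau>, 1) - l 1 = L (\<tau>, 0) - l 0"
    proof (rule exp_lift_diff_const[of "{0..1}" "\<lambda>t. L (\<tau>, t)" l])
      show "exp (L (\<tau>, t)) = exp (l t)" if "t \<in> {0..1}" for t
        using L(2)[of "(\<tau>, t)"] l(2)[OF that] k(3)[OF that] k(2) that by auto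
    qed (use l k(2) in \<open>auto intro!: continuous_on_slice[OF L(1)]\<close>)
    then show ?thesis using l(3,4) by (simp add: algebra_simps)
  qed
  have "2 * of_int n * pi * \<i> = 2 * of_int m * pi * \<i>"
    using deg[OF assms(4), of 0] deg[OF assms(5), of 1] h(3,4) * by simp
  then show ?thesis by simp
qed

text \<open>Loops in the unit circle have imaginary logarithms, and convex combinations of these are
  imaginary again, so their exponentials stay in the circle. Equal degrees give equal end values,
  which keeps the end points fixed.\<close>

lemma loop_degree_imp_homotopic:
  assumes "loop_degree p n" "loop_degree q n"
    "p \<in> loops_at (sphere 0 1) 1" "q \<in> loops_at (sphere 0 1) 1"
  shows "homotopic_paths (sphere 0 1) p q"
proof -
  obtain l where l: "continuous_on {0..1} l" "\<And>t. t\<in>{0..1} \<Longrightarrow> p t = exp (l t)" "l 0 = 0" "l 1 = 2 * of_int n * pi * \<i>"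
    using assms(1) unfolding loop_degree_def by blast
  obtain m where m: "continuous_on {0..1} m" "\<And>t. t\<in>{0..1} \<Longrightarrow> q t = exp (m t)" "m 0 = 0" "m 1 = 2 * of_int n * pi * \<i>"
    using assms(2) unfolding loop_degree_def by blast
  have re: "Re (l t) = 0" "Re (m t) = 0" if "t \<in> {0..1}" for t
  proof -
    have "norm (p t) = 1" "norm (q t) = 1" using assms(3,4) that by (auto simp: path_image_def image_subset_iff)
    then show "Re (l t) = 0" "Re (m t) = 0" using l(2)[OF that] m(2)[OF that] by (simp_all add: norm_exp_eq_Re)
  qed
  show ?thesis
    unfolding homotopic_paths
  proof (intro exI[of _ "\<lambda>z. exp ((1 - of_real (fst z)) * l (snd z) + of_real (fst z) * m (snd z))"] conjI ballI)
    have "continuous_on unit_square (\<lambda>z. l (snd z))" "continuous_on unit_square (\<lambda>z. m (snd z))"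
      by (auto intro!: continuous_on_compose2[OF l(1)] continuous_on_compose2[OF m(1)] continuous_intros)
    then show "continuous_on unit_square (\<lambda>z. exp ((1 - of_real (fst z)) * l (snd z) + of_real (fst z) * m (snd z)))"
      by (intro continuous_intros)
    show "(\<lambda>z. exp ((1 - of_real (fst z)) * l (snd z) + of_real (fst z) * m (snd z))) \<in> unit_square \<rightarrow> sphere 0 1"
      using re by (auto simp: norm_exp_eq_Re)
    show "pathstart ((\<lambda>z. exp ((1 - of_real (fst z)) * l (snd z) + of_real (fst z) * m (snd z))) \<circ> Pair t) = pathstart p"
      for t :: real
      using l(2)[of 0] l(3) m(3) by (simp add: pathstart_def)
    show "pathfinish ((\<lambda>z. exp ((1 - of_real (fst z)) * l (snd z) + of_real (fst z) * m (snd z))) \<circ> Pair t) = pathfinish p"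
      for t :: real
      using l(2)[of 1] l(4) m(4) by (simp add: pathfinish_def flip: distrib_right)
  qed (use l m in auto)
qed

lemma loop_degree_join:
  assumes "loop_degree p n" "loop_degree q m"
  shows "loop_degree (p +++ q) (n + m)"
proof -
  obtain l where l: "continuous_on {0..1} l" "\<And>t. t\<in>{0..1} \<Longrightarrow> p t = exp (l t)" "l 0 = 0" "l 1 = 2 * of_int n * pi * \<i>"
    using assms(1) unfolding loop_degree_def by blast
  obtain k where k: "continuous_on {0..1} k" "\<And>t. t\<in>{0..1} \<Longrightarrow> q t = exp (k t)" "k 0 = 0" "k 1 = 2 * of_int m * pi * \<i>"
    using assms(2) unfolding loop_degree_def by blast
  have l1: "exp (l 1) = 1" by (simp add: l(4) exp_eq_1)
  \<comment> \<open>The second logarithm is shifted by \<open>l 1\<close>: this does not affect its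
    exponential and makes the two pieces meet.\<close>
  have "path (l +++ (\<lambda>t. l 1 + k t))"
    by (rule path_join_imp) (use l k in \<open>auto simp: path_def pathstart_def pathfinish_def intro!: continuous_intros\<close>)
  then show ?thesis
    unfolding loop_degree_def
    by (intro exI[of _ "l +++ (\<lambda>t. l 1 + k t)"])
       (use l k l1 in \<open>auto simp: path_def joinpaths_def exp_add algebra_simps\<close>)
qed

lemma loop_degree_surj:
  obtains p where "p \<in> loops_at (sphere 0 1) 1" "loop_degree p n"
proof -
  define l where "l t = 2 * of_int n * pi * \<i> * complex_of_real t" for t
  have "(\<lambda>t. exp (l t)) \<in> loops_at (sphere 0 1) 1"
    by (auto simp: l_def path_def path_image_def pathstart_def pathfinish_def norm_exp_eq_Re exp_eq_1 intro!: continuous_intros)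
  moreover have "loop_degree (\<lambda>t. exp (l t)) n"
    unfolding loop_degree_def by (intro exI[of _ l]) (auto simp: l_def intro!: continuous_intros)
  ultimately show thesis by (rule that)
qed

lemma loops_at_image:
  assumes "p \<in> loops_at X a" "continuous_on X k" "k ` X \<subseteq> Y"
  shows "k \<circ> p \<in> loops_at Y (k a)"
  using assms
  by (auto simp: path_image_compose pathstart_compose pathfinish_compose
      intro!: path_continuous_image continuous_on_subset[OF assms(2)])

lemma fundamental_group_iso_integer_group:
  fixes X :: "'a::real_normed_vector set" and \<phi> :: "'a \<Rightarrow> complex"
  assumes \<phi>: "continuous_on X \<phi>" "\<phi> ` X \<subseteq> sphere 0 1" "\<phi> a = 1"
    and \<sigma>: "continuous_on (sphere 0 1) \<sigma>" "\<sigma> ` sphere 0 1 \<subseteq> X" "\<sigma> 1 = a"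
    and id: "\<And>y. y \<in> sphere 0 1 \<Longrightarrow> \<phi> (\<sigma> y) = y"
    and seg: "\<And>x. x \<in> X \<Longrightarrow> closed_segment x (\<sigma> (\<phi> x)) \<subseteq> X"
  shows "fundamental_group X a \<cong> integer_group"
proof -
  define d where "d f = (THE n. loop_degree (\<phi> \<circ> f) n)" for f
  have ps: "\<phi> \<circ> p \<in> loops_at (sphere 0 1) 1" if "p \<in> loops_at X a" for p
    using loops_at_image[OF that \<phi>(1,2)] \<phi>(3) by simp
  have d: "loop_degree (\<phi> \<circ> p) n \<longleftrightarrow> d p = n" if p: "p \<in> loops_at X a" for p n
  proof -
    obtain k where k: "loop_degree (\<phi> \<circ> p) k" using loop_degree_exists ps[OF p] by blast
    have "homotopic_paths (sphere 0 1) (\<phi> \<circ> p) (\<phi> \<circ> p)"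
      using ps[OF p] by simp
    then have "n = k" if "loop_degree (\<phi> \<circ> p) n" for n
      using loop_degree_homotopic that k ps[OF p] by blast
    then show ?thesis unfolding d_def using k by (metis the_equality)
  qed
  show ?thesis
    unfolding fundamental_group_def
  proof (rule quotient_iso_integer_group[where d = d])
    fix p q assume p: "p \<in> loops_at X a"
    show "homotopic_paths X p q \<longleftrightarrow> q \<in> loops_at X a \<and> d p = d q"
    proof (rule iffI)
      assume h: "homotopic_paths X p q"
      then have q: "q \<in> loops_at X a"
        using p homotopic_paths_imp_path homotopic_paths_imp_subset homotopic_paths_imp_pathstart homotopic_paths_imp_pathfinish
        by (metis (mono_tags, lifting) mem_Collect_eq)
      have "homotopic_paths (sphere 0 1) (\<phi> \<circ> p) (\<phi> \<circ> q)"
        using homotopic_paths_continuous_image[OF h \<phi>(1)] \<phi>(2) by (simp add: image_subset_iff_funcset)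
      then have "d p = d q" using loop_degree_homotopic d p q ps[OF p] by blast
      then show "q \<in> loops_at X a \<and> d p = d q" using q by blast
    next
      assume qd: "q \<in> loops_at X a \<and> d p = d q"
      then have q: "q \<in> loops_at X a" by blast
      have "loop_degree (\<phi> \<circ> p) (d p)" "loop_degree (\<phi> \<circ> q) (d p)" using d[OF p] d[OF q] qd by simp_all
      from homotopic_paths_continuous_image[OF loop_degree_imp_homotopic[OF this ps[OF p] ps[OF q]] \<sigma>(1)]
      have 1: "homotopic_paths X (\<sigma> \<circ> (\<phi> \<circ> p)) (\<sigma> \<circ> (\<phi> \<circ> q))" using \<sigma>(2) by (simp add: image_subset_iff_funcset)
      have 2: "homotopic_paths X k (\<sigma> \<circ> (\<phi> \<circ> k))" if k: "k \<in> loops_at X a" for k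
      proof -
        have s: "\<sigma> \<circ> (\<phi> \<circ> k) \<in> loops_at X a" using loops_at_image[OF ps[OF k] \<sigma>(1,2)] \<sigma>(3) by simp
        have "closed_segment (k t) ((\<sigma> \<circ> (\<phi> \<circ> k)) t) \<subseteq> X" if "t \<in> {0..1}" for t
        proof -
          have "k t \<in> X" using k that unfolding path_image_def by blast
          then show ?thesis using seg by simp
        qed
        then show ?thesis using s k by (intro homotopic_paths_linear) simp_all
      qed
      show "homotopic_paths X p q"
        using 1 2[OF p] 2[OF q] homotopic_paths_trans homotopic_paths_sym by blast
    qed
  next
    fix p q assume pq: "p \<in> loops_at X a" "q \<in> loops_at X a"
    then have j: "p +++ q \<in> loops_at X a" by (simp add: path_image_join)
    have "loop_degree (\<phi> \<circ> (p +++ q)) (d p + d q)"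
      unfolding path_compose_join using loop_degree_join d[OF pq(1)] d[OF pq(2)] by simp
    then show "p +++ q \<in> loops_at X a \<and> d (p +++ q) = d p + d q"
      using d[OF j] j by blast
  next
    fix n
    obtain p where p: "p \<in> loops_at (sphere 0 1) 1" "loop_degree p n"
      using loop_degree_surj .
    have s: "\<sigma> \<circ> p \<in> loops_at X a" using loops_at_image[OF p(1) \<sigma>(1,2)] \<sigma>(3) by simp
    have "homotopic_paths (sphere 0 1) (\<phi> \<circ> (\<sigma> \<circ> p)) p"
    proof (rule homotopic_paths_eq)
      show "path (\<phi> \<circ> (\<sigma> \<circ> p))" "path_image (\<phi> \<circ> (\<sigma> \<circ> p)) \<subseteq> sphere 0 1" using ps[OF s] by auto
      show "(\<phi> \<circ> (\<sigma> \<circ> p)) t = p t" if "t \<in> {0..1}" for t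
      proof -
        have "p t \<in> sphere 0 1" using p(1) that unfolding path_image_def by blast
        then show ?thesis using id by simp
      qed
    qed
    then have "d (\<sigma> \<circ> p) = n"
      using loop_degree_homotopic[OF _ _ _ _ p(2)] loop_degree_exists[OF ps[OF s]] d[OF s] ps[OF s] by blast
    then show "\<exists>p\<in>loops_at X a. d p = n" using s by blast
  qed
qed

section \<open>Starlike fibrations\<close>

text \<open>The segments have to stay in X, not in a fibre; this already gives a linear homotopy
  from the identity to \<open>\<sigma> \<circ> \<phi>\<close>. The condition
  \<open>\<sigma> (\<phi> a) = a\<close> makes it stationary at a, as based groups require.\<close>

definition starlike_fibration ::
    "'a::real_normed_vector set \<Rightarrow> 'b::topological_space set \<Rightarrow> 'a \<Rightarrow> ('a \<Rightarrow> 'b) \<Rightarrow> ('b \<Rightarrow> 'a) \<Rightarrow> bool" where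
  "starlike_fibration X S a \<phi> \<sigma> \<longleftrightarrow>
    continuous_on X \<phi> \<and> \<phi> ` X \<subseteq> S \<and> continuous_on S \<sigma> \<and> \<sigma> ` S \<subseteq> X \<and>
    (\<forall>y\<in>S. \<phi> (\<sigma> y) = y) \<and> \<sigma> (\<phi> a) = a \<and> (\<forall>x\<in>X. closed_segment x (\<sigma> (\<phi> x)) \<subseteq> X)"

lemma starlike_fibrationD:
  assumes "starlike_fibration X S a \<phi> \<sigma>"
  shows "continuous_on X \<phi>" "\<phi> ` X \<subseteq> S" "continuous_on S \<sigma>" "\<sigma> ` S \<subseteq> X"
    "\<And>y. y \<in> S \<Longrightarrow> \<phi> (\<sigma> y) = y" "\<sigma> (\<phi> a) = a" "\<And>x. x \<in> X \<Longrightarrow> closed_segment x (\<sigma> (\<phi> x)) \<subseteq> X"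
  using assms by (simp_all add: starlike_fibration_def)

text \<open>The section may depend on a. The first conjunct excludes the vacuous case, in which an
  empty X would be fibred over every S.\<close>

definition starlike_fibred :: "'a::real_normed_vector set \<Rightarrow> 'b::topological_space set \<Rightarrow> bool" where
  "starlike_fibred X S \<longleftrightarrow>
    (X = {} \<longrightarrow> S = {}) \<and> (\<forall>a\<in>X. \<exists>\<phi> \<sigma>. starlike_fibration X S a \<phi> \<sigma>)"

lemma starlike_fibred_homotopy_eqv:
  fixes S :: "'b::real_normed_vector set"
  assumes "starlike_fibred X S" shows "X homotopy_eqv S"
proof (cases "X = {}")
  case True
  have "S = {}" using True assms by (simp add: starlike_fibred_def)
  show ?thesis unfolding True \<open>S = {}\<close> by (rule homotopy_eqv_empty1[THEN iffD2, OF refl])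
next
  case False
  then obtain a where "a \<in> X" by blast
  obtain \<phi> \<sigma> where "starlike_fibration X S a \<phi> \<sigma>"
    using assms \<open>a \<in> X\<close> unfolding starlike_fibred_def by blast
  note * = starlike_fibrationD[OF this]
  have "homotopic_with_canon (\<lambda>x. True) X X id (\<sigma> \<circ> \<phi>)"
  proof (rule homotopic_with_linear)
    show "continuous_on X (\<sigma> \<circ> \<phi>)"
      by (rule continuous_on_compose[OF *(1) continuous_on_subset[OF *(3,2)]])
  qed (use *(7) in auto)
  moreover have "homotopic_with_canon (\<lambda>x. True) S S (\<phi> \<circ> \<sigma>) id"
    using *(5) by (intro homotopic_with_equal) (auto simp: continuous_map_id)
  ultimately show ?thesis
    unfolding homotopy_equivalent_space_def
    using * by (intro exI[of _ \<phi>] exI[of _ \<sigma>])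
      (simp add: homotopic_with_sym[of _ _ _ id] image_subset_iff_funcset)
qed

lemma starlike_fibred_affine_image:
  fixes T B :: "'a::euclidean_space \<Rightarrow> 'a"
  assumes W: "starlike_fibred W S" and lin: "linear T" "linear B"
    and BT: "\<And>x. B (T x) = x"
  shows "starlike_fibred ((\<lambda>x. m + T x) ` W) S"
proof -
  define A where "A x = m + T x" for x
  define A' where "A' r = B (r - m)" for r
  have A'A: "A' (A x) = x" for x by (simp add: A_def A'_def BT)
  have cont: "continuous_on X A" "continuous_on X A'" for X
    unfolding A_def A'_def
    by (auto intro!: continuous_intros linear_continuous_on_compose[OF _ lin(1)] linear_continuous_on_compose[OF _ lin(2)])
  have seg: "closed_segment (A x) (A y) = A ` closed_segment x y" for x y
    unfolding A_def closed_segment_translation closed_segment_linear_image[OF lin(1)] image_image ..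
  have "starlike_fibred (A ` W) S"
    unfolding starlike_fibred_def
  proof (intro conjI ballI impI)
    show "S = {}" if "A ` W = {}" using that W by (simp add: starlike_fibred_def)
    fix r assume "r \<in> A ` W"
    then obtain a where a: "a \<in> W" "r = A a" by blast
    obtain \<phi> \<sigma> where "starlike_fibration W S a \<phi> \<sigma>"
    using W a(1) unfolding starlike_fibred_def by blast
  note * = starlike_fibrationD[OF this]
    have im: "A' ` (A ` W) = W" by (simp add: image_image A'A)
    show "\<exists>\<phi> \<sigma>. starlike_fibration (A ` W) S r \<phi> \<sigma>"
      unfolding starlike_fibration_def
    proof (intro exI[of _ "\<phi> \<circ> A'"] exI[of _ "A \<circ> \<sigma>"] conjI)
      show "continuous_on (A ` W) (\<phi> \<circ> A')"
        by (rule continuous_on_compose[OF cont(2)]) (use *(1) im in simp)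
      show "continuous_on S (A \<circ> \<sigma>)" by (rule continuous_on_compose[OF *(3) cont(1)])
      show "(\<phi> \<circ> A') ` (A ` W) \<subseteq> S" using *(2) by (simp only: image_comp[symmetric] im)
      show "(A \<circ> \<sigma>) ` S \<subseteq> A ` W" using *(4) by (auto simp: image_comp[symmetric])
      show "\<forall>x\<in>A ` W. closed_segment x ((A \<circ> \<sigma>) ((\<phi> \<circ> A') x)) \<subseteq> A ` W"
        using *(7) by (auto simp: A'A seg)
    qed (use * a in \<open>auto simp: A'A\<close>)
  qed
  then show ?thesis unfolding A_def .
qed

text \<open>In the scaled frame \<open>\<Psi> \<ge> 0\<close> is the convex light cone and \<open>norm (x - u x) < norm (u x)\<close> the cone in
  which the quadratic form is negative.  Points are pushed into the light cone along rays.\<close>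

lemma starlike_fibred_cone:
  fixes u :: "'a::euclidean_space \<Rightarrow> 'a" and \<Psi> :: "'a \<Rightarrow> real"
  assumes u: "linear u" "\<And>x. u (u x) = u x"
    and \<Psi>: "continuous_on UNIV \<Psi>" "\<Psi> 0 > 0"
      "\<And>t x y. 0 \<le> t \<Longrightarrow> t \<le> 1 \<Longrightarrow> (1 - t) * \<Psi> x + t * \<Psi> y \<le> \<Psi> ((1 - t) *\<^sub>R x + t *\<^sub>R y)"
  shows "starlike_fibred {x. 0 \<le> \<Psi> x \<and> norm (x - u x) < norm (u x)} (sphere 0 1 \<inter> {x. u x = x})"
    (is "starlike_fibred ?W ?S")
proof -
  \<comment> \<open>By concavity \<open>\<Psi> (h *\<^sub>R p)\<close> is at least
    \<open>(1 - h) * \<Psi> 0 + h * \<Psi> p\<close>. For \<open>\<Psi> p < 0\<close> this h makes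
    the bound 0, otherwise it is 1; the maximum in the denominator joins both cases
    continuously.\<close>
  define h where "h p = \<Psi> 0 / (\<Psi> 0 + max 0 (- \<Psi> p))" for p
  have h: "0 < h p" "h p \<le> 1" "0 \<le> \<Psi> p \<Longrightarrow> h p = 1" for p
    using \<Psi>(2) by (auto simp: h_def)
  have \<Psi>h: "0 \<le> \<Psi> (h p *\<^sub>R p)" for p
  proof -
    have "0 \<le> (1 - h p) * \<Psi> 0 + h p * \<Psi> p"
    proof (cases "0 \<le> \<Psi> p")
      case True then show ?thesis using h(3) by simp
    next
      case False
      then have "h p * (\<Psi> 0 - \<Psi> p) = \<Psi> 0" using \<Psi>(2) by (simp add: h_def max_def)
      then show ?thesis by (simp add: algebra_simps)
    qed
    also have "\<dots> \<le> \<Psi> (h p *\<^sub>R p)" using \<Psi>(3)[of "h p" 0 p] h(1,2)[of p] by (simp add: less_imp_le)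
    finally show ?thesis .
  qed
  have hc: "continuous_on UNIV h"
  proof -
    have "\<Psi> 0 + max 0 (- \<Psi> p) \<noteq> 0" for p using \<Psi>(2) by (smt (verit))
    then show ?thesis unfolding h_def by (intro continuous_intros \<Psi>(1)) auto
  qed
  have uc: "continuous_on X u" for X by (rule linear_continuous_on) (simp add: linear_conv_bounded_linear[symmetric] u(1))
  have in_W: "h p *\<^sub>R p \<in> ?W" if "norm (p - u p) < norm (u p)" for p
  proof -
    have "h p *\<^sub>R p - u (h p *\<^sub>R p) = h p *\<^sub>R (p - u p)" "u (h p *\<^sub>R p) = h p *\<^sub>R u p"
      by (simp_all add: linear_scale[OF u(1)] algebra_simps)
    then show ?thesis using \<Psi>h h(1)[of p] that by simp
  qed
  show ?thesis
    unfolding starlike_fibred_def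
  proof (intro conjI ballI impI)
    assume W: "?W = {}"
    show "?S = {}"
    proof (rule equals0I)
      fix w assume "w \<in> ?S"
      then have "h w *\<^sub>R w \<in> ?W" by (intro in_W) auto
      then show False using W by blast
    qed
  next
    fix a assume a: "a \<in> ?W"
    \<comment> \<open>This replaces the direction of \<open>u a\<close> by w and keeps its length
      and the part \<open>a - u a\<close>, so the result stays in the open cone and
      \<open>p (\<phi> a) = a\<close>. It may leave the region \<open>0 \<le> \<Psi>\<close>, hence
      the factor h in \<sigma>.\<close>
    define p where "p w = norm (u a) *\<^sub>R w + (a - u a)" for w
    define \<sigma> where "\<sigma> w = h (p w) *\<^sub>R p w" for w
    define \<phi> where "\<phi> x = u x /\<^sub>R norm (u x)" for x
    have ua: "0 < norm (u a)" using a by (auto intro: le_less_trans[OF norm_ge_zero])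
    have up: "u (p w) = norm (u a) *\<^sub>R w" "p w - u (p w) = a - u a" if "w \<in> ?S" for w
    proof -
      show "u (p w) = norm (u a) *\<^sub>R w"
        using that by (simp add: p_def linear_add[OF u(1)] linear_scale[OF u(1)] linear_diff[OF u(1)] u(2))
      then show "p w - u (p w) = a - u a" by (simp add: p_def)
    qed
    have \<sigma>W: "\<sigma> w \<in> ?W" if "w \<in> ?S" for w
      unfolding \<sigma>_def
    proof (rule in_W)
      show "norm (p w - u (p w)) < norm (u (p w))"
        unfolding up(2)[OF that] using that a up(1)[OF that] by simp
    qed
    have u\<sigma>: "u (\<sigma> w) = (h (p w) * norm (u a)) *\<^sub>R w" if "w \<in> ?S" for w
      using up(1)[OF that] by (simp add: \<sigma>_def linear_scale[OF u(1)])
    have un: "u x \<noteq> 0" if "x \<in> ?W" for x using that by auto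
    have \<phi>S: "\<phi> x \<in> ?S" if "x \<in> ?W" for x
      using un[OF that] by (simp add: \<phi>_def linear_scale[OF u(1)] u(2))
    show "\<exists>\<phi> \<sigma>. starlike_fibration ?W ?S a \<phi> \<sigma>"
      unfolding starlike_fibration_def
    proof (rule exI[of _ \<phi>], rule exI[of _ \<sigma>], intro conjI ballI)
      have "\<forall>x\<in>?W. norm (u x) \<noteq> 0" using un by simp
      then show "continuous_on ?W \<phi>" unfolding \<phi>_def by (intro continuous_intros uc)
      show "\<phi> ` ?W \<subseteq> ?S" using \<phi>S by (rule image_subsetI)
      have pc: "continuous_on ?S p" unfolding p_def by (intro continuous_intros)
      then have "continuous_on ?S (\<lambda>w. h (p w))"
        by (rule continuous_on_compose2[OF hc]) simp
      then show "continuous_on ?S \<sigma>" unfolding \<sigma>_def by (intro continuous_intros pc)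
      show "\<sigma> ` ?S \<subseteq> ?W" using \<sigma>W by (rule image_subsetI)
      show "\<phi> (\<sigma> y) = y" if y: "y \<in> ?S" for y
      proof -
        have *: "(c *\<^sub>R y) /\<^sub>R norm (c *\<^sub>R y) = y" if "0 < c" for c :: real
          using that y by simp
        show ?thesis unfolding \<phi>_def u\<sigma>[OF y] by (rule *, rule mult_pos_pos[OF h(1) ua])
      qed
      have "p (\<phi> a) = a" unfolding p_def \<phi>_def using ua by simp
      then show "\<sigma> (\<phi> a) = a" using h(3)[of a] a by (simp add: \<sigma>_def)
      show "closed_segment x (\<sigma> (\<phi> x)) \<subseteq> ?W" if x: "x \<in> ?W" for x
      proof
        fix z assume "z \<in> closed_segment x (\<sigma> (\<phi> x))"
        then obtain t where t: "0 \<le> t" "t \<le> 1" "z = (1 - t) *\<^sub>R x + t *\<^sub>R \<sigma> (\<phi> x)"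
          unfolding in_segment by blast
        define y where "y = \<sigma> (\<phi> x)"
        have y: "y \<in> ?W" unfolding y_def using \<sigma>W \<phi>S x by blast
        \<comment> \<open>Both \<open>u x\<close> and \<open>u y\<close> are positive multiples of
          \<open>\<phi> x\<close>, so the norm of the u-part is affine along the segment, while the
          norm of the other part is convex; thus the strict inequality passes to z.\<close>
        define c where "c = h (p (\<phi> x)) * norm (u a)"
        have c: "0 < c" unfolding c_def using h(1) ua by simp
        have uy: "u y = c *\<^sub>R \<phi> x" unfolding y_def c_def using u\<sigma> \<phi>S x by blast
        have ux: "u x = norm (u x) *\<^sub>R \<phi> x" unfolding \<phi>_def using un[OF x] by simp
        have n1: "norm (\<phi> x) = 1" using \<phi>S[OF x] by simp
        have uz: "u z = (1 - t) *\<^sub>R u x + t *\<^sub>R u y"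
          by (simp add: t(3) y_def linear_add[OF u(1)] linear_scale[OF u(1)])
        also have "\<dots> = ((1 - t) * norm (u x) + t * c) *\<^sub>R \<phi> x"
          by (subst ux, subst uy) (simp add: algebra_simps)
        finally have "norm (u z) = \<bar>(1 - t) * norm (u x) + t * c\<bar>" using n1 by simp
        then have nu: "norm (u z) = (1 - t) * norm (u x) + t * norm (u y)"
          using t c n1 by (simp add: uy)
        have "z - u z = (1 - t) *\<^sub>R (x - u x) + t *\<^sub>R (y - u y)"
          unfolding uz by (simp add: t(3) y_def algebra_simps)
        then have "norm (z - u z) \<le> (1 - t) * norm (x - u x) + t * norm (y - u y)"
          using norm_triangle_ineq[of "(1 - t) *\<^sub>R (x - u x)" "t *\<^sub>R (y - u y)"] t by simp
        also have "\<dots> < norm (u z)"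
        proof -
          have 1: "norm (x - u x) < norm (u x)" "norm (y - u y) < norm (u y)" using x y by auto
          show ?thesis
          proof (cases "t = 0")
            case True then show ?thesis using 1 nu by simp
          next
            case False
            then have "t * norm (y - u y) < t * norm (u y)" using 1 t by simp
            moreover have "(1 - t) * norm (x - u x) \<le> (1 - t) * norm (u x)"
              using 1 t by (intro mult_left_mono) auto
            ultimately show ?thesis unfolding nu by linarith
          qed
        qed
        finally have n: "norm (z - u z) < norm (u z)" .
        have "0 \<le> (1 - t) * \<Psi> x + t * \<Psi> y" using x y t by simp
        also have "\<dots> \<le> \<Psi> z" using \<Psi>(3)[OF t(1,2), of x y] by (simp add: t(3) y_def)
        finally show "z \<in> ?W" using n by simp
      qed
    qed
  qed
qed

text \<open>X is the union of the segments from its points to the section, each of which ends on the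
  connected image of S under \<sigma>.\<close>

lemma starlike_fibred_connected:
  assumes "starlike_fibred X S" "connected S" "S \<noteq> {}"
  shows "connected X"
proof (cases "X = {}")
  case False
  then obtain a where "a \<in> X" by blast
  obtain \<phi> \<sigma> where "starlike_fibration X S a \<phi> \<sigma>"
    using assms(1) \<open>a \<in> X\<close> unfolding starlike_fibred_def by blast
  note * = starlike_fibrationD[OF this]
  define Y where "Y x = closed_segment x (\<sigma> (\<phi> x)) \<union> \<sigma> ` S" for x
  have "connected (\<Union>x\<in>X. Y x)"
  proof (rule connected_Union)
    show "connected s" if s: "s \<in> Y ` X" for s
    proof -
      obtain x where x: "x \<in> X" "s = Y x" using s by blast
      have "\<sigma> (\<phi> x) \<in> closed_segment x (\<sigma> (\<phi> x)) \<inter> \<sigma> ` S" using *(2) x(1) by auto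
      then show ?thesis
        unfolding x(2) Y_def using connected_continuous_image[OF *(3) assms(2)]
        by (intro connected_Un connected_segment) auto
    qed
    show "\<Inter> (Y ` X) \<noteq> {}" using assms(3) by (auto simp: Y_def)
  qed
  moreover have "(\<Union>x\<in>X. Y x) = X"
  proof
    show "(\<Union>x\<in>X. Y x) \<subseteq> X" using *(4,7) by (auto simp: Y_def)
    show "X \<subseteq> (\<Union>x\<in>X. Y x)" by (auto simp: Y_def)
  qed
  ultimately show ?thesis by simp
qed simp

text \<open>As S is finite, \<phi> is constant on connected subsets of X. So the segments stay in a
  fibre, each fibre is starlike about its point of the section, and the fibres are exactly the
  components.\<close>

lemma starlike_fibred_two_points:
  fixes X :: "'a::real_normed_vector set" and S :: "'b::metric_space set"
  assumes X: "starlike_fibred X S" and S: "card S = 2"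
  shows "\<not> connected X" "card (components X) = 2" "\<And>C. C \<in> components X \<Longrightarrow> simply_connected C"
proof -
  have fin: "finite S" using S by (metis card.infinite zero_neq_numeral)
  have "S \<noteq> {}" using S by auto
  then obtain a where "a \<in> X" using X unfolding starlike_fibred_def by blast
  obtain \<phi> \<sigma> where "starlike_fibration X S a \<phi> \<sigma>"
    using X \<open>a \<in> X\<close> unfolding starlike_fibred_def by blast
  note * = starlike_fibrationD[OF this]
  have const: "\<phi> x = \<phi> y" if "connected C" "C \<subseteq> X" "x \<in> C" "y \<in> C" for C x y
  proof -
    have "connected (\<phi> ` C)" by (rule connected_continuous_image[OF continuous_on_subset[OF *(1) that(2)] that(1)])
    moreover have "finite (\<phi> ` C)" using *(2) that(2) fin by (meson finite_subset image_mono subset_trans)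
    ultimately obtain z where "\<phi> ` C \<subseteq> {z}"
      using connected_finite_iff_sing[of "\<phi> ` C"] by blast
    then show ?thesis using that(3,4) by blast
  qed
  define fib where "fib w = {x \<in> X. \<phi> x = w}" for w
  have star: "starlike (fib w)" if w: "w \<in> S" for w
    unfolding starlike_def
  proof (intro bexI[of _ "\<sigma> w"] ballI subsetI)
    show "\<sigma> w \<in> fib w" using *(4,5) w by (auto simp: fib_def)
    fix x z assume "x \<in> fib w" and z: "z \<in> closed_segment (\<sigma> w) x"
    then have x: "x \<in> X" "\<phi> x = w" by (auto simp: fib_def)
    have sub: "closed_segment (\<sigma> w) x \<subseteq> X" using *(7)[OF x(1)] x(2) by (simp add: closed_segment_commute)
    have "\<phi> z = \<phi> x" by (rule const[OF connected_segment(1) sub z]) simp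
    then show "z \<in> fib w" using sub z x(2) by (auto simp: fib_def)
  qed
  have comp: "connected_component_set X x = fib (\<phi> x)" if x: "x \<in> X" for x
  proof
    have "\<phi> x \<in> S" using *(2) x by blast
    then show "fib (\<phi> x) \<subseteq> connected_component_set X x"
      using x by (intro connected_component_maximal starlike_imp_connected star) (auto simp: fib_def)
    show "connected_component_set X x \<subseteq> fib (\<phi> x)"
    proof
      fix y assume y: "y \<in> connected_component_set X x"
      have "x \<in> connected_component_set X x" using x by (simp add: connected_component_refl)
      from const[OF connected_connected_component connected_component_subset y this]
      show "y \<in> fib (\<phi> x)" using y connected_component_subset[of X x] by (auto simp: fib_def)
    qed
  qed
  have comps: "components X = fib ` S"
  proof
    show "components X \<subseteq> fib ` S"
    proof
      fix C assume "C \<in> components X"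
      then obtain x where "x \<in> X" "C = connected_component_set X x" unfolding components_iff by blast
      then show "C \<in> fib ` S" using comp *(2) by auto
    qed
    show "fib ` S \<subseteq> components X"
    proof
      fix C assume "C \<in> fib ` S"
      then obtain w where w: "w \<in> S" "C = fib w" by blast
      have sw: "\<sigma> w \<in> X" "\<phi> (\<sigma> w) = w" using *(4,5) w(1) by auto
      then have "C = connected_component_set X (\<sigma> w)" using comp[OF sw(1)] w by simp
      then show "C \<in> components X" using sw(1) unfolding components_iff by blast
    qed
  qed
  have "inj_on fib S"
  proof (rule inj_onI)
    fix w w' assume w: "w \<in> S" "w' \<in> S" "fib w = fib w'"
    have "\<sigma> w \<in> fib w" using *(4,5) w(1) by (auto simp: fib_def)
    then have "\<sigma> w \<in> fib w'" using w(3) by simp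
    then show "w = w'" using *(5)[OF w(1)] by (simp add: fib_def)
  qed
  then show card2: "card (components X) = 2" unfolding comps using S by (simp add: card_image)
  show "\<not> connected X"
  proof
    assume "connected X"
    then have "components X \<subseteq> {X}" by (simp add: connected_eq_components_subset_sing)
    then have "card (components X) \<le> 1" using card_mono[of "{X}" "components X"] by simp
    then show False using card2 by simp
  qed
  show "simply_connected C" if "C \<in> components X" for C
    using that star unfolding comps by (auto intro: starlike_imp_simply_connected)
qed

section \<open>Unit spheres of subspaces with a prescribed base point\<close>

text \<open>Isometries between spaces of equal dimension do not control the image of w; the
  orthogonal map R of the intermediate space \<open>real^'n\<close> corrects it to b. Thus base
  points reach the point at which the degrees are normalised.\<close>

lemma unit_sphere_subspace_homeomorphism:
  fixes U :: "'a::euclidean_space set" and w :: 'a and b :: "'b::euclidean_space"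
  assumes U: "subspace U" "w \<in> U" "norm w = 1" and b: "norm b = 1"
    and dims: "dim U = CARD('n::finite)" "DIM('b) = CARD('n)"
  obtains f g where "continuous_on UNIV f" "continuous_on UNIV g" "f ` (sphere 0 1 \<inter> U) \<subseteq> sphere 0 1"
    "g ` sphere 0 1 \<subseteq> sphere 0 1 \<inter> U" "\<And>x. x \<in> U \<Longrightarrow> g (f x) = x" "\<And>y. f (g y) = y" "f w = b"
proof -
  have "dim U = dim (UNIV :: (real^'n) set)" using dims(1) by simp
  then obtain f1 g1 where 1: "linear f1" "linear g1" "f1 ` U = (UNIV :: (real^'n) set)" "g1 ` (UNIV :: (real^'n) set) = U"
    "\<And>x. x \<in> U \<Longrightarrow> norm (f1 x) = norm x" "\<And>x. x \<in> (UNIV :: (real^'n) set) \<Longrightarrow> norm (g1 x) = norm x"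
    "\<And>x. x \<in> U \<Longrightarrow> g1 (f1 x) = x" "\<And>x. x \<in> (UNIV :: (real^'n) set) \<Longrightarrow> f1 (g1 x) = x"
    by (rule isometries_subspaces[OF U(1) subspace_UNIV]) (rule that; assumption)
  have "dim (UNIV :: (real^'n) set) = dim (UNIV :: 'b set)" using dims(2) by simp
  then obtain f2 g2 where 2: "linear f2" "linear g2" "f2 ` (UNIV :: (real^'n) set) = (UNIV :: 'b set)"
    "g2 ` (UNIV :: 'b set) = (UNIV :: (real^'n) set)"
    "\<And>x. x \<in> (UNIV :: (real^'n) set) \<Longrightarrow> norm (f2 x) = norm x" "\<And>x. x \<in> (UNIV :: 'b set) \<Longrightarrow> norm (g2 x) = norm x"
    "\<And>x. x \<in> (UNIV :: (real^'n) set) \<Longrightarrow> g2 (f2 x) = x" "\<And>x. x \<in> (UNIV :: 'b set) \<Longrightarrow> f2 (g2 x) = x"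
    by (rule isometries_subspaces[OF subspace_UNIV subspace_UNIV]) (rule that; assumption)
  obtain R where R: "orthogonal_transformation R" "R (f1 w) = g2 b"
    using orthogonal_transformation_exists[of "f1 w" "g2 b"] 1(5)[of w] 2(6)[of b] U b by auto
  obtain R' where R': "linear R'" "\<And>x. R' (R x) = x" "\<And>x. R (R' x) = x"
    using linear_injective_isomorphism[of R] orthogonal_transformation_linear[OF R(1)]
      orthogonal_transformation_inj[OF R(1)] by blast
  have nR: "norm (R x) = norm x" for x using R(1) by (simp add: orthogonal_transformation_norm)
  have nR': "norm (R' x) = norm x" for x using nR[of "R' x"] R'(3) by simp
  have lin: "linear (\<lambda>x. f2 (R (f1 x)))" "linear (\<lambda>y. g1 (R' (g2 y)))"
    using linear_compose[OF linear_compose[OF 1(1) orthogonal_transformation_linear[OF R(1)]] 2(1)]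
      linear_compose[OF linear_compose[OF 2(2) R'(1)] 1(2)] by (simp_all add: o_def)
  show thesis
  proof (rule that[of "\<lambda>x. f2 (R (f1 x))" "\<lambda>y. g1 (R' (g2 y))"])
    show "continuous_on UNIV (\<lambda>x. f2 (R (f1 x)))" "continuous_on UNIV (\<lambda>y. g1 (R' (g2 y)))"
      using lin by (simp_all add: linear_continuous_on linear_conv_bounded_linear)
    show "(\<lambda>y. g1 (R' (g2 y))) ` sphere 0 1 \<subseteq> sphere 0 1 \<inter> U"
      using 1(4,6) 2(6) nR' by auto
  qed (use 1 2 R R' nR nR' in auto)
qed

lemma starlike_fibred_second_homotopy_group:
  fixes X :: "'a::euclidean_space set" and U :: "'b::euclidean_space set"
  assumes X: "starlike_fibred X (sphere 0 1 \<inter> U)" and U: "subspace U" "dim U = 3" and a: "a \<in> X"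
  shows "second_homotopy_group X a \<cong> integer_group"
proof -
  obtain \<phi> \<sigma> where "starlike_fibration X (sphere 0 1 \<inter> U) a \<phi> \<sigma>"
    using X a unfolding starlike_fibred_def by blast
  note * = starlike_fibrationD[OF this]
  have pa: "\<phi> a \<in> U" "norm (\<phi> a) = 1" using *(2) a by auto
  obtain f :: "'b \<Rightarrow> real \<times> complex" and g where f: "continuous_on UNIV f" "continuous_on UNIV g"
    "f ` (sphere 0 1 \<inter> U) \<subseteq> sphere 0 1" "g ` sphere 0 1 \<subseteq> sphere 0 1 \<inter> U" "\<And>x. x \<in> U \<Longrightarrow> g (f x) = x"
    "\<And>y. f (g y) = y" "f (\<phi> a) = (1, 0)"
    by (rule unit_sphere_subspace_homeomorphism[where ?'n = 3, OF U(1) pa, of "(1, 0)"]) (auto simp: U(2))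
  show ?thesis
  proof (rule second_homotopy_group_iso_integer_group[of X "f \<circ> \<phi>" a "\<sigma> \<circ> g"])
    show "continuous_on X (f \<circ> \<phi>)" by (rule continuous_on_compose[OF *(1) continuous_on_subset[OF f(1)]]) simp
    show "(f \<circ> \<phi>) ` X \<subseteq> sphere 0 1" using *(2) f(3) by (metis image_comp image_mono subset_trans)
    show "continuous_on (sphere 0 1) (\<sigma> \<circ> g)"
      by (rule continuous_on_compose[OF continuous_on_subset[OF f(2)] continuous_on_subset[OF *(3) f(4)]]) simp
    show "(\<sigma> \<circ> g) ` sphere 0 1 \<subseteq> X" using *(4) f(4) by (metis image_comp image_mono subset_trans)
    show "(\<sigma> \<circ> g) (1, 0) = a" using f(5)[OF pa(1)] f(7) *(6) by simp
    show "(f \<circ> \<phi>) ((\<sigma> \<circ> g) y) = y" if "y \<in> sphere 0 1" for y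
    proof -
      have "g y \<in> sphere 0 1 \<inter> U" using f(4) that by blast
      then show ?thesis using *(5) f(6) by simp
    qed
    show "closed_segment x ((\<sigma> \<circ> g) ((f \<circ> \<phi>) x)) \<subseteq> X" if "x \<in> X" for x
    proof -
      have "\<phi> x \<in> U" using *(2) that by blast
      then show ?thesis using *(7)[OF that] f(5) by simp
    qed
  qed (use f in auto)
qed

lemma starlike_fibred_fundamental_group:
  fixes X :: "'a::euclidean_space set" and U :: "'b::euclidean_space set"
  assumes X: "starlike_fibred X (sphere 0 1 \<inter> U)" and U: "subspace U" "dim U = 2" and a: "a \<in> X"
  shows "fundamental_group X a \<cong> integer_group"
proof -
  obtain \<phi> \<sigma> where "starlike_fibration X (sphere 0 1 \<inter> U) a \<phi> \<sigma>"
    using X a unfolding starlike_fibred_def by blast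
  note * = starlike_fibrationD[OF this]
  have pa: "\<phi> a \<in> U" "norm (\<phi> a) = 1" using *(2) a by auto
  obtain f :: "'b \<Rightarrow> complex" and g where f: "continuous_on UNIV f" "continuous_on UNIV g"
    "f ` (sphere 0 1 \<inter> U) \<subseteq> sphere 0 1" "g ` sphere 0 1 \<subseteq> sphere 0 1 \<inter> U" "\<And>x. x \<in> U \<Longrightarrow> g (f x) = x"
    "\<And>y. f (g y) = y" "f (\<phi> a) = 1"
    by (rule unit_sphere_subspace_homeomorphism[where ?'n = 2, OF U(1) pa, of "1"]) (auto simp: U(2))
  show ?thesis
  proof (rule fundamental_group_iso_integer_group[of X "f \<circ> \<phi>" a "\<sigma> \<circ> g"])
    show "continuous_on X (f \<circ> \<phi>)" by (rule continuous_on_compose[OF *(1) continuous_on_subset[OF f(1)]]) simp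
    show "(f \<circ> \<phi>) ` X \<subseteq> sphere 0 1" using *(2) f(3) by (metis image_comp image_mono subset_trans)
    show "continuous_on (sphere 0 1) (\<sigma> \<circ> g)"
      by (rule continuous_on_compose[OF continuous_on_subset[OF f(2)] continuous_on_subset[OF *(3) f(4)]]) simp
    show "(\<sigma> \<circ> g) ` sphere 0 1 \<subseteq> X" using *(4) f(4) by (metis image_comp image_mono subset_trans)
    show "(\<sigma> \<circ> g) 1 = a" using f(5)[OF pa(1)] f(7) *(6) by simp
    show "(f \<circ> \<phi>) ((\<sigma> \<circ> g) y) = y" if "y \<in> sphere 0 1" for y
    proof -
      have "g y \<in> sphere 0 1 \<inter> U" using f(4) that by blast
      then show ?thesis using *(5) f(6) by simp
    qed
    show "closed_segment x ((\<sigma> \<circ> g) ((f \<circ> \<phi>) x)) \<subseteq> X" if "x \<in> X" for x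
    proof -
      have "\<phi> x \<in> U" using *(2) that by blast
      then show ?thesis using *(7)[OF that] f(5) by simp
    qed
  qed (use f in auto)
qed

lemma sphere_subspaces_homeomorphic:
  fixes U :: "'a::euclidean_space set" and U' :: "'b::euclidean_space set"
  assumes "subspace U" "subspace U'" "dim U = dim U'"
  shows "(sphere 0 1 \<inter> U) homeomorphic (sphere 0 1 \<inter> U')"
proof -
  obtain f g where 1: "linear f" "linear g" "f ` U = U'" "g ` U' = U"
    "\<And>x. x \<in> U \<Longrightarrow> norm (f x) = norm x" "\<And>x. x \<in> U' \<Longrightarrow> norm (g x) = norm x"
    "\<And>x. x \<in> U \<Longrightarrow> g (f x) = x" "\<And>x. x \<in> U' \<Longrightarrow> f (g x) = x"
    by (rule isometries_subspaces[OF assms]) (rule that; assumption)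
  have "homeomorphism (sphere 0 1 \<inter> U) (sphere 0 1 \<inter> U') f g"
  proof (rule homeomorphismI)
    show "continuous_on (sphere 0 1 \<inter> U) f" "continuous_on (sphere 0 1 \<inter> U') g"
      using 1(1,2) by (simp_all add: linear_continuous_on linear_conv_bounded_linear)
  qed (use 1 in auto)
  then show ?thesis unfolding homeomorphic_def by blast
qed

section \<open>Minkowski geometry and Lorentz frames\<close>

lemma UNIV_4_eq: "(UNIV :: 4 set) = {0, 1, 2, 3}"
proof -
  have "i \<in> {0, 1, 2, 3}" for i :: 4 using exhaust_4[of i] by auto
  then show ?thesis by blast
qed

lemma sum_UNIV_4: "sum f (UNIV :: 4 set) = f 0 + f 1 + f 2 + f 3"
  unfolding UNIV_4_eq by (simp add: add.assoc)

lemma forall_UNIV_4: "(\<forall>i::4. P i) \<longleftrightarrow> P 0 \<and> P 1 \<and> P 2 \<and> P 3"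
proof -
  have "(\<forall>i::4. P i) \<longleftrightarrow> (\<forall>i\<in>{0, 1, 2, 3}. P i)" unfolding UNIV_4_eq[symmetric] by simp
  then show ?thesis by simp
qed

definition bform :: "real^'n^'n \<Rightarrow> real^'n \<Rightarrow> real^'n \<Rightarrow> real" where
  "bform A x y = x \<bullet> (A *v y)"

lemma qform_bform: "qform \<Lambda> p = bform \<Lambda> p p"
  by (simp add: qform_inner bform_def)

lemma bform_simps:
  "bform A (x + y) z = bform A x z + bform A y z" "bform A z (x + y) = bform A z x + bform A z y"
  "bform A (c *\<^sub>R x) z = c * bform A x z" "bform A z (c *\<^sub>R x) = c * bform A z x"
  "bform A 0 z = 0" "bform A z 0 = 0" "bform A (- x) z = - bform A x z" "bform A z (- x) = - bform A z x"
  "bform A (x - y) z = bform A x z - bform A y z" "bform A z (x - y) = bform A z x - bform A z y"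
  using matrix_vector_mult_diff_distrib[of A 0 x]
  by (simp_all add: bform_def inner_add_left inner_add_right matrix_vector_right_distrib
      matrix_vector_mult_scaleR matrix_vector_mult_diff_distrib inner_diff_left inner_diff_right)

lemma bform_sym: "transpose A = A \<Longrightarrow> bform A x y = bform A y x"
  by (metis bform_def dot_lmul_matrix inner_commute transpose_matrix_vector)

lemma bform_expand:
  assumes "transpose A = A"
  shows "bform A (x + t *\<^sub>R y) (x + t *\<^sub>R y) = bform A x x + 2 * t * bform A x y + t\<^sup>2 * bform A y y"
  by (simp add: bform_simps bform_sym[OF assms, of y x] power2_eq_square algebra_simps)

lemma continuous_on_bform [continuous_intros]:
  assumes "continuous_on S f" "continuous_on S g"
  shows "continuous_on S (\<lambda>x. bform A (f x) (g x))"
  unfolding bform_def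
  by (intro continuous_on_inner assms bounded_linear.continuous_on[OF matrix_vector_mul_bounded_linear])

lemma transpose_minkowski_metric: "transpose minkowski_metric = minkowski_metric"
  by (simp add: minkowski_metric_def transpose_def vec_eq_iff)

lemma bform_minkowski:
  "bform minkowski_metric x y = x$0 * y$0 - x$1 * y$1 - x$2 * y$2 - x$3 * y$3"
  by (simp add: bform_def inner_vec_def matrix_vector_mult_def minkowski_metric_def sum_UNIV_4)

lemma minkowski_sq_bform: "minkowski_sq x = bform minkowski_metric x x"
  by (simp add: minkowski_sq_def bform_minkowski power2_eq_square)

definition space_part :: "real^4 \<Rightarrow> real^4" where
  "space_part r = (\<chi> i. if i = 0 then 0 else r $ i)"

lemma linear_space_part: "linear space_part"
  by (rule linearI) (simp_all add: space_part_def vec_eq_iff)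

lemma space_part_inner: "space_part x \<bullet> space_part y = x$1 * y$1 + x$2 * y$2 + x$3 * y$3"
  by (simp add: inner_vec_def sum_UNIV_4 space_part_def)

lemma norm_space_part_sq: "(norm (space_part r))\<^sup>2 = (r$1)\<^sup>2 + (r$2)\<^sup>2 + (r$3)\<^sup>2"
  unfolding power2_norm_eq_inner space_part_inner by (simp add: power2_eq_square)

lemma minkowski_sq_space_part: "minkowski_sq r = (r$0)\<^sup>2 - (norm (space_part r))\<^sup>2"
  by (simp add: minkowski_sq_def norm_space_part_sq)

text \<open>\<open>minkowski_sq\<close> is not concave and does not separate the forward from the
  backward cone. This function is concave, and its sign alone decides membership in
  \<open>LC_plus\<close> and \<open>LC_inside\<close>.\<close>

definition lightcone_gap :: "real^4 \<Rightarrow> real" where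
  "lightcone_gap r = r $ 0 - norm (space_part r)"

lemma LC_plus_iff_gap: "r \<in> LC_plus \<longleftrightarrow> 0 \<le> lightcone_gap r"
proof -
  have "norm (space_part r) \<le> r$0 \<longleftrightarrow> 0 \<le> r$0 \<and> (norm (space_part r))\<^sup>2 \<le> (r$0)\<^sup>2"
    using power_mono[of "norm (space_part r)" "r$0" 2] power2_le_imp_le[of "norm (space_part r)" "r$0"]
      norm_ge_zero[of "space_part r"] by linarith
  then show ?thesis by (simp add: LC_plus_def minkowski_sq_space_part lightcone_gap_def)
qed

lemma LC_inside_iff_gap: "r \<in> LC_inside \<longleftrightarrow> 0 < lightcone_gap r"
proof -
  have "norm (space_part r) < r$0 \<longleftrightarrow> 0 < r$0 \<and> (norm (space_part r))\<^sup>2 < (r$0)\<^sup>2"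
    using power_strict_mono[of "norm (space_part r)" "r$0" 2] power2_less_imp_less[of "norm (space_part r)" "r$0"]
      norm_ge_zero[of "space_part r"] by linarith
  then show ?thesis by (simp add: LC_inside_def minkowski_sq_space_part lightcone_gap_def)
qed

lemma continuous_on_lightcone_gap: "continuous_on S lightcone_gap"
  unfolding lightcone_gap_def
  using linear_continuous_on_compose[OF continuous_on_id linear_space_part, of S]
  by (intro continuous_intros)

lemma lightcone_gap_concave:
  assumes "0 \<le> t" "t \<le> 1"
  shows "(1 - t) * lightcone_gap x + t * lightcone_gap y \<le> lightcone_gap ((1 - t) *\<^sub>R x + t *\<^sub>R y)"
proof -
  have "space_part ((1 - t) *\<^sub>R x + t *\<^sub>R y) = (1 - t) *\<^sub>R space_part x + t *\<^sub>R space_part y"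
    by (simp add: linear_add[OF linear_space_part] linear_scale[OF linear_space_part])
  then have "norm (space_part ((1 - t) *\<^sub>R x + t *\<^sub>R y)) \<le> (1 - t) * norm (space_part x) + t * norm (space_part y)"
    using norm_triangle_ineq[of "(1 - t) *\<^sub>R space_part x" "t *\<^sub>R space_part y"] assms by simp
  then show ?thesis by (simp add: lightcone_gap_def right_diff_distrib)
qed

lemma LC_plus_scale: "r \<in> LC_plus \<Longrightarrow> 0 \<le> c \<Longrightarrow> c *\<^sub>R r \<in> LC_plus"
proof -
  have "minkowski_sq (c *\<^sub>R r) = c\<^sup>2 * minkowski_sq r"
    by (simp add: minkowski_sq_bform bform_simps power2_eq_square)
  then show "r \<in> LC_plus \<Longrightarrow> 0 \<le> c \<Longrightarrow> c *\<^sub>R r \<in> LC_plus" by (simp add: LC_plus_def)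
qed

section \<open>Diagonalisation by extremal problems\<close>

text \<open>The first-order condition at a maximum, for quadratic functions. If
  \<open>d \<noteq> 0\<close>, take t of the sign of d and of size s with
  \<open>s * \<bar>c\<bar> < \<bar>d\<bar>\<close>; then the linear term outweighs the quadratic
  one.\<close>

lemma linear_coeff_zero:
  fixes d c \<epsilon> :: real
  assumes "0 < \<epsilon>" "\<And>t. \<bar>t\<bar> \<le> \<epsilon> \<Longrightarrow> 2 * t * d + t\<^sup>2 * c \<le> 0"
  shows "d = 0"
proof (rule ccontr)
  assume d: "d \<noteq> 0"
  define s where "s = min \<epsilon> (\<bar>d\<bar> / (\<bar>c\<bar> + 1))"
  have s: "0 < s" "s \<le> \<epsilon>" using assms(1) d by (auto simp: s_def)
  have "s \<le> \<bar>d\<bar> / (\<bar>c\<bar> + 1)" by (simp add: s_def)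
  moreover have "0 < \<bar>c\<bar> + 1" by simp
  ultimately have "s * (\<bar>c\<bar> + 1) \<le> \<bar>d\<bar>" by (simp only: pos_le_divide_eq)
  then have sc: "s * \<bar>c\<bar> < \<bar>d\<bar>" using s by (simp add: algebra_simps)
  have "2 * (sgn d * s) * d + (sgn d * s)\<^sup>2 * c \<le> 0"
    using d s by (intro assms(2)) (simp add: abs_mult)
  moreover have "2 * (sgn d * s) * d = 2 * s * \<bar>d\<bar>" using d by (simp add: sgn_if)
  moreover have "(sgn d * s)\<^sup>2 * c = s * (s * c)" using d by (simp add: sgn_if power2_eq_square)
  moreover have "- (s * \<bar>c\<bar>) \<le> s * c" using mult_left_mono[of "- \<bar>c\<bar>" c s] s by simp
  ultimately have "2 * s * \<bar>d\<bar> - s * (s * \<bar>c\<bar>) \<le> 0"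
    using s mult_left_mono[of "- (s * \<bar>c\<bar>)" "s * c" s] by linarith
  then have "s * (2 * \<bar>d\<bar> - s * \<bar>c\<bar>) \<le> 0" by (simp add: algebra_simps)
  then have "2 * \<bar>d\<bar> - s * \<bar>c\<bar> \<le> 0" using s by (simp add: mult_le_0_iff)
  then show False using sc d by linarith
qed

text \<open>Where the quotient of A by N attains its maximum \<mu> on the unit sphere of T, the form
  \<open>A - \<mu> * N\<close> is nonpositive on T and zero at e, so its linear term at e
  vanishes.\<close>

lemma subspace_relative_eigenvector:
  fixes N A :: "real^'n^'n"
  assumes sym: "transpose N = N" "transpose A = A" and T: "subspace T" "x0 \<in> T" "x0 \<noteq> 0"
    and pos: "\<And>x. x \<in> T \<Longrightarrow> x \<noteq> 0 \<Longrightarrow> 0 < bform N x x"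
  obtains e \<mu> where "e \<in> T" "bform N e e = 1" "\<And>x. x \<in> T \<Longrightarrow> bform A e x = \<mu> * bform N e x"
proof -
  define K where "K = sphere 0 1 \<inter> T"
  have nz: "x \<noteq> 0" "x \<in> T" if "x \<in> K" for x using that by (auto simp: K_def)
  have "compact K" unfolding K_def by (intro compact_Int_closed compact_sphere closed_subspace T)
  moreover have unit: "x /\<^sub>R norm x \<in> K" if "x \<in> T" "x \<noteq> 0" for x
    using that by (simp add: K_def subspace_scale[OF T(1)])
  then have "K \<noteq> {}" using T by blast
  moreover have "continuous_on K (\<lambda>x. bform A x x / bform N x x)"
  proof (intro continuous_intros ballI)
    show "bform N x x \<noteq> 0" if "x \<in> K" for x using pos nz[OF that] by fastforce
  qed
  ultimately obtain e where e: "e \<in> K" and max: "\<And>y. y \<in> K \<Longrightarrow> bform A y y / bform N y y \<le> bform A e e / bform N e e"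
    using continuous_attains_sup[of K "\<lambda>x. bform A x x / bform N x x"] by blast
  define \<mu> where "\<mu> = bform A e e / bform N e e"
  have Ne: "0 < bform N e e" using pos nz[OF e] by blast
  have le: "bform A x x \<le> \<mu> * bform N x x" if x: "x \<in> T" for x
  proof (cases "x = 0")
    case False
    have "bform A (x /\<^sub>R norm x) (x /\<^sub>R norm x) / bform N (x /\<^sub>R norm x) (x /\<^sub>R norm x) = bform A x x / bform N x x"
      using False by (simp add: bform_simps)
    then have "bform A x x / bform N x x \<le> \<mu>" using max[OF unit[OF x False]] by (simp add: \<mu>_def)
    then show ?thesis using pos[OF x False] by (simp add: field_simps)
  qed (simp add: bform_simps)
  have crit: "bform A e x = \<mu> * bform N e x" if x: "x \<in> T" for x
  proof -
    have "bform A e x - \<mu> * bform N e x = 0"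
    proof (rule linear_coeff_zero[of 1])
      fix t :: real
      have "bform A (e + t *\<^sub>R x) (e + t *\<^sub>R x) \<le> \<mu> * bform N (e + t *\<^sub>R x) (e + t *\<^sub>R x)"
        using nz[OF e] x by (intro le subspace_add[OF T(1)] subspace_scale[OF T(1)]) auto
      moreover have "bform A e e = \<mu> * bform N e e" using Ne by (simp add: \<mu>_def)
      ultimately show "2 * t * (bform A e x - \<mu> * bform N e x) + t\<^sup>2 * (bform A x x - \<mu> * bform N x x) \<le> 0"
        by (simp add: bform_expand sym algebra_simps)
    qed simp
    then show ?thesis by simp
  qed
  show thesis
  proof (rule that[of "(1 / sqrt (bform N e e)) *\<^sub>R e" \<mu>])
    show "(1 / sqrt (bform N e e)) *\<^sub>R e \<in> T" using nz[OF e] subspace_scale[OF T(1)] by blast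
    show "bform N ((1 / sqrt (bform N e e)) *\<^sub>R e) ((1 / sqrt (bform N e e)) *\<^sub>R e) = 1"
      using Ne by (simp add: bform_simps flip: power2_eq_square)
    show "bform A ((1 / sqrt (bform N e e)) *\<^sub>R e) x = \<mu> * bform N ((1 / sqrt (bform N e e)) *\<^sub>R e) x" if "x \<in> T" for x
      using crit[OF that] by (simp add: bform_simps)
  qed
qed

text \<open>Orthogonality equates \<open>e$0 * x$0\<close> with the product of the space parts; as
  \<open>norm (space_part e) < e$0\<close>, the Cauchy-Schwarz inequality bounds
  \<open>\<bar>x$0\<bar>\<close> by \<open>norm (space_part x)\<close>.\<close>

lemma minkowski_neg_on_orthogonal:
  assumes e: "e \<in> LC_inside" and x: "bform minkowski_metric e x = 0" "x \<noteq> 0"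
  shows "bform minkowski_metric x x < 0"
proof -
  have e0: "norm (space_part e) < e$0" "0 < e$0"
    using e unfolding LC_inside_iff_gap by (auto simp: lightcone_gap_def intro: le_less_trans[OF norm_ge_zero])
  have "e$0 * x$0 = space_part e \<bullet> space_part x"
    using x(1) by (simp add: bform_minkowski space_part_inner)
  then have "\<bar>e$0 * x$0\<bar> \<le> norm (space_part e) * norm (space_part x)"
    by (simp add: Cauchy_Schwarz_ineq2)
  then have *: "e$0 * \<bar>x$0\<bar> \<le> norm (space_part e) * norm (space_part x)" using e0 by (simp add: abs_mult)
  have "space_part x \<noteq> 0"
  proof
    assume 0: "space_part x = 0"
    then have "x$0 = 0" using * e0 by (simp add: mult_le_0_iff)
    then have "x = 0" using 0 by (auto simp: vec_eq_iff space_part_def forall_UNIV_4)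
    then show False using x(2) by simp
  qed
  then have "norm (space_part e) * norm (space_part x) < e$0 * norm (space_part x)" using e0 by simp
  then have "e$0 * \<bar>x$0\<bar> < e$0 * norm (space_part x)" using * by linarith
  then have "\<bar>x$0\<bar> < norm (space_part x)" using e0 by simp
  then have "(x$0)\<^sup>2 < (norm (space_part x))\<^sup>2"
    using power_strict_mono[of "\<bar>x$0\<bar>" "norm (space_part x)" 2] by simp
  then show ?thesis unfolding minkowski_sq_bform[symmetric] minkowski_sq_space_part by simp
qed

text \<open>The form \<Lambda> is in the denominator because it is positive on the closed cone
  without 0, whereas the Minkowski form vanishes on the surface. For that reason the maximum, being
  positive, is attained inside, where all directions are admissible and the first-order condition is
  unconstrained.\<close>

lemma minkowski_timelike_eigenvector:
  assumes sym: "transpose \<Lambda> = \<Lambda>" and pos: "\<forall>r\<in>LC_plus - {0}. 0 < qform \<Lambda> r"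
  obtains e \<mu> where "e \<in> LC_inside" "bform minkowski_metric e e = 1"
    "\<And>x. bform \<Lambda> e x = \<mu> * bform minkowski_metric e x"
proof -
  let ?G = minkowski_metric
  define K where "K = sphere 0 1 \<inter> LC_plus"
  have nz: "x \<noteq> 0" "x \<in> LC_plus" if "x \<in> K" for x using that by (auto simp: K_def)
  have Qpos: "0 < bform \<Lambda> x x" if "x \<in> LC_plus" "x \<noteq> 0" for x
    using pos that by (simp add: qform_bform)
  have "closed LC_plus"
  proof -
    have "LC_plus = {r. 0 \<le> lightcone_gap r}" using LC_plus_iff_gap by blast
    moreover have "closed {r. 0 \<le> lightcone_gap r}"
      by (intro closed_Collect_le continuous_on_const continuous_on_lightcone_gap)
    ultimately show ?thesis by simp
  qed
  then have "compact K" unfolding K_def by (intro compact_Int_closed compact_sphere)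
  moreover have a0: "axis 0 1 \<in> K" by (simp add: K_def LC_plus_def minkowski_sq_def axis_def norm_eq_sqrt_inner inner_vec_def sum_UNIV_4)
  moreover have "continuous_on K (\<lambda>x. bform ?G x x / bform \<Lambda> x x)"
  proof (intro continuous_intros ballI)
    show "bform \<Lambda> x x \<noteq> 0" if "x \<in> K" for x using Qpos nz[OF that] by fastforce
  qed
  ultimately obtain e where e: "e \<in> K" and max: "\<And>y. y \<in> K \<Longrightarrow> bform ?G y y / bform \<Lambda> y y \<le> bform ?G e e / bform \<Lambda> e e"
    using continuous_attains_sup[of K "\<lambda>x. bform ?G x x / bform \<Lambda> x x"] by blast
  define \<kappa> where "\<kappa> = bform ?G e e / bform \<Lambda> e e"
  have Qe: "0 < bform \<Lambda> e e" using Qpos nz[OF e] by blast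
  have "0 < bform ?G (axis 0 1) (axis 0 1) / bform \<Lambda> (axis 0 1) (axis 0 1)"
    using Qpos nz[OF a0] by (simp add: bform_minkowski axis_def)
  then have \<kappa>: "0 < \<kappa>" using max[OF a0] unfolding \<kappa>_def by linarith
  then have Ge: "0 < bform ?G e e" using Qe by (simp add: \<kappa>_def zero_less_divide_iff)
  have e_in: "e \<in> LC_inside"
  proof -
    have "0 \<le> e$0" using nz(2)[OF e] by (simp add: LC_plus_def)
    moreover have "0 < minkowski_sq e" using Ge by (simp add: minkowski_sq_bform)
    moreover have "e$0 \<noteq> 0"
    proof
      assume "e$0 = 0"
      then have "minkowski_sq e \<le> 0" by (simp add: minkowski_sq_space_part)
      then show False using \<open>0 < minkowski_sq e\<close> by simp
    qed
    ultimately show ?thesis by (simp add: LC_inside_def)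
  qed
  have le: "bform ?G x x \<le> \<kappa> * bform \<Lambda> x x" if x: "x \<in> LC_plus" for x
  proof (cases "x = 0")
    case False
    have "x /\<^sub>R norm x \<in> K" using LC_plus_scale[OF x] False by (simp add: K_def)
    moreover have "bform ?G (x /\<^sub>R norm x) (x /\<^sub>R norm x) / bform \<Lambda> (x /\<^sub>R norm x) (x /\<^sub>R norm x) = bform ?G x x / bform \<Lambda> x x"
      using False by (simp add: bform_simps)
    ultimately have "bform ?G x x / bform \<Lambda> x x \<le> \<kappa>" using max[of "x /\<^sub>R norm x"] by (simp add: \<kappa>_def)
    then show ?thesis using Qpos[OF x False] by (simp add: field_simps)
  qed (simp add: bform_simps)
  have "open LC_inside"
  proof -
    have "LC_inside = {r. 0 < lightcone_gap r}" using LC_inside_iff_gap by blast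
    moreover have "open {r. 0 < lightcone_gap r}"
      by (intro open_Collect_less continuous_on_const continuous_on_lightcone_gap)
    ultimately show ?thesis by simp
  qed
  then obtain r where r: "0 < r" "ball e r \<subseteq> LC_inside" using e_in open_contains_ball by blast
  have crit: "bform \<Lambda> e x = (1 / \<kappa>) * bform ?G e x" for x
  proof -
    have "bform ?G e x - \<kappa> * bform \<Lambda> e x = 0"
    \<comment> \<open>With this bound on t the point \<open>e + t *\<^sub>R x\<close> stays in the
      ball around e inside the cone; adding 1 covers \<open>x = 0\<close>.\<close>
    proof (rule linear_coeff_zero[of "r / (2 * (norm x + 1))"])
      show "0 < r / (2 * (norm x + 1))" using r(1) by (simp add: add_nonneg_pos)
      fix t assume t: "\<bar>t\<bar> \<le> r / (2 * (norm x + 1))"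
      have n: "0 < norm x + 1" by (simp add: add_nonneg_pos)
      have "\<bar>t\<bar> * norm x \<le> \<bar>t\<bar> * (norm x + 1)" by (simp add: mult_left_mono)
      also have "\<dots> \<le> r / (2 * (norm x + 1)) * (norm x + 1)" using t n by (intro mult_right_mono) auto
      also have "\<dots> < r"
      proof -
        have "r / (2 * N) * N < r" if "0 < N" for N :: real using that r(1) by simp
        then show ?thesis using n .
      qed
      finally have "e + t *\<^sub>R x \<in> ball e r" by (simp add: dist_norm)
      then have "e + t *\<^sub>R x \<in> LC_plus"
        using r(2) by (force simp: LC_inside_iff_gap LC_plus_iff_gap)
      then have "bform ?G (e + t *\<^sub>R x) (e + t *\<^sub>R x) \<le> \<kappa> * bform \<Lambda> (e + t *\<^sub>R x) (e + t *\<^sub>R x)" by (rule le)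
      moreover have "bform ?G e e = \<kappa> * bform \<Lambda> e e" using Qe by (simp add: \<kappa>_def)
      ultimately show "2 * t * (bform ?G e x - \<kappa> * bform \<Lambda> e x) + t\<^sup>2 * (bform ?G x x - \<kappa> * bform \<Lambda> x x) \<le> 0"
        by (simp add: bform_expand sym transpose_minkowski_metric algebra_simps)
    qed
    then show ?thesis using \<kappa> by simp
  qed
  define c where "c = 1 / sqrt (bform ?G e e)"
  have c: "0 < c" "c * c * bform ?G e e = 1" using Ge by (simp_all add: c_def)
  show thesis
  proof (rule that[of "c *\<^sub>R e" "1 / \<kappa>"])
    show "c *\<^sub>R e \<in> LC_inside"
      using e_in c(1) by (simp add: LC_inside_def minkowski_sq_bform bform_simps)
    show "bform ?G (c *\<^sub>R e) (c *\<^sub>R e) = 1" using c(2) by (simp add: bform_simps mult.assoc)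
    show "bform \<Lambda> (c *\<^sub>R e) x = 1 / \<kappa> * bform ?G (c *\<^sub>R e) x" for x
      using crit[of x] by (simp add: bform_simps)
  qed
qed

lemma transpose_mult_bform:
  "(transpose S ** A ** S) $ i $ j = bform A (column i S) (column j S)"
proof -
  have "(transpose S ** A ** S) $ i $ j = axis i 1 \<bullet> ((transpose S ** A ** S) *v axis j 1)"
    by (simp add: inner_axis' matrix_vector_mult_basis column_def)
  also have "\<dots> = axis i 1 \<bullet> (transpose S *v (A *v (S *v axis j 1)))"
    by (simp add: matrix_vector_mul_assoc matrix_mul_assoc)
  also have "\<dots> = (S *v axis i 1) \<bullet> (A *v (S *v axis j 1))"
    by (metis dot_lmul_matrix inner_commute transpose_matrix_vector transpose_transpose)
  finally show ?thesis by (simp add: bform_def matrix_vector_mult_basis)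
qed

lemma lorentz_eigenvalues_exist:
  assumes sym: "transpose \<Lambda> = \<Lambda>" and pos: "\<forall>r\<in>LC_plus - {0}. 0 < qform \<Lambda> r"
  shows "\<exists>L. lorentz_eigenvalues \<Lambda> L"
proof -
  let ?G = minkowski_metric
  note symG = transpose_minkowski_metric
  obtain e0 \<mu>0 where e0: "e0 \<in> LC_inside" "bform ?G e0 e0 = 1"
    and E0: "\<And>x. bform \<Lambda> e0 x = \<mu>0 * bform ?G e0 x"
    using minkowski_timelike_eigenvector[OF sym pos] by blast
  define T where "T B = {x. \<forall>b\<in>B. bform ?G b x = 0}" for B
  have subT: "subspace (T B)" for B
    by (rule subspaceI) (auto simp: T_def bform_simps)
  have symN: "transpose (- ?G) = - ?G" using symG by (simp add: transpose_def vec_eq_iff)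
  have N: "bform (- ?G) x y = - bform ?G x y" for x y
    by (simp add: bform_def inner_vec_def matrix_vector_mult_def sum_negf)
  \<comment> \<open>At most three linear conditions in four dimensions leave a nonzero solution, and
    as \<open>e0\<close> is in B, the form \<open>- ?G\<close> is positive definite on the
    solutions.\<close>
  have step: "\<exists>e \<mu>. (\<forall>b\<in>B. bform ?G b e = 0) \<and> bform ?G e e = - 1 \<and>
      (\<forall>x. (\<forall>b\<in>B. bform ?G b x = 0) \<longrightarrow> bform \<Lambda> e x = \<mu> * bform ?G e x)"
    if B: "e0 \<in> B" "finite B" "card B \<le> 3" for B
  proof -
    have "dim ((\<lambda>b. ?G *v b) ` B) < DIM(real^4)"
    proof -
      have "dim ((\<lambda>b. ?G *v b) ` B) \<le> card ((\<lambda>b. ?G *v b) ` B)" by (rule dim_le_card') (simp add: B(2))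
      also have "\<dots> \<le> card B" by (rule card_image_le[OF B(2)])
      finally show ?thesis using B(3) by simp
    qed
    then obtain x0 where x0: "x0 \<noteq> 0" "\<And>y. y \<in> span ((\<lambda>b. ?G *v b) ` B) \<Longrightarrow> orthogonal x0 y"
      by (rule orthogonal_to_subspace_exists) (rule that; assumption)
    have "x0 \<in> T B"
      unfolding T_def
    proof (clarify)
      fix b assume "b \<in> B"
      then have "x0 \<bullet> (?G *v b) = 0" using x0(2) by (auto simp: orthogonal_def span_base)
      then show "bform ?G b x0 = 0" using bform_sym[OF symG, of b x0] by (simp add: bform_def)
    qed
    moreover have "0 < bform (- ?G) x x" if "x \<in> T B" "x \<noteq> 0" for x
      using minkowski_neg_on_orthogonal[OF e0(1) _ that(2)] that(1) B(1) by (simp add: N T_def)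
    ultimately obtain e \<mu> where "e \<in> T B" "bform (- ?G) e e = 1" "\<And>x. x \<in> T B \<Longrightarrow> bform \<Lambda> e x = \<mu> * bform (- ?G) e x"
      using subspace_relative_eigenvector[OF symN sym subT _ x0(1)] by blast
    then show ?thesis by (intro exI[of _ e] exI[of _ "- \<mu>"]) (simp add: N T_def)
  qed
  obtain e1 \<mu>1 where e1: "bform ?G e0 e1 = 0" "bform ?G e1 e1 = - 1"
    and E1: "\<And>x. bform ?G e0 x = 0 \<Longrightarrow> bform \<Lambda> e1 x = \<mu>1 * bform ?G e1 x"
    using step[of "{e0}"] by auto
  have "card {e0, e1} \<le> 3" using card_insert_le_m1[of 2 "{e1}" e0] by simp
  then obtain e2 \<mu>2 where e2: "bform ?G e0 e2 = 0" "bform ?G e1 e2 = 0" "bform ?G e2 e2 = - 1"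
    and E2: "\<And>x. bform ?G e0 x = 0 \<Longrightarrow> bform ?G e1 x = 0 \<Longrightarrow> bform \<Lambda> e2 x = \<mu>2 * bform ?G e2 x"
    using step[of "{e0, e1}"] by auto
  have "card {e0, e1, e2} \<le> 3" by (simp add: card_insert_if)
  then obtain e3' where e3': "bform ?G e0 e3' = 0" "bform ?G e1 e3' = 0" "bform ?G e2 e3' = 0" "bform ?G e3' e3' = - 1"
    using step[of "{e0, e1, e2}"] by auto
  define fr :: "real^4 \<Rightarrow> real^4^4" where
    "fr e3 = (\<chi> i j. (if j = 0 then e0 else if j = 1 then e1 else if j = 2 then e2 else e3) $ i)" for e3
  have col: "column j (fr e3) = (if j = 0 then e0 else if j = 1 then e1 else if j = 2 then e2 else e3)" for e3 j
    by (simp add: column_def fr_def vec_eq_iff)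
  have orth: "transpose (fr (c *\<^sub>R e3')) ** ?G ** fr (c *\<^sub>R e3') = ?G" if "c * c = 1" for c
    unfolding vec_eq_iff forall_UNIV_4 transpose_mult_bform col
    using e0 e1 e2 e3' that bform_sym[OF symG, of e1 e0] bform_sym[OF symG, of e2 e0] bform_sym[OF symG, of e2 e1]
      bform_sym[OF symG, of e3' e0] bform_sym[OF symG, of e3' e1] bform_sym[OF symG, of e3' e2]
    by (simp add: minkowski_metric_def bform_simps)
  have detG: "det ?G \<noteq> 0"
  proof -
    have "det ?G = (\<Prod>i\<in>UNIV. ?G $ i $ i)" by (rule det_diagonal) (simp add: minkowski_metric_def)
    then show ?thesis by (simp add: minkowski_metric_def)
  qed
  have "det (fr e3') = 1 \<or> det (fr e3') = - 1"
  proof -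
    have "det (transpose (fr e3') ** ?G ** fr e3') = det ?G" using orth[of 1] by simp
    then have "det (fr e3') * det (fr e3') * det ?G = det ?G" by (simp add: det_mul det_transpose)
    then have "(det (fr e3'))\<^sup>2 = 1" using detG by (simp add: power2_eq_square)
    then show ?thesis by (simp add: power2_eq_1_iff)
  qed
  \<comment> \<open>The frame has determinant 1 or -1, and the free sign of its last vector is used
    to make it 1. The transpose turns the change of a column into that of a row.\<close>
  moreover have "det (fr (- e3')) = - det (fr e3')"
  proof -
    have t: "transpose (fr (c *s e3')) = (\<chi> i. if i = 3 then c *s e3' else (\<chi> j. if j = 0 then e0 else if j = 1 then e1 else e2) $ i)" for c
      by (simp add: transpose_def fr_def vec_eq_iff forall_UNIV_4)
    have e: "(-1) *s e3' = - e3'" "1 *s e3' = e3'" by (simp_all add: vec_eq_iff)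
    have "det (transpose (fr ((-1) *s e3'))) = - 1 * det (transpose (fr (1 *s e3')))"
      unfolding t using det_row_mul[of 3 "-1" "\<lambda>i. e3'" "\<lambda>i. (\<chi> j. if j = 0 then e0 else if j = 1 then e1 else e2) $ i"]
      by (simp only: e)
    then show ?thesis unfolding e det_transpose by simp
  qed
  ultimately obtain c where c: "c * c = 1" "det (fr (c *\<^sub>R e3')) = 1"
  proof (elim disjE)
    assume "det (fr e3') = 1" then show thesis by (intro that[of 1]) simp_all
  next
    assume "det (fr e3') = - 1" "det (fr (- e3')) = - det (fr e3')"
    then show thesis by (intro that[of "-1"]) simp_all
  qed
  define e3 where "e3 = c *\<^sub>R e3'"
  define S where "S = fr e3"
  have e3: "bform ?G e0 e3 = 0" "bform ?G e1 e3 = 0" "bform ?G e2 e3 = 0" "bform ?G e3 e3 = - 1"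
    using e3' c(1) by (simp_all add: e3_def bform_simps)
  have "proper_lorentz S"
    unfolding proper_lorentz_def S_def e3_def
    using orth[OF c(1)] c(2) e0(1) by (simp add: LC_inside_def fr_def)
  moreover define L :: "real^4" where "L = (\<chi> i. if i = 0 then bform \<Lambda> e0 e0 else - bform \<Lambda> (column i S) (column i S))"
  \<comment> \<open>Each vector satisfies its eigenvector equation only against vectors orthogonal
    to its predecessors; symmetry of \<Lambda> supplies the other off-diagonal zeros.\<close>
  have "transpose S ** \<Lambda> ** S = (\<chi> i j. if i = j then (if i = 0 then L $ i else - L $ i) else 0)"
    unfolding vec_eq_iff forall_UNIV_4 transpose_mult_bform
    using e0 e1 e2 e3 E0[of e1] E0[of e2] E0[of e3] E1[of e2] E1[of e3] E2[of e3]
      bform_sym[OF sym, of e1 e0] bform_sym[OF sym, of e2 e0] bform_sym[OF sym, of e2 e1]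
      bform_sym[OF sym, of e3 e0] bform_sym[OF sym, of e3 e1] bform_sym[OF sym, of e3 e2]
    by (simp add: L_def S_def col)
  moreover have "0 < L $ 0"
    using pos e0(1) by (force simp: L_def qform_bform LC_inside_iff_gap LC_plus_iff_gap lightcone_gap_def space_part_def vec_eq_iff)
  moreover have "\<forall>i\<in>{1, 2, 3}. L $ i < L $ 0"
  proof
    fix i :: 4 assume i: "i \<in> {1, 2, 3}"
    define e where "e = column i S"
    have e: "bform ?G e0 e = 0" "bform ?G e e = - 1"
      using i e1 e2 e3 by (auto simp: e_def S_def col)
    \<comment> \<open>A unit timelike vector plus an orthogonal unit spacelike one is null, so it or
      its negative lies on the cone. There \<Lambda> is positive, and its value is
      \<open>L $ 0 - L $ i\<close>.\<close>
    define r where "r = e0 + e"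
    have "bform ?G r r = 0" using e e0(2) bform_sym[OF symG, of e e0] by (simp add: r_def bform_simps)
    then have null: "minkowski_sq r = 0" by (simp add: minkowski_sq_bform)
    have "bform ?G e0 r = 1" using e e0(2) by (simp add: r_def bform_simps)
    then have "r \<noteq> 0" by (auto simp: bform_simps)
    moreover have "r \<in> LC_plus \<or> - r \<in> LC_plus" using null by (auto simp: LC_plus_def minkowski_sq_def)
    ultimately have "0 < bform \<Lambda> r r \<or> 0 < bform \<Lambda> (- r) (- r)"
      using pos unfolding qform_bform by (metis DiffI neg_equal_0_iff_equal singletonD)
    then have "0 < bform \<Lambda> r r" by (simp add: bform_simps)
    also have "bform \<Lambda> r r = bform \<Lambda> e0 e0 + bform \<Lambda> e e"
      using E0[of e] e(1) bform_sym[OF sym, of e e0] by (simp add: r_def bform_simps)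
    finally show "L $ i < L $ 0" using i by (auto simp: L_def e_def)
  qed
  ultimately show ?thesis unfolding lorentz_eigenvalues_def by blast
qed

section \<open>The topology of the valley\<close>

definition pos_indices :: "real^4 \<Rightarrow> 4 set" where
  "pos_indices L = {i \<in> {1, 2, 3}. 0 < L $ i}"

definition pos_subspace :: "real^4 \<Rightarrow> (real^4) set" where
  "pos_subspace L = {x. \<forall>i. i \<notin> pos_indices L \<longrightarrow> x $ i = 0}"

lemma subspace_pos_subspace: "subspace (pos_subspace L)"
  unfolding pos_subspace_def by (rule subspaceI) auto

lemma dim_pos_subspace: "dim (pos_subspace L) = num_pos_spacelike L"
  using dim_substandard_cart[of "pos_indices L", where 'a = real]
  by (simp add: pos_subspace_def pos_indices_def num_pos_spacelike_def dim_vec_eq)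

lemma bform_congruence:
  "bform A (S *v y) (S *v z) = bform (transpose S ** A ** S) y z"
proof -
  have "(S *v y) \<bullet> w = y \<bullet> (transpose S *v w)" for w
    using dot_lmul_matrix[of y "transpose S" w] transpose_matrix_vector[of "transpose S" y] by simp
  then show ?thesis by (simp only: bform_def matrix_vector_mul_assoc matrix_mul_assoc)
qed

lemma bform_diagonal:
  fixes y :: "real^'n"
  shows "bform (\<chi> i j. if i = j then d i else 0) y y = (\<Sum>i\<in>UNIV. d i * (y $ i)\<^sup>2)"
proof -
  have "(\<Sum>j\<in>UNIV. (if i = j then d i else 0) * y $ j) = d i * y $ i" for i
    by (simp add: if_distrib[of "\<lambda>a. a * _"] cong: if_cong)
  then show ?thesis
    by (simp add: bform_def inner_vec_def matrix_vector_mult_def power2_eq_square mult_ac)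
qed

lemma valley_starlike_fibred:
  assumes inv: "invertible \<Lambda>" and m: "base_point M \<Lambda> \<in> LC_inside" and L: "lorentz_eigenvalues \<Lambda> L"
  shows "starlike_fibred (valley M \<Lambda>) (sphere 0 1 \<inter> pos_subspace L)"
proof -
  define m' where "m' = base_point M \<Lambda>"
  define d where "d i = (if i = 0 then L $ i else - L $ i)" for i
  define P where "P = pos_indices L"
  obtain S where S: "proper_lorentz S"
    and D: "transpose S ** \<Lambda> ** S = (\<chi> i j. if i = j then d i else 0)" and L0: "0 < L $ 0"
    using L unfolding lorentz_eigenvalues_def d_def by blast
  have detS: "det S = 1" using S by (simp add: proper_lorentz_def)
  \<comment> \<open>As S has determinant 1, nonsingularity of \<Lambda> means that no diagonal entry
    is 0, on which the division in T relies.\<close>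
  have "det (transpose S ** \<Lambda> ** S) \<noteq> 0"
    using inv by (simp add: det_mul det_transpose detS invertible_det_nz)
  moreover have "det (\<chi> i j. if i = j then d i else 0 :: real^4^4) = (\<Prod>i\<in>UNIV. d i)"
    by (subst det_diagonal) simp_all
  ultimately have d0: "d i \<noteq> 0" for i unfolding D by simp
  have dP: "d i < 0 \<longleftrightarrow> i \<in> P" for i
  proof -
    have "i = 0 \<or> i \<in> {1, 2, 3}" using UNIV_4_eq by blast
    then show ?thesis using L0 by (auto simp: d_def P_def pos_indices_def)
  qed
  \<comment> \<open>In these coordinates the diagonal entries become 1 or -1, with -1 exactly on P,
    so the form is a difference of two squared norms.\<close>
  define T where "T x = S *v (\<chi> i. x $ i / sqrt \<bar>d i\<bar>)" for x
  define u :: "real^4 \<Rightarrow> real^4" where "u x = (\<chi> i. if i \<in> P then x $ i else 0)" for x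
  have T_add: "T (x + y) = T x + T y" for x y
  proof -
    have "(\<chi> i. (x + y) $ i / sqrt \<bar>d i\<bar>) = (\<chi> i. x $ i / sqrt \<bar>d i\<bar>) + (\<chi> i. y $ i / sqrt \<bar>d i\<bar>)"
      by (simp add: vec_eq_iff add_divide_distrib)
    then show ?thesis by (simp add: T_def matrix_vector_right_distrib)
  qed
  have T_scale: "T (c *\<^sub>R x) = c *\<^sub>R T x" for c x
  proof -
    have "(\<chi> i. (c *\<^sub>R x) $ i / sqrt \<bar>d i\<bar>) = c *\<^sub>R (\<chi> i. x $ i / sqrt \<bar>d i\<bar>)"
      by (simp add: vec_eq_iff)
    then show ?thesis by (simp add: T_def matrix_vector_mult_scaleR)
  qed
  have linT: "linear T" by (rule linearI[OF T_add T_scale])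
  have "inj T"
  proof (rule injI)
    fix x y assume "T x = T y"
    moreover have "inj ((*v) S)"
      using detS invertible_det_nz[of S] by (intro inj_matrix_vector_mult) simp
    ultimately have "(\<chi> i. x $ i / sqrt \<bar>d i\<bar>) = (\<chi> i. y $ i / sqrt \<bar>d i\<bar>)"
      unfolding T_def by (rule injD[rotated])
    then show "x = y" using d0 by (simp add: vec_eq_iff)
  qed
  then obtain B where B: "linear B" "\<And>x. B (T x) = x" "\<And>x. T (B x) = x"
    using linear_injective_isomorphism[OF linT] by blast
  have neg: "qform \<Lambda> (T x) < 0 \<longleftrightarrow> norm (x - u x) < norm (u x)" for x
  proof -
    have "qform \<Lambda> (T x) = (\<Sum>i\<in>UNIV. d i * (x $ i / sqrt \<bar>d i\<bar>)\<^sup>2)"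
      unfolding qform_bform T_def bform_congruence D bform_diagonal by simp
    also have "\<dots> = (\<Sum>i\<in>UNIV. ((x - u x) $ i)\<^sup>2 - (u x $ i)\<^sup>2)"
    proof (rule sum.cong[OF refl])
      fix i
      have "d i * (x $ i / sqrt \<bar>d i\<bar>)\<^sup>2 = d i / \<bar>d i\<bar> * (x $ i)\<^sup>2" by (simp add: power_divide)
      also have "\<dots> = ((x - u x) $ i)\<^sup>2 - (u x $ i)\<^sup>2"
        using d0[of i] dP[of i] by (cases "i \<in> P") (auto simp: u_def)
      finally show "d i * (x $ i / sqrt \<bar>d i\<bar>)\<^sup>2 = ((x - u x) $ i)\<^sup>2 - (u x $ i)\<^sup>2" .
    qed
    also have "\<dots> = (norm (x - u x))\<^sup>2 - (norm (u x))\<^sup>2"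
      unfolding power2_norm_eq_inner inner_vec_def by (simp add: sum_subtractf power2_eq_square)
    finally show ?thesis
      using power_strict_mono[of "norm (x - u x)" "norm (u x)" 2] power2_less_imp_less[of "norm (x - u x)" "norm (u x)"]
      by auto
  qed
  \<comment> \<open>Concavity of the gap survives because \<open>m' + T x\<close> is affine in x,
    and \<open>0 < \<Psi> 0\<close> says that the base point is strictly inside.\<close>
  define \<Psi> where "\<Psi> x = lightcone_gap (m' + T x)" for x
  have W: "starlike_fibred {x. 0 \<le> \<Psi> x \<and> norm (x - u x) < norm (u x)} (sphere 0 1 \<inter> {x. u x = x})"
  proof (rule starlike_fibred_cone)
    show "linear u" by (rule linearI) (simp_all add: u_def vec_eq_iff)
    show "u (u x) = u x" for x by (simp add: u_def vec_eq_iff)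
    show "continuous_on UNIV \<Psi>"
      unfolding \<Psi>_def
      by (intro continuous_on_compose2[OF continuous_on_lightcone_gap[of UNIV]] continuous_intros
          linear_continuous_on_compose[OF continuous_on_id linT]) auto
    show "0 < \<Psi> 0" using m linear_0[OF linT] by (simp add: \<Psi>_def m'_def LC_inside_iff_gap)
    show "(1 - t) * \<Psi> x + t * \<Psi> y \<le> \<Psi> ((1 - t) *\<^sub>R x + t *\<^sub>R y)" if "0 \<le> t" "t \<le> 1" for t x y
    proof -
      have "m' + T ((1 - t) *\<^sub>R x + t *\<^sub>R y) = (1 - t) *\<^sub>R (m' + T x) + t *\<^sub>R (m' + T y)"
        unfolding T_add T_scale by (simp add: algebra_simps)
      then show ?thesis unfolding \<Psi>_def using lightcone_gap_concave[OF that, of "m' + T x" "m' + T y"] by simp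
    qed
  qed
  have "valley M \<Lambda> = (\<lambda>x. m' + T x) ` {x. 0 \<le> \<Psi> x \<and> norm (x - u x) < norm (u x)}"
  proof (intro equalityI subsetI)
    fix r assume "r \<in> valley M \<Lambda>"
    then have r: "r \<in> LC_plus" "qform \<Lambda> (r - m') < 0" by (auto simp: valley_def m'_def)
    have e: "m' + T (B (r - m')) = r" by (simp add: B(3))
    have "qform \<Lambda> (T (B (r - m'))) < 0" using r(2) by (simp add: B(3))
    then have "B (r - m') \<in> {x. 0 \<le> \<Psi> x \<and> norm (x - u x) < norm (u x)}"
      using r(1) by (simp add: neg \<Psi>_def e LC_plus_iff_gap)
    then show "r \<in> (\<lambda>x. m' + T x) ` {x. 0 \<le> \<Psi> x \<and> norm (x - u x) < norm (u x)}"
      using e by (intro image_eqI[of _ _ "B (r - m')"]) simp_all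
  next
    fix r assume "r \<in> (\<lambda>x. m' + T x) ` {x. 0 \<le> \<Psi> x \<and> norm (x - u x) < norm (u x)}"
    then obtain x where "0 \<le> \<Psi> x" "norm (x - u x) < norm (u x)" "r = m' + T x" by blast
    then show "r \<in> valley M \<Lambda>"
      using neg[of x] by (simp add: valley_def \<Psi>_def LC_plus_iff_gap flip: m'_def)
  qed
  moreover have "{x. u x = x} = pos_subspace L"
    by (auto simp: u_def pos_subspace_def P_def vec_eq_iff)
  ultimately show ?thesis using starlike_fibred_affine_image[OF W linT B(1,2), of m'] by simp
qed

section \<open>Exit points of spacelike rays from the light cone\<close>

text \<open>The positive root of the quadratic \<open>\<lambda> \<mapsto> (m + \<lambda> p)\<^sup>2\<close>, for spacelike \<open>p\<close>.\<close>

definition exit_time :: "real^4 \<Rightarrow> real^4 \<Rightarrow> real" where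
  "exit_time m p =
    (bform minkowski_metric m p + sqrt ((bform minkowski_metric m p)\<^sup>2 - minkowski_sq p * minkowski_sq m))
      / (- minkowski_sq p)"

text \<open>For spacelike p the leading coefficient is negative and the constant term positive,
  hence one root is positive and one negative. The last formula splits off the positive root,
  rescaled to \<open>s = 1\<close>; the other factor is positive for \<open>0 \<le> s\<close>, which
  yields positivity before the exit and uniqueness of the exit.\<close>

lemma exit_time_root:
  assumes m: "0 < minkowski_sq m" and p: "minkowski_sq p < 0"
  shows "0 < exit_time m p" "minkowski_sq (m + exit_time m p *\<^sub>R p) = 0"
    "minkowski_sq (m + (s * exit_time m p) *\<^sub>R p) =
       (1 - s) * (minkowski_sq m - s * minkowski_sq p * (exit_time m p)\<^sup>2)"
proof -
  define A B C where "A = minkowski_sq p" and "B = bform minkowski_metric m p" and "C = minkowski_sq m"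
  define R where "R = sqrt (B\<^sup>2 - A * C)"
  have A: "A < 0" and C: "0 < C" using assms by (simp_all add: A_def C_def)
  have AC: "0 < - (A * C)" using A C by (simp add: mult_neg_pos)
  have R2: "R\<^sup>2 = B\<^sup>2 - A * C" 
  proof -
    have "0 \<le> B\<^sup>2 - A * C" using AC zero_le_power2[of B] by linarith
    then show ?thesis by (simp add: R_def)
  qed
  have ex: "exit_time m p = (B + R) / (- A)" by (simp add: exit_time_def A_def B_def C_def R_def)
  have "\<bar>B\<bar> < R" unfolding R_def using AC by (intro real_less_rsqrt) simp
  then have BR: "0 < B + R" by linarith
  then show "0 < exit_time m p" unfolding ex using A by (simp add: divide_pos_neg zero_less_divide_iff)
  have q: "minkowski_sq (m + t *\<^sub>R p) = C + 2 * t * B + t\<^sup>2 * A" for t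
    by (simp add: minkowski_sq_bform bform_expand transpose_minkowski_metric A_def B_def C_def)
  have Ae: "A * exit_time m p = - (B + R)" unfolding ex using A by simp
  have "A * (C + 2 * exit_time m p * B + (exit_time m p)\<^sup>2 * A) = A * C + 2 * B * (A * exit_time m p) + (A * exit_time m p)\<^sup>2"
    by (simp add: power2_eq_square algebra_simps)
  also have "\<dots> = 0" unfolding Ae using R2 by (simp add: power2_eq_square algebra_simps)
  finally have root: "C + 2 * exit_time m p * B + (exit_time m p)\<^sup>2 * A = 0" using A by simp
  then show "minkowski_sq (m + exit_time m p *\<^sub>R p) = 0" by (simp add: q)
  have "2 * exit_time m p * B = - C - (exit_time m p)\<^sup>2 * A" using root by linarith
  then have "C + 2 * (s * exit_time m p) * B + (s * exit_time m p)\<^sup>2 * A =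
      C + s * (- C - (exit_time m p)\<^sup>2 * A) + s\<^sup>2 * (exit_time m p)\<^sup>2 * A"
    by (simp add: power_mult_distrib mult.assoc mult.left_commute)
  also have "\<dots> = (1 - s) * (C - s * A * (exit_time m p)\<^sup>2)"
    by (simp add: power2_eq_square algebra_simps)
  finally show "minkowski_sq (m + (s * exit_time m p) *\<^sub>R p) =
       (1 - s) * (minkowski_sq m - s * minkowski_sq p * (exit_time m p)\<^sup>2)"
    unfolding q by (simp add: A_def C_def)
qed

text \<open>A null point might lie on the backward cone. Then the time coordinate would vanish for
  some s strictly between 0 and 1, where \<open>minkowski_sq\<close> would be at most 0, although it
  is positive before the exit.\<close>

lemma exit_point_in_LC_surface:
  assumes m: "m \<in> LC_inside" and p: "minkowski_sq p < 0"
  shows "m + exit_time m p *\<^sub>R p \<in> LC_surface"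
proof -
  have m': "0 < minkowski_sq m" "0 < m$0" using m by (auto simp: LC_inside_def)
  note ex = exit_time_root[OF m'(1) p]
  have "0 \<le> (m + exit_time m p *\<^sub>R p) $ 0"
  proof (rule ccontr)
    assume "\<not> ?thesis"
    then have neg: "m$0 + exit_time m p * p$0 < 0" by simp
    define k where "k = - (exit_time m p * p$0)"
    have k: "m$0 < k" "0 < k" using neg m'(2) by (simp_all add: k_def)
    define s where "s = m$0 / k"
    have s: "0 < s" "s < 1" unfolding s_def using k m'(2) by simp_all
    have "(m + (s * exit_time m p) *\<^sub>R p) $ 0 = m$0 - s * k" by (simp add: k_def)
    also have "\<dots> = 0" unfolding s_def using k by simp
    finally have "minkowski_sq (m + (s * exit_time m p) *\<^sub>R p) \<le> 0" by (simp add: minkowski_sq_space_part)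
    moreover have "0 < (1 - s) * (minkowski_sq m - s * minkowski_sq p * (exit_time m p)\<^sup>2)"
    proof -
      have "s * minkowski_sq p * (exit_time m p)\<^sup>2 \<le> 0"
        using s p by (simp add: mult_nonneg_nonpos mult_nonpos_nonneg)
      then have "0 < minkowski_sq m - s * minkowski_sq p * (exit_time m p)\<^sup>2" using m'(1) by linarith
      then show ?thesis using s by simp
    qed
    ultimately show False using ex(3)[of s] by linarith
  qed
  then show ?thesis using ex(2) by (simp add: LC_surface_def LC_plus_def)
qed

lemma exit_time_eq_1:
  assumes m: "m \<in> LC_inside" and p: "minkowski_sq p < 0" and r: "minkowski_sq (m + p) = 0"
  shows "exit_time m p = 1"
proof -
  have m': "0 < minkowski_sq m" using m by (auto simp: LC_inside_def)
  \<comment> \<open>If \<open>m + p\<close> is null, this s is a root of the factored quadratic,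
    whose second factor is positive.\<close>
  define s where "s = 1 / exit_time m p"
  have s: "0 < s" "s * exit_time m p = 1" using exit_time_root(1)[OF m' p] by (simp_all add: s_def)
  have "s * minkowski_sq p * (exit_time m p)\<^sup>2 \<le> 0"
    using s p by (simp add: mult_nonneg_nonpos mult_nonpos_nonneg)
  then have "0 < minkowski_sq m - s * minkowski_sq p * (exit_time m p)\<^sup>2" using m' by linarith
  moreover have "(1 - s) * (minkowski_sq m - s * minkowski_sq p * (exit_time m p)\<^sup>2) = 0"
    using exit_time_root(3)[OF m' p, of s] r s(2) by simp
  ultimately have "s = 1" by simp
  then show ?thesis using s(2) by simp
qed

lemma qform_scale: "qform \<Lambda> (c *\<^sub>R p) = c\<^sup>2 * qform \<Lambda> p"
  by (simp add: qform_bform bform_simps power2_eq_square)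

lemma qform_neg_imp_spacelike:
  assumes "\<forall>r\<in>LC_plus - {0}. 0 < qform \<Lambda> r" "qform \<Lambda> p < 0"
  shows "minkowski_sq p < 0"
proof (rule ccontr)
  assume "\<not> minkowski_sq p < 0"
  then have "p \<in> LC_plus \<or> - p \<in> LC_plus" by (auto simp: LC_plus_def minkowski_sq_def)
  moreover have "p \<noteq> 0" using assms(2) by (auto simp: qform_bform bform_simps)
  ultimately have "0 < qform \<Lambda> p \<or> 0 < qform \<Lambda> (- p)"
    using assms(1) by (metis DiffI neg_equal_0_iff_equal singletonD)
  then show False using assms(2) by (simp add: qform_bform bform_simps)
qed

text \<open>Negativity of the form is constant along open rays from m and the light cone is convex,
  so the segment from r to its exit point stays in the valley; on the bottom the exit time is
  1.\<close>

lemma valley_homotopy_eqv_bottom: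
  assumes pos: "\<forall>r\<in>LC_plus - {0}. 0 < qform \<Lambda> r" and base: "base_point M \<Lambda> \<in> LC_inside"
  shows "valley M \<Lambda> homotopy_eqv valley_bottom M \<Lambda>"
proof -
  define m where "m = base_point M \<Lambda>"
  have m: "m \<in> LC_inside" "0 < minkowski_sq m" using base by (auto simp: m_def LC_inside_def)
  define \<rho> where "\<rho> r = m + exit_time m (r - m) *\<^sub>R (r - m)" for r
  have V: "r \<in> valley M \<Lambda> \<longleftrightarrow> r \<in> LC_plus \<and> qform \<Lambda> (r - m) < 0" for r
    by (simp add: valley_def m_def)
  have sp: "minkowski_sq (r - m) < 0" if "r \<in> valley M \<Lambda>" for r
    using qform_neg_imp_spacelike[OF pos] that V by blast
  have surf: "\<rho> r \<in> LC_surface" if "r \<in> valley M \<Lambda>" for r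
    unfolding \<rho>_def by (rule exit_point_in_LC_surface[OF m(1) sp[OF that]])
  have \<rho>V: "\<rho> r \<in> valley M \<Lambda>" if r: "r \<in> valley M \<Lambda>" for r
  proof -
    have "0 < exit_time m (r - m)" by (rule exit_time_root(1)[OF m(2) sp[OF r]])
    then have "qform \<Lambda> (\<rho> r - m) < 0" using r by (simp add: V \<rho>_def qform_scale mult_pos_neg)
    moreover have "\<rho> r \<in> LC_plus" using surf[OF r] by (simp add: LC_surface_def)
    ultimately show ?thesis by (simp add: V)
  qed
  have cont: "continuous_on (valley M \<Lambda>) \<rho>"
  proof -
    have nz: "- minkowski_sq (r - m) \<noteq> 0" if "r \<in> valley M \<Lambda>" for r using sp[OF that] by simp
    then show ?thesis
      unfolding \<rho>_def exit_time_def minkowski_sq_bform by (intro continuous_intros ballI) auto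
  qed
  have seg: "closed_segment r (\<rho> r) \<subseteq> valley M \<Lambda>" if r: "r \<in> valley M \<Lambda>" for r
  proof
    fix x assume "x \<in> closed_segment r (\<rho> r)"
    then obtain t where t: "0 \<le> t" "t \<le> 1" "x = (1 - t) *\<^sub>R r + t *\<^sub>R \<rho> r" unfolding in_segment by blast
    have "0 \<le> (1 - t) * lightcone_gap r + t * lightcone_gap (\<rho> r)"
      using r \<rho>V[OF r] t by (simp add: V LC_plus_iff_gap)
    also have "\<dots> \<le> lightcone_gap x" unfolding t(3) by (rule lightcone_gap_concave[OF t(1,2)])
    finally have "x \<in> LC_plus" by (simp add: LC_plus_iff_gap)
    moreover have "qform \<Lambda> (x - m) < 0"
    proof -
      define c where "c = (1 - t) + t * exit_time m (r - m)"
      have "x - m = c *\<^sub>R (r - m)" by (simp add: t(3) \<rho>_def c_def algebra_simps)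
      moreover have "0 < exit_time m (r - m)" by (rule exit_time_root(1)[OF m(2) sp[OF r]])
      then have "0 < c"
      proof (cases "t = 0")
        case False
        then have "0 < t * exit_time m (r - m)" using t \<open>0 < exit_time m (r - m)\<close> by simp
        then show ?thesis using t by (simp add: c_def)
      qed (simp add: c_def)
      ultimately show ?thesis using r by (simp add: V qform_scale mult_pos_neg)
    qed
    ultimately show "x \<in> valley M \<Lambda>" by (simp add: V)
  qed
  show ?thesis
  proof (rule deformation_retract_imp_homotopy_eqv)
    show "homotopic_with_canon (\<lambda>x. True) (valley M \<Lambda>) (valley M \<Lambda>) id \<rho>"
      by (rule homotopic_with_linear) (use cont seg in simp_all)
    show "retraction (valley M \<Lambda>) (valley_bottom M \<Lambda>) \<rho>"
      unfolding retraction_def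
    proof (intro conjI ballI)
      show "valley_bottom M \<Lambda> \<subseteq> valley M \<Lambda>" by (simp add: valley_bottom_def)
      show "\<rho> \<in> valley M \<Lambda> \<rightarrow> valley_bottom M \<Lambda>" using \<rho>V surf by (simp add: valley_bottom_def)
      fix r assume "r \<in> valley_bottom M \<Lambda>"
      then have r: "r \<in> valley M \<Lambda>" "minkowski_sq r = 0" by (auto simp: valley_bottom_def LC_surface_def)
      then have "exit_time m (r - m) = 1" by (intro exit_time_eq_1 m(1) sp) simp_all
      then show "\<rho> r = r" by (simp add: \<rho>_def)
    qed (rule cont)
  qed
qed

lemma unit_sphere_pos_subspace_homeomorphic:
  assumes "num_pos_spacelike L = DIM('a)"
  shows "(sphere 0 1 \<inter> pos_subspace L) homeomorphic sphere (0::'a::euclidean_space) 1"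
  using sphere_subspaces_homeomorphic[OF subspace_pos_subspace subspace_UNIV, of L, where 'b = 'a] assms
  by (simp add: dim_pos_subspace)

text \<open>That the number of positive eigenvalues determines the topology is rendered by comparing
  two potentials with equal numbers: both valleys are equivalent to unit spheres of subspaces of the
  same dimension. Ranging over all L covers every diagonalising frame, so no frame has to be singled
  out.\<close>

theorem mainTheorem8:
  fixes M :: "real^4" and \<Lambda> :: "real^4^4"
  assumes "transpose \<Lambda> = \<Lambda>"
    and "invertible \<Lambda>"
    and "\<forall>r \<in> LC_plus - {0}. 0 < qform \<Lambda> r"
    and "base_point M \<Lambda> \<in> LC_inside"
  shows "valley M \<Lambda> homotopy_eqv valley_bottom M \<Lambda> \<and>
    (\<exists>L. lorentz_eigenvalues \<Lambda> L) \<and>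
    (\<forall>L. lorentz_eigenvalues \<Lambda> L \<longrightarrow>
      (\<forall>M' \<Lambda>' L'. transpose \<Lambda>' = \<Lambda>' \<and> invertible \<Lambda>' \<and>
          (\<forall>r \<in> LC_plus - {0}. 0 < qform \<Lambda>' r) \<and> base_point M' \<Lambda>' \<in> LC_inside \<and>
          lorentz_eigenvalues \<Lambda>' L' \<and> num_pos_spacelike L' = num_pos_spacelike L
          \<longrightarrow> valley M' \<Lambda>' homotopy_eqv valley M \<Lambda>) \<and>
      (num_pos_spacelike L = 3 \<longrightarrow>
          simply_connected (valley M \<Lambda>) \<and>
          valley M \<Lambda> homotopy_eqv sphere (0 :: real^3) 1 \<and>
          (\<forall>a \<in> valley M \<Lambda>. second_homotopy_group (valley M \<Lambda>) a \<cong> integer_group)) \<and>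
      (num_pos_spacelike L = 2 \<longrightarrow>
          connected (valley M \<Lambda>) \<and>
          \<not> simply_connected (valley M \<Lambda>) \<and>
          valley M \<Lambda> homotopy_eqv sphere (0 :: real^2) 1 \<and>
          (\<forall>a \<in> valley M \<Lambda>. fundamental_group (valley M \<Lambda>) a \<cong> integer_group)) \<and>
      (num_pos_spacelike L = 1 \<longrightarrow>
          \<not> connected (valley M \<Lambda>) \<and>
          card (components (valley M \<Lambda>)) = 2 \<and>
          (\<forall>C \<in> components (valley M \<Lambda>). simply_connected C)))"
proof (intro conjI allI impI)
  show "valley M \<Lambda> homotopy_eqv valley_bottom M \<Lambda>"
    by (rule valley_homotopy_eqv_bottom[OF assms(3,4)])
  show "\<exists>L. lorentz_eigenvalues \<Lambda> L" by (rule lorentz_eigenvalues_exist[OF assms(1,3)])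
next
  fix L assume L: "lorentz_eigenvalues \<Lambda> L"
  let ?S = "sphere 0 1 \<inter> pos_subspace L"
  note fib = valley_starlike_fibred[OF assms(2,4) L]
  note eqv = starlike_fibred_homotopy_eqv[OF fib]
  show "valley M' \<Lambda>' homotopy_eqv valley M \<Lambda>"
    if *: "transpose \<Lambda>' = \<Lambda>' \<and> invertible \<Lambda>' \<and>
      (\<forall>r \<in> LC_plus - {0}. 0 < qform \<Lambda>' r) \<and> base_point M' \<Lambda>' \<in> LC_inside \<and>
      lorentz_eigenvalues \<Lambda>' L' \<and> num_pos_spacelike L' = num_pos_spacelike L" for M' \<Lambda>' L'
  proof -
    have "valley M' \<Lambda>' homotopy_eqv (sphere 0 1 \<inter> pos_subspace L')"
      using * by (intro starlike_fibred_homotopy_eqv valley_starlike_fibred) simp_all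
    also have "(sphere 0 1 \<inter> pos_subspace L') homotopy_eqv ?S"
      using * by (intro homeomorphic_imp_homotopy_eqv sphere_subspaces_homeomorphic subspace_pos_subspace)
        (simp add: dim_pos_subspace)
    also have "?S homotopy_eqv valley M \<Lambda>" by (rule homotopy_equivalent_space_sym[THEN iffD1, OF eqv])
    finally show ?thesis .
  qed
  {
    assume n: "num_pos_spacelike L = 3"
    have "?S homeomorphic sphere (0 :: real^3) 1"
      using unit_sphere_pos_subspace_homeomorphic[of L, where 'a = "real^3"] n by simp
    from homotopy_eqv_trans[OF eqv homeomorphic_imp_homotopy_eqv[OF this]]
    have e: "valley M \<Lambda> homotopy_eqv sphere (0 :: real^3) 1" .
    then show "valley M \<Lambda> homotopy_eqv sphere (0 :: real^3) 1" .
    show "simply_connected (valley M \<Lambda>)"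
      using homotopy_eqv_simple_connectedness[OF e] by (simp add: simply_connected_sphere_eq)
    show "\<forall>a \<in> valley M \<Lambda>. second_homotopy_group (valley M \<Lambda>) a \<cong> integer_group"
      using starlike_fibred_second_homotopy_group[OF fib subspace_pos_subspace] n
      by (simp add: dim_pos_subspace)
  next
    assume n: "num_pos_spacelike L = 2"
    have hom: "?S homeomorphic sphere (0 :: real^2) 1"
      using unit_sphere_pos_subspace_homeomorphic[of L, where 'a = "real^2"] n by simp
    have e: "valley M \<Lambda> homotopy_eqv sphere (0 :: real^2) 1"
      by (rule homotopy_eqv_trans[OF eqv homeomorphic_imp_homotopy_eqv[OF hom]])
    then show "valley M \<Lambda> homotopy_eqv sphere (0 :: real^2) 1" .
    have "connected (sphere (0 :: real^2) 1)" by (rule connected_sphere) simp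
    then have "connected ?S" using homeomorphic_connectedness[OF hom] by simp
    moreover have "?S \<noteq> {}" using hom by (auto simp: homeomorphic_empty)
    ultimately show "connected (valley M \<Lambda>)" by (rule starlike_fibred_connected[OF fib])
    show "\<not> simply_connected (valley M \<Lambda>)"
      using homotopy_eqv_simple_connectedness[OF e] by (simp add: simply_connected_sphere_eq)
    show "\<forall>a \<in> valley M \<Lambda>. fundamental_group (valley M \<Lambda>) a \<cong> integer_group"
      using starlike_fibred_fundamental_group[OF fib subspace_pos_subspace] n
      by (simp add: dim_pos_subspace)
  next
    assume n: "num_pos_spacelike L = 1"
    have "?S homeomorphic sphere (0 :: real) 1"
      using unit_sphere_pos_subspace_homeomorphic[of L, where 'a = real] n by simp
    moreover have "sphere (0 :: real) 1 = {1, -1}" by auto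
    ultimately have card: "card ?S = 2"
      using homeomorphic_finite[of "sphere (0 :: real) 1" ?S] by simp
    show "\<not> connected (valley M \<Lambda>)" "card (components (valley M \<Lambda>)) = 2"
      "\<forall>C \<in> components (valley M \<Lambda>). simply_connected C"
      using starlike_fibred_two_points[OF fib card] by blast+
  }
qed

end
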